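(* Let $\Gamma$ be a finite graph that is not a join and that contains at least two vertices. If $A(\Gamma)$ is coarsely separable by a family of subexponential growth, then, for every $k \geq 0$, there exists a weight $\nu : V(\Gamma) \to \mathbb{N}_{\geq 2}$ with $\nu \geq k$ (that is, $\nu(u) \geq k$ for all $u \in V(\Gamma)$) such that $\Gamma(\nu)$ is coarsely separable by a family of subexponential growth.
   Context: Graphs are simple. A graph is a join if its vertex-set can be partitioned into two non-empty subsets such that every vertex of the first is adjacent to every vertex of the second. $A(\Gamma)$ is the right-angled Artin group with generators the vertices of $\Gamma$, two generators commuting whenever the vertices are adjacent. For a weight $\nu : V(\Gamma) \to \mathbb{N}_{\geq 2}$, $\Gamma(\nu)$ is the graph product of the cyclic groups $\mathbb{Z}_{\nu(u)}$ of order $\nu(u)$, $u \in V(\Gamma)$: the quotient of the free product of the $\mathbb{Z}_{\nu(u)}$ by the relations $[g,h]=1$ for $g \in \mathbb{Z}_{\nu(u)}$, $h \in \mathbb{Z}_{\nu(v)}$ with $u,v$ adjacent. Coarse separation. Graphs are identified with their vertex-sets with the graph metric. For a metric space $X$, $Z \subseteq X$ and $L \geq 0$, set $Z^{+L} = \{x \in X \mid d(x,Z) \leq L\}$. A subset is $k$-connected if any two of its points are joined by a finite chain of points of the subset with consecutive points at distance $\leq k$; $k$-connected components are maximal $k$-connected subsets. A collection $\mathcal{A}$ of subspaces of $X$ is coarsely separated by a collection $\mathcal{Z}$ of subspaces if there exist $k, L \geq 0$ such that, for every $D \geq 0$, there are $A \in \mathcal{A}$ and $Z \in \mathcal{Z}$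 such that $A$ is $k$-connected and $A \setminus Z^{+L}$ has at least two $k$-connected components containing points at distance $\geq D$ from $Z$. A subspace $Y$ is coarsely separated by $\mathcal{Z}$ if $\{Y\}$ is. Growth. For a family $\mathcal{S}$ of subsets of a bounded degree graph $X$, set $V_{\mathcal{S}}(R) = \sup_{s \in S,\, S \in \mathcal{S}} |B_X(s,R) \cap S|$. The family has exponential growth if $\limsup_{r \to \infty} \frac{1}{r} \log V_{\mathcal{S}}(r) > 0$, and subexponential growth otherwise. A finitely generated group is coarsely separable by a family of subexponential growth if one of its Cayley graphs (with respect to a finite generating set) is coarsely separated by a family of subsets of subexponential growth. *)

theory Defs
  imports
    Complex_Main
    "HOL-Library.Extended_Real"
    "HOL-Algebra.Generated_Groups"
    "HOL-Algebra.Elementary_Groups"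
    "Graph_Theory.Pair_Digraph"
begin

section \<open>Graphs\<close>

text \<open>Simple graphs are loopless symmetric digraphs without parallel arcs: \<^const>\<open>pair_graph\<close> when
  finite, \<^const>\<open>pair_bidirected_digraph\<close> in general.\<close>

definition is_join :: "'v pair_pre_digraph \<Rightarrow> bool" where
  "is_join \<Gamma> \<longleftrightarrow> (\<exists>A B. A \<noteq> {} \<and> B \<noteq> {} \<and> A \<inter> B = {} \<and> A \<union> B = pverts \<Gamma> \<and>
     (\<forall>a\<in>A. \<forall>b\<in>B. (a, b) \<in> parcs \<Gamma>))"

text \<open>The length of a shortest path. This is meaningful only for vertices in the same connected component.\<close>

definition graph_dist :: "'v pair_pre_digraph \<Rightarrow> 'v \<Rightarrow> 'v \<Rightarrow> real" where
  "graph_dist X x y =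
     real (LEAST n. \<exists>p. pre_digraph.awalk (with_proj X) x p y \<and> length p = n)"


section \<open>Free groups, free products and quotients by relations\<close>

definition word_step :: "'l set \<Rightarrow> ('l list \<times> 'l list) set \<Rightarrow> 'l list rel" where
  "word_step L R = {(a @ u @ b, a @ v @ b) | a u v b.
     a \<in> lists L \<and> b \<in> lists L \<and> u \<in> lists L \<and> v \<in> lists L \<and> (u, v) \<in> R}"

text \<open>The congruence on words over \<open>L\<close> generated by \<open>R\<close>.\<close>

definition word_cong :: "'l set \<Rightarrow> ('l list \<times> 'l list) set \<Rightarrow> 'l list rel" where
  "word_cong L R = {(u, v) \<in> (word_step L R \<union> (word_step L R)\<inverse>)\<^sup>*. u \<in> lists L \<and> v \<in> lists L}"

definition word_monoid :: "'l set \<Rightarrow> ('l list \<times> 'l list) set \<Rightarrow> 'l list set monoid" where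
  "word_monoid L R =
     \<lparr>carrier = lists L // word_cong L R,
      monoid.mult = (\<lambda>A B. \<Union>a\<in>A. \<Union>b\<in>B. word_cong L R `` {a @ b}),
      one = word_cong L R `` {[]}\<rparr>"

text \<open>The letter \<open>(x, True)\<close> stands for \<open>x\<close> and \<open>(x, False)\<close> for its inverse.\<close>

definition free_group_relations :: "'a set \<Rightarrow> (('a \<times> bool) list \<times> ('a \<times> bool) list) set" where
  "free_group_relations S = {([(x, e), (x, \<not> e)], []) | x e. x \<in> S}"

definition free_group :: "'a set \<Rightarrow> ('a \<times> bool) list set monoid" where
  "free_group S = word_monoid (S \<times> UNIV) (free_group_relations S)"

definition free_group_gen :: "'a set \<Rightarrow> 'a \<Rightarrow> ('a \<times> bool) list set" where
  "free_group_gen S x = word_cong (S \<times> UNIV) (free_group_relations S) `` {[(x, True)]}"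

definition free_product_relations ::
    "'i set \<Rightarrow> ('i \<Rightarrow> ('g, 'm) monoid_scheme) \<Rightarrow> (('i \<times> 'g) list \<times> ('i \<times> 'g) list) set" where
  "free_product_relations I G =
     {([(i, \<one>\<^bsub>G i\<^esub>)], []) | i. i \<in> I} \<union>
     {([(i, g), (i, h)], [(i, g \<otimes>\<^bsub>G i\<^esub> h)]) | i g h.
        i \<in> I \<and> g \<in> carrier (G i) \<and> h \<in> carrier (G i)}"

definition free_product ::
    "'i set \<Rightarrow> ('i \<Rightarrow> ('g, 'm) monoid_scheme) \<Rightarrow> ('i \<times> 'g) list set monoid" where
  "free_product I G =
     word_monoid (SIGMA i:I. carrier (G i)) (free_product_relations I G)"

definition free_product_inj ::
    "'i set \<Rightarrow> ('i \<Rightarrow> ('g, 'm) monoid_scheme) \<Rightarrow> 'i \<Rightarrow> 'g \<Rightarrow> ('i \<times> 'g) list set" where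
  "free_product_inj I G i g =
     word_cong (SIGMA i:I. carrier (G i)) (free_product_relations I G) `` {[(i, g)]}"

definition commutator :: "('g, 'm) monoid_scheme \<Rightarrow> 'g \<Rightarrow> 'g \<Rightarrow> 'g" where
  "commutator G g h = g \<otimes>\<^bsub>G\<^esub> h \<otimes>\<^bsub>G\<^esub> inv\<^bsub>G\<^esub> g \<otimes>\<^bsub>G\<^esub> inv\<^bsub>G\<^esub> h"

definition quotient_by_relators :: "('g, 'm) monoid_scheme \<Rightarrow> 'g set \<Rightarrow> 'g set monoid" where
  "quotient_by_relators G R = G Mod ((\<lambda>N. N \<lhd> G) hull R)"

definition raag :: "'v pair_pre_digraph \<Rightarrow> ('v \<times> bool) list set set monoid" where
  "raag \<Gamma> =
     (let F = free_group (pverts \<Gamma>); x = free_group_gen (pverts \<Gamma>)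
      in quotient_by_relators F {commutator F (x u) (x v) | u v. (u, v) \<in> parcs \<Gamma>})"

definition graph_product ::
    "'v pair_pre_digraph \<Rightarrow> ('v \<Rightarrow> ('g, 'm) monoid_scheme) \<Rightarrow> ('v \<times> 'g) list set set monoid" where
  "graph_product \<Gamma> G =
     (let F = free_product (pverts \<Gamma>) G; \<iota> = free_product_inj (pverts \<Gamma>) G
      in quotient_by_relators F
           {commutator F (\<iota> u g) (\<iota> v h) | u v g h.
              (u, v) \<in> parcs \<Gamma> \<and> g \<in> carrier (G u) \<and> h \<in> carrier (G v)})"

definition cyclic_graph_product ::
    "'v pair_pre_digraph \<Rightarrow> ('v \<Rightarrow> nat) \<Rightarrow> ('v \<times> int) list set set monoid" where
  "cyclic_graph_product \<Gamma> \<nu> = graph_product \<Gamma> (\<lambda>u. integer_mod_group (\<nu> u))"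


section \<open>Coarse separation\<close>

text \<open>Metric spaces are given by a carrier \<open>X\<close> and a distance \<open>d\<close>. The distance to a subset takes values in
  \<^typ>\<open>ereal\<close>, so that the distance to the empty set is \<open>\<infinity>\<close>.\<close>

definition dist_to_set :: "('p \<Rightarrow> 'p \<Rightarrow> real) \<Rightarrow> 'p \<Rightarrow> 'p set \<Rightarrow> ereal" where
  "dist_to_set d x Z = (INF z\<in>Z. ereal (d x z))"

definition thickening :: "'p set \<Rightarrow> ('p \<Rightarrow> 'p \<Rightarrow> real) \<Rightarrow> 'p set \<Rightarrow> real \<Rightarrow> 'p set" where
  "thickening X d Z L = {x \<in> X. dist_to_set d x Z \<le> ereal L}"

definition coarsely_connected :: "('p \<Rightarrow> 'p \<Rightarrow> real) \<Rightarrow> real \<Rightarrow> 'p set \<Rightarrow> bool" where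
  "coarsely_connected d k S \<longleftrightarrow>
     (\<forall>x\<in>S. \<forall>y\<in>S. (x, y) \<in> {(a, b). a \<in> S \<and> b \<in> S \<and> d a b \<le> k}\<^sup>*)"

definition coarse_component :: "('p \<Rightarrow> 'p \<Rightarrow> real) \<Rightarrow> real \<Rightarrow> 'p set \<Rightarrow> 'p set \<Rightarrow> bool" where
  "coarse_component d k S C \<longleftrightarrow>
     C \<subseteq> S \<and> coarsely_connected d k C \<and>
     (\<forall>C'. C \<subseteq> C' \<and> C' \<subseteq> S \<and> coarsely_connected d k C' \<longrightarrow> C' = C)"

definition coarsely_separated ::
    "'p set \<Rightarrow> ('p \<Rightarrow> 'p \<Rightarrow> real) \<Rightarrow> 'p set set \<Rightarrow> 'p set set \<Rightarrow> bool" where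
  "coarsely_separated X d \<A> \<Z> \<longleftrightarrow>
     (\<exists>k\<ge>0. \<exists>L\<ge>0. \<forall>D\<ge>0. \<exists>A\<in>\<A>. \<exists>Z\<in>\<Z>.
        coarsely_connected d k A \<and>
        (\<exists>C1 C2. C1 \<noteq> C2 \<and>
           (\<forall>C\<in>{C1, C2}. coarse_component d k (A - thickening X d Z L) C \<and>
              (\<exists>x\<in>C. ereal D \<le> dist_to_set d x Z))))"


section \<open>Growth and coarse separability of groups\<close>

text \<open>In a graph of bounded degree, the cardinalities below are finite and bounded for fixed \<open>R\<close>; the
  supremum over an empty set of natural numbers is \<open>0\<close>.\<close>

definition family_growth :: "'v pair_pre_digraph \<Rightarrow> 'v set set \<Rightarrow> real \<Rightarrow> nat" where
  "family_growth X \<S> R =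
     (SUP (S, s) \<in> (SIGMA S:\<S>. S). card ({x \<in> pverts X. graph_dist X s x \<le> R} \<inter> S))"

definition exponential_growth :: "'v pair_pre_digraph \<Rightarrow> 'v set set \<Rightarrow> bool" where
  "exponential_growth X \<S> \<longleftrightarrow>
     Limsup at_top (\<lambda>r::real. ereal (1 / r * ln (real (family_growth X \<S> r)))) > 0"

definition cayley_graph :: "('g, 'm) monoid_scheme \<Rightarrow> 'g set \<Rightarrow> 'g pair_pre_digraph" where
  "cayley_graph G S =
     \<lparr>pverts = carrier G,
      parcs = {(g, g \<otimes>\<^bsub>G\<^esub> s) | g s.
        g \<in> carrier G \<and> s \<in> S \<union> (\<lambda>s. inv\<^bsub>G\<^esub> s) ` S \<and> s \<noteq> \<one>\<^bsub>G\<^esub>}\<rparr>"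

definition coarsely_separable_subexp :: "('g, 'm) monoid_scheme \<Rightarrow> bool" where
  "coarsely_separable_subexp G \<longleftrightarrow>
     (\<exists>S. finite S \<and> S \<subseteq> carrier G \<and> generate G S = carrier G \<and>
        (\<exists>\<Z>. (\<forall>Z\<in>\<Z>. Z \<subseteq> carrier G) \<and>
           \<not> exponential_growth (cayley_graph G S) \<Z> \<and>
           coarsely_separated (carrier G) (graph_dist (cayley_graph G S)) {carrier G} \<Z>))"

section \<open>Well-formedness of the constructions\<close>

lemma equiv_word_cong: "equiv (lists L) (word_cong L R)"
proof (rule equivI)
  show "word_cong L R \<subseteq> lists L \<times> lists L" by (auto simp: word_cong_def)
  show "refl_on (lists L) (word_cong L R)" by (auto simp: refl_on_def word_cong_def)
  have "sym ((word_step L R \<union> (word_step L R)\<inverse>)\<^sup>*)"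
    by (intro sym_rtrancl sym_Un_converse)
  then show "sym (word_cong L R)" by (auto simp: sym_def word_cong_def)
  show "trans (word_cong L R)" by (auto simp: trans_def word_cong_def intro: rtrancl_trans)
qed

lemma trans_word_cong: "trans (word_cong L R)"
  using equiv_word_cong by (auto simp: equiv_def)

lemma word_cong_relation:
  assumes "(u, v) \<in> R" "u \<in> lists L" "v \<in> lists L"
  shows "(u, v) \<in> word_cong L R"
proof -
  have "([] @ u @ [], [] @ v @ []) \<in> word_step L R"
    using assms lists.Nil unfolding word_step_def by blast
  then show ?thesis using assms(2,3) by (auto simp: word_cong_def)
qed

lemma word_cong_context:
  assumes "(u, v) \<in> word_cong L R" "a \<in> lists L" "b \<in> lists L"
  shows "(a @ u @ b, a @ v @ b) \<in> word_cong L R"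
proof -
  have step: "(a @ u @ b, a @ v @ b) \<in> word_step L R" if "(u, v) \<in> word_step L R" for u v
  proof -
    from that obtain a' u' v' b' where "u = a' @ u' @ b'" "v = a' @ v' @ b'"
      "a' \<in> lists L" "b' \<in> lists L" "u' \<in> lists L" "v' \<in> lists L" "(u', v') \<in> R"
      unfolding word_step_def by blast
    moreover from this have "a @ a' \<in> lists L" "b' @ b \<in> lists L"
      using assms(2,3) by simp_all
    ultimately have "((a @ a') @ u' @ b' @ b, (a @ a') @ v' @ b' @ b) \<in> word_step L R"
      unfolding word_step_def by blast
    then show ?thesis using \<open>u = _\<close> \<open>v = _\<close> by simp
  qed
  have "(u, v) \<in> (word_step L R \<union> (word_step L R)\<inverse>)\<^sup>*"
    using assms(1) by (simp add: word_cong_def)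
  then have "(a @ u @ b, a @ v @ b) \<in> (word_step L R \<union> (word_step L R)\<inverse>)\<^sup>*"
  proof induction
    case (step v w)
    then have "(a @ v @ b, a @ w @ b) \<in> word_step L R \<union> (word_step L R)\<inverse>"
      using \<open>\<And>u v. (u, v) \<in> word_step L R \<Longrightarrow> _\<close> by blast
    then show ?case using step.IH by (meson rtrancl.rtrancl_into_rtrancl)
  qed simp
  then show ?thesis using assms by (auto simp: word_cong_def)
qed

lemma word_monoid_mult_class:
  assumes "u \<in> lists L" "v \<in> lists L"
  shows "word_cong L R `` {u} \<otimes>\<^bsub>word_monoid L R\<^esub> word_cong L R `` {v} = word_cong L R `` {u @ v}"
proof -
  have eq: "word_cong L R `` {a @ b} = word_cong L R `` {u @ v}"
    if "(u, a) \<in> word_cong L R" "(v, b) \<in> word_cong L R" for a b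
  proof -
    have "a \<in> lists L" using that(1) by (auto simp: word_cong_def)
    then have "(u @ v, a @ v) \<in> word_cong L R" "(a @ v, a @ b) \<in> word_cong L R"
      using word_cong_context[OF that(1), of "[]" v] word_cong_context[OF that(2), of a "[]"] assms
      by auto
    then show ?thesis
      using equiv_class_eq[OF equiv_word_cong] by metis
  qed
  have uv: "u \<in> word_cong L R `` {u}" "v \<in> word_cong L R `` {v}"
    using assms equiv_class_self[OF equiv_word_cong] by metis+
  have "(\<Union>a\<in>word_cong L R `` {u}. \<Union>b\<in>word_cong L R `` {v}. word_cong L R `` {a @ b})
      = (\<Union>a\<in>word_cong L R `` {u}. \<Union>b\<in>word_cong L R `` {v}. word_cong L R `` {u @ v})"
    by (intro SUP_cong refl eq) blast+
  also have "\<dots> = word_cong L R `` {u @ v}"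
    using uv by blast
  finally show ?thesis by (simp add: word_monoid_def)
qed

lemma group_word_monoid:
  assumes "\<And>x. x \<in> L \<Longrightarrow> \<exists>y\<in>L. ([y, x], []) \<in> word_cong L R"
  shows "group (word_monoid L R)"
proof (rule groupI)
  let ?M = "word_monoid L R" and ?c = "\<lambda>u. word_cong L R `` {u}"
  have car: "carrier ?M = ?c ` lists L" by (auto simp: word_monoid_def quotient_def)
  have one: "\<one>\<^bsub>?M\<^esub> = ?c []" by (simp add: word_monoid_def)
  show "\<one>\<^bsub>?M\<^esub> \<in> carrier ?M" by (auto simp: car one)
  fix x y assume x: "x \<in> carrier ?M"
  then obtain u where u: "u \<in> lists L" "x = ?c u" by (auto simp: car)
  show "\<one>\<^bsub>?M\<^esub> \<otimes>\<^bsub>?M\<^esub> x = x" using u by (simp add: one word_monoid_mult_class)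
  have "\<exists>w\<in>lists L. (w @ u, []) \<in> word_cong L R" using u(1)
  proof induction
    case Nil
    show ?case using equiv_word_cong[of L R]
      by (intro bexI[of _ "[]"]) (auto simp: equiv_def refl_on_def)
  next
    case (Cons a u)
    then obtain w b where w: "w \<in> lists L" "(w @ u, []) \<in> word_cong L R"
      and b: "b \<in> L" "([b, a], []) \<in> word_cong L R" using assms by blast
    have "(w @ [b, a] @ u, w @ [] @ u) \<in> word_cong L R"
      using word_cong_context[OF b(2)] w(1) Cons.hyps by blast
    then have "((w @ [b]) @ a # u, []) \<in> word_cong L R"
      using w(2) equiv_word_cong[of L R] by (auto simp: equiv_def elim: transE)
    then show ?case using w(1) b(1) by (metis append_in_lists_conv lists.simps)
  qed
  then obtain w where "w \<in> lists L" "?c (w @ u) = ?c []"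
    using equiv_class_eq[OF equiv_word_cong] by metis
  then show "\<exists>y\<in>carrier ?M. y \<otimes>\<^bsub>?M\<^esub> x = \<one>\<^bsub>?M\<^esub>"
    using u by (intro bexI[of _ "?c w"]) (auto simp: car one word_monoid_mult_class)
  assume y: "y \<in> carrier ?M"
  then obtain v where v: "v \<in> lists L" "y = ?c v" by (auto simp: car)
  show "x \<otimes>\<^bsub>?M\<^esub> y \<in> carrier ?M" using u v by (auto simp: word_monoid_mult_class car)
  fix z assume "z \<in> carrier ?M"
  then obtain w where w: "w \<in> lists L" "z = ?c w" by (auto simp: car)
  show "x \<otimes>\<^bsub>?M\<^esub> y \<otimes>\<^bsub>?M\<^esub> z = x \<otimes>\<^bsub>?M\<^esub> (y \<otimes>\<^bsub>?M\<^esub> z)"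
    using u v w by (simp add: word_monoid_mult_class)
qed

lemma group_free_group: "group (free_group S)"
  unfolding free_group_def
proof (rule group_word_monoid)
  fix x :: "'a \<times> bool" assume "x \<in> S \<times> UNIV"
  then obtain a e where a: "x = (a, e)" "a \<in> S" by auto
  have "([(a, \<not> e), (a, \<not> \<not> e)], []) \<in> free_group_relations S"
    using a(2) unfolding free_group_relations_def by blast
  then have "([(a, \<not> e), x], []) \<in> word_cong (S \<times> UNIV) (free_group_relations S)"
    by (intro word_cong_relation) (use a in simp_all)
  then show "\<exists>y\<in>S \<times> UNIV. ([y, x], []) \<in> word_cong (S \<times> UNIV) (free_group_relations S)"
    by (rule bexI) (use a(2) in simp)
qed

lemma group_free_product:
  assumes "\<And>i. i \<in> I \<Longrightarrow> group (G i)"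
  shows "group (free_product I G)"
  unfolding free_product_def
proof (rule group_word_monoid)
  let ?L = "SIGMA i:I. carrier (G i)" and ?R = "free_product_relations I G"
  fix x assume "x \<in> ?L"
  then obtain i g where x: "x = (i, g)" "i \<in> I" "g \<in> carrier (G i)" by auto
  interpret group "G i" using assms x by blast
  have "([(i, inv\<^bsub>G i\<^esub> g), (i, g)], [(i, inv\<^bsub>G i\<^esub> g \<otimes>\<^bsub>G i\<^esub> g)]) \<in> ?R"
    using x inv_closed[of g] unfolding free_product_relations_def by blast
  then have cancel: "([(i, inv\<^bsub>G i\<^esub> g), x], [(i, \<one>\<^bsub>G i\<^esub>)]) \<in> word_cong ?L ?R"
    by (intro word_cong_relation) (use x in simp_all)
  have "([(i, \<one>\<^bsub>G i\<^esub>)], []) \<in> ?R"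
    using x unfolding free_product_relations_def by blast
  then have "([(i, \<one>\<^bsub>G i\<^esub>)], []) \<in> word_cong ?L ?R"
    by (intro word_cong_relation) (use x in simp_all)
  with cancel have "([(i, inv\<^bsub>G i\<^esub> g), x], []) \<in> word_cong ?L ?R"
    by (rule transD[OF trans_word_cong])
  then show "\<exists>y\<in>?L. ([y, x], []) \<in> word_cong ?L ?R"
    by (rule bexI) (use x in simp)
qed

lemma (in group) normal_hull:
  assumes "R \<subseteq> carrier G"
  shows "((\<lambda>N. N \<lhd> G) hull R) \<lhd> G"
proof -
  have "carrier G \<lhd> G" using normal_inv_iff subgroup_self by auto
  then have ne: "{N. N \<lhd> G \<and> R \<subseteq> N} \<noteq> {}" using assms by auto
  show ?thesis
    unfolding hull_def normal_inv_iff
    using subgroups_Inter[OF _ ne] normal_inv_iff by auto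
qed

lemma group_quotient_by_relators:
  assumes "group G" "R \<subseteq> carrier G"
  shows "group (quotient_by_relators G R)"
  unfolding quotient_by_relators_def
  using group.normal_hull[OF assms] by (rule normal.factorgroup_is_group)

lemma free_group_gen_in_carrier: "x \<in> S \<Longrightarrow> free_group_gen S x \<in> carrier (free_group S)"
  by (auto simp: free_group_gen_def free_group_def word_monoid_def intro!: quotientI)

lemma free_product_inj_in_carrier:
  "i \<in> I \<Longrightarrow> g \<in> carrier (G i) \<Longrightarrow> free_product_inj I G i g \<in> carrier (free_product I G)"
  by (auto simp: free_product_inj_def free_product_def word_monoid_def intro!: quotientI)

lemma (in group) commutator_closed:
  "g \<in> carrier G \<Longrightarrow> h \<in> carrier G \<Longrightarrow> commutator G g h \<in> carrier G"
  by (simp add: commutator_def)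

lemma group_raag:
  assumes "pair_wf_digraph \<Gamma>"
  shows "group (raag \<Gamma>)"
  unfolding raag_def Let_def
  by (rule group_quotient_by_relators[OF group_free_group])
    (auto dest: pair_wf_digraph.wellformed'[OF assms]
      intro!: group.commutator_closed[OF group_free_group] free_group_gen_in_carrier)

lemma group_graph_product:
  assumes "pair_wf_digraph \<Gamma>" "\<And>u. u \<in> pverts \<Gamma> \<Longrightarrow> group (G u)"
  shows "group (graph_product \<Gamma> G)"
  unfolding graph_product_def Let_def
  by (rule group_quotient_by_relators[OF group_free_product[OF assms(2)]])
    (auto dest: pair_wf_digraph.wellformed'[OF assms(1)]
      intro!: group.commutator_closed[OF group_free_product[OF assms(2)]] free_product_inj_in_carrier)

lemma group_cyclic_graph_product: "pair_wf_digraph \<Gamma> \<Longrightarrow> group (cyclic_graph_product \<Gamma> \<nu>)"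
  unfolding cyclic_graph_product_def by (rule group_graph_product) auto

lemma (in group) cayley_graph_simple:
  assumes "S \<subseteq> carrier G"
  shows "pair_bidirected_digraph (cayley_graph G S)"
proof -
  have sub: "S \<union> (\<lambda>s. inv s) ` S \<subseteq> carrier G" using assms by auto
  have S: "s \<in> carrier G" "inv s \<in> S \<union> (\<lambda>s. inv s) ` S" if "s \<in> S \<union> (\<lambda>s. inv s) ` S" for s
    using that assms by auto
  show ?thesis
  proof unfold_locales
    fix e assume "e \<in> parcs (cayley_graph G S)"
    then obtain g s where e: "e = (g, g \<otimes> s)" "g \<in> carrier G" "s \<in> S \<union> (\<lambda>s. inv s) ` S" "s \<noteq> \<one>"
      by (auto simp: cayley_graph_def)
    show "fst e \<in> pverts (cayley_graph G S)" "snd e \<in> pverts (cayley_graph G S)"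
      using e S by (simp_all add: cayley_graph_def)
    show "fst e \<noteq> snd e"
      using e S(1)[OF e(3)] by simp
  next
    have "(h, g) \<in> parcs (cayley_graph G S)" if gh: "(g, h) \<in> parcs (cayley_graph G S)" for g h
    proof -
      from gh obtain s where s: "h = g \<otimes> s" "g \<in> carrier G" "s \<in> S \<union> (\<lambda>s. inv s) ` S" "s \<noteq> \<one>"
        by (auto simp: cayley_graph_def)
      have "g = h \<otimes> inv s" "h \<in> carrier G" "inv s \<noteq> \<one>"
        using s S(1)[OF s(3)] by (simp_all add: m_assoc inv_eq_1_iff)
      then show ?thesis using S(2)[OF s(3)] unfolding cayley_graph_def by auto
    qed
    then show "symmetric (with_proj (cayley_graph G S))"
      by (auto simp: symmetric_def sym_def)
  qed
qed

end

theory Submission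
  imports Defs "HOL-Algebra.Bij"
begin

text \<open>
  Let \<open>A\<close> be the Artin group and \<open>P\<close> the graph product for a constant weight \<open>N \<ge> 3\<close>. The idea is to
  cover \<open>A\<close> by translates of a copy of \<open>P\<close> and to show that, if subsets of subexponential growth cut
  \<open>A\<close>, then they already cut one of the translates.

  The copy of \<open>P\<close> is the image of a map \<open>s : P \<Rightarrow> A\<close> which is a section of the reduction
  \<open>A \<Rightarrow> P\<close> of all exponents modulo \<open>N\<close>, hence injective, and which moves neighbours to
  points at bounded distance. The cyclic group of order \<open>N\<close>
  acts on the integers by rotating every block \<open>{q N, \<dots>, q N + N - 1}\<close>. For a vertex
  \<open>u\<close>, multiply an element of \<open>A\<close> on the right by the power of \<open>u\<close> which performs such a rotation on
  its exponent sum in \<open>u\<close>. This gives an action of the cyclic group on the set \<open>A\<close>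
  (\<open>turn_add\<close>), and the actions of adjacent vertices commute (\<open>turn_commute\<close>), so the graph product
  acts on the set \<open>A\<close>. The section is the orbit map of the neutral element (\<open>reduce_lift\<close>,
  \<open>lift_step\<close>).

  Every vertex \<open>u\<close> has a non-neighbour \<open>v \<noteq> u\<close>, since otherwise \<open>u\<close> and the remaining vertices would form a
  join. Different words of equal length in the two letters \<open>[u, v]\<close> and \<open>[u, v\<^sup>2]\<close> represent different
  elements of \<open>A\<close> (\<open>letters_free\<close>). While such a word is spelled out, the exponent sums of \<open>u\<close> and \<open>v\<close> stay between \<open>0\<close> and
  \<open>2\<close>, even after starting at \<open>u\<close>, so no block boundary is crossed and the word lies both in \<open>s(P)\<close> and in
  \<open>u\<^sup>-\<^sup>1 s(P)\<close> (\<open>lift_image_words\<close>). Consequently two translates \<open>g s(P)\<close> and \<open>g u s(P)\<close> overlap in a set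
  of exponential growth. A set \<open>Z\<close> from a family of subexponential growth cannot stay close to all
  of it, so the overlap contains points as far from \<open>Z\<close> as desired
  (\<open>exponential_set_leaves_nbhd\<close>).

  Walking through \<open>A\<close> along generators therefore gives chains of translates, consecutive ones sharing a
  point far from \<open>Z\<close>. If \<open>Z\<close> separated two far points of \<open>A\<close> but no two far points of a single
  translate, such a chain would connect them, a contradiction. So some translate is
  separated, and pulling \<open>Z\<close> back along an injective Lipschitz map yields separating sets in \<open>P\<close> that
  are still of subexponential growth (\<open>coarsely_separable_subexp_pullback\<close>).
\<close>

section \<open>Cayley graphs and their word metrics\<close>

context group
begin

primrec word_ball :: "'a set \<Rightarrow> nat \<Rightarrow> 'a set" where
  "word_ball S 0 = {\<one>}"
| "word_ball S (Suc n) = word_ball S n \<union> {g \<otimes> s |g s. g \<in> word_ball S n \<and> s \<in> S \<union> (\<lambda>s. inv s) ` S}"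

lemma word_ball_subset: "S \<subseteq> carrier G \<Longrightarrow> word_ball S n \<subseteq> carrier G"
  by (induction n) auto

lemma one_in_word_ball: "\<one> \<in> word_ball S n"
  by (induction n) auto

lemma finite_word_ball: "finite S \<Longrightarrow> finite (word_ball S n)"
proof (induction n)
  case (Suc n)
  have "word_ball S (Suc n)
      = word_ball S n \<union> (\<lambda>(g, s). g \<otimes> s) ` (word_ball S n \<times> (S \<union> (\<lambda>s. inv s) ` S))"
    by auto
  then show ?case using Suc by (metis finite_SigmaI finite_UnI finite_imageI)
qed simp

lemma word_ball_mono: "m \<le> n \<Longrightarrow> word_ball S m \<subseteq> word_ball S n"
  by (rule lift_Suc_mono_le) auto

lemma word_ball_mult:
  assumes "S \<subseteq> carrier G" "a \<in> word_ball S m" "b \<in> word_ball S n"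
  shows "a \<otimes> b \<in> word_ball S (m + n)"
  using assms(3)
proof (induction n arbitrary: b)
  case 0
  have "a \<in> carrier G" using assms word_ball_subset[OF assms(1)] by blast
  then show ?case using 0 assms by simp
next
  case (Suc n)
  show ?case
  proof (cases "b \<in> word_ball S n")
    case True
    then show ?thesis using Suc.IH by simp
  next
    case False
    then obtain g s where g: "b = g \<otimes> s" "g \<in> word_ball S n" "s \<in> S \<union> (\<lambda>s. inv s) ` S"
      using Suc.prems by auto
    have "a \<in> carrier G" "g \<in> carrier G" "s \<in> carrier G"
      using assms g word_ball_subset[OF assms(1)] by auto
    then have "a \<otimes> b = (a \<otimes> g) \<otimes> s" by (simp add: g m_assoc)
    moreover have "a \<otimes> g \<in> word_ball S (m + n)" using Suc.IH g by blast
    ultimately show ?thesis using g(3) by auto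
  qed
qed

lemma word_ball_1: "S \<subseteq> carrier G \<Longrightarrow> s \<in> S \<union> (\<lambda>s. inv s) ` S \<Longrightarrow> s \<in> word_ball S 1"
proof -
  assume a: "S \<subseteq> carrier G" "s \<in> S \<union> (\<lambda>s. inv s) ` S"
  then have "s = \<one> \<otimes> s" by auto
  then show ?thesis using a(2) by auto
qed

lemma word_ball_inv:
  assumes "S \<subseteq> carrier G" "a \<in> word_ball S n"
  shows "inv a \<in> word_ball S n"
  using assms(2)
proof (induction n arbitrary: a)
  case (Suc n)
  show ?case
  proof (cases "a \<in> word_ball S n")
    case True
    then show ?thesis using Suc.IH by simp
  next
    case False
    then obtain g s where g: "a = g \<otimes> s" "g \<in> word_ball S n" "s \<in> S \<union> (\<lambda>s. inv s) ` S"
      using Suc.prems by auto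
    have c: "g \<in> carrier G" "s \<in> carrier G"
      using assms g word_ball_subset[OF assms(1)] by auto
    have "inv s \<in> S \<union> (\<lambda>s. inv s) ` S" using g(3) assms(1) by auto
    then have "inv s \<in> word_ball S 1" using word_ball_1 assms(1) by blast
    then have "inv s \<otimes> inv g \<in> word_ball S (1 + n)"
      using word_ball_mult[OF assms(1)] Suc.IH g by blast
    then show ?thesis using c by (simp add: g inv_mult_group)
  qed
qed simp

lemma word_ball_exhausts:
  assumes "S \<subseteq> carrier G" "g \<in> generate G S"
  shows "\<exists>n. g \<in> word_ball S n"
  using assms(2)
proof induction
  case one
  show ?case using one_in_word_ball by blast
next
  case (incl h)
  then show ?case using word_ball_1[OF assms(1)] by blast
next
  case (inv h)
  then show ?case using word_ball_1[OF assms(1)] by blast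
next
  case (eng h1 h2)
  then show ?case using word_ball_mult[OF assms(1)] by blast
qed

lemma finite_subset_word_ball:
  assumes "S \<subseteq> carrier G" "finite K" "K \<subseteq> generate G S"
  shows "\<exists>n. K \<subseteq> word_ball S n"
  using assms(2,3)
proof induction
  case (insert g K)
  then obtain m n where "K \<subseteq> word_ball S n" "g \<in> word_ball S m"
    using word_ball_exhausts[OF assms(1)] by blast
  then have "insert g K \<subseteq> word_ball S (max m n)"
    using word_ball_mono[of m "max m n" S] word_ball_mono[of n "max m n" S] by auto
  then show ?case by blast
qed simp

lemma awalk_cayley_word_ball:
  assumes S: "S \<subseteq> carrier G"
    and "pre_digraph.awalk (with_proj (cayley_graph G S)) g p h"
  shows "h \<in> carrier G \<and> inv g \<otimes> h \<in> word_ball S (length p)"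
  using assms(2)
proof (induction p arbitrary: g)
  case Nil
  then show ?case by (auto simp: pre_digraph.awalk_def pre_digraph.cas.simps cayley_graph_def)
next
  case (Cons e p)
  then have g: "g \<in> carrier G" and e: "e \<in> parcs (cayley_graph G S)" "fst e = g"
    by (auto simp: pre_digraph.awalk_def pre_digraph.cas.simps cayley_graph_def)
  then obtain s where s: "snd e = g \<otimes> s" "s \<in> S \<union> (\<lambda>s. inv s) ` S"
    by (auto simp: cayley_graph_def)
  have sc: "s \<in> carrier G" using s S by auto
  have "pre_digraph.awalk (with_proj (cayley_graph G S)) (g \<otimes> s) p h"
    using Cons.prems g sc s by (auto simp: pre_digraph.awalk_def pre_digraph.cas.simps cayley_graph_def)
  from Cons.IH[OF this] have h: "h \<in> carrier G" "inv (g \<otimes> s) \<otimes> h \<in> word_ball S (length p)" by auto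
  have "s \<otimes> (inv (g \<otimes> s) \<otimes> h) \<in> word_ball S (1 + length p)"
    using word_ball_mult[OF S word_ball_1[OF S s(2)] h(2)] .
  moreover have "s \<otimes> (inv (g \<otimes> s) \<otimes> h) = inv g \<otimes> h"
    using g sc h(1) by (simp add: inv_mult_group m_assoc [symmetric])
  ultimately show ?case using h(1) by simp
qed

lemma word_ball_awalk_cayley:
  assumes S: "S \<subseteq> carrier G" and "g \<in> carrier G" and "a \<in> word_ball S n"
  shows "\<exists>p. pre_digraph.awalk (with_proj (cayley_graph G S)) g p (g \<otimes> a) \<and> length p \<le> n"
proof -
  interpret pair_bidirected_digraph "cayley_graph G S" using cayley_graph_simple[OF S] .
  have pverts_cayley: "pverts (cayley_graph G S) = carrier G" by (simp add: cayley_graph_def)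
  show ?thesis using assms(3)
  proof (induction n arbitrary: a)
    case 0
    have "awalk g [] g" using assms pverts_cayley by (simp add: awalk_Nil_iff)
    then show ?case using 0 assms by auto
  next
    case (Suc n)
    show ?case
    proof (cases "a \<in> word_ball S n")
      case True
      then show ?thesis using Suc.IH le_Suc_eq by blast
    next
      case False
      then obtain b s where b: "a = b \<otimes> s" "b \<in> word_ball S n" "s \<in> S \<union> (\<lambda>s. inv s) ` S"
        using Suc.prems by auto
      have c: "b \<in> carrier G" "s \<in> carrier G"
        using S b word_ball_subset[OF S] by auto
      have "s \<noteq> \<one>" using False b c by (metis r_one)
      then have e: "(g \<otimes> b, g \<otimes> b \<otimes> s) \<in> parcs (cayley_graph G S)"
        using b c assms(2) by (auto simp: cayley_graph_def)
      obtain p where p: "awalk g p (g \<otimes> b)" "length p \<le> n" using Suc.IH b by blast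
      have "awalk (g \<otimes> b) [(g \<otimes> b, g \<otimes> b \<otimes> s)] (g \<otimes> b \<otimes> s)"
        using e pverts_cayley c assms(2) by (simp add: awalk_simps)
      then have "awalk g (p @ [(g \<otimes> b, g \<otimes> b \<otimes> s)]) (g \<otimes> b \<otimes> s)"
        using p by (meson awalk_appendI)
      then show ?thesis using p c assms by (intro exI[of _ "p @ [(g \<otimes> b, g \<otimes> b \<otimes> s)]"]) (simp add: b m_assoc)
    qed
  qed
qed

text \<open>
  This lemma replaces walks in the Cayley graph by products of generators everywhere below. The case of
  an arbitrary real \<open>r\<close> is what thickenings and growth functions refer to.
\<close>
lemma graph_dist_cayley:
  assumes S: "S \<subseteq> carrier G" "generate G S = carrier G" and g: "g \<in> carrier G" "h \<in> carrier G"
  shows "graph_dist (cayley_graph G S) g h \<le> r \<longleftrightarrow> 0 \<le> r \<and> inv g \<otimes> h \<in> word_ball S (nat \<lfloor>r\<rfloor>)"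
proof -
  define P where "P n \<longleftrightarrow> (\<exists>p. pre_digraph.awalk (with_proj (cayley_graph G S)) g p h \<and> length p = n)" for n
  have d: "graph_dist (cayley_graph G S) g h = real (LEAST n. P n)"
    by (simp add: graph_dist_def P_def)
  have gh: "g \<otimes> (inv g \<otimes> h) = h" using g by (simp add: m_assoc [symmetric])
  have 1: "\<exists>m\<le>n. P m" if "inv g \<otimes> h \<in> word_ball S n" for n
    using word_ball_awalk_cayley[OF S(1) g(1) that] by (auto simp: P_def gh)
  obtain n0 where "inv g \<otimes> h \<in> word_ball S n0"
    using word_ball_exhausts[OF S(1)] S(2) g by (metis inv_closed m_closed)
  then have "P (LEAST n. P n)" using 1 by (metis LeastI)
  then have 2: "inv g \<otimes> h \<in> word_ball S (LEAST n. P n)"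
    unfolding P_def using awalk_cayley_word_ball[OF S(1)] by metis
  show ?thesis
  proof
    assume le: "graph_dist (cayley_graph G S) g h \<le> r"
    then have "0 \<le> r" using d by linarith
    moreover have "(LEAST n. P n) \<le> nat \<lfloor>r\<rfloor>" using le d by (simp add: le_nat_floor)
    ultimately show "0 \<le> r \<and> inv g \<otimes> h \<in> word_ball S (nat \<lfloor>r\<rfloor>)" using 2 word_ball_mono by blast
  next
    assume r: "0 \<le> r \<and> inv g \<otimes> h \<in> word_ball S (nat \<lfloor>r\<rfloor>)"
    then obtain m where "m \<le> nat \<lfloor>r\<rfloor>" "P m" using 1 by blast
    then have "(LEAST n. P n) \<le> nat \<lfloor>r\<rfloor>" by (meson Least_le order_trans)
    then show "graph_dist (cayley_graph G S) g h \<le> r" unfolding d using r by linarith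
  qed
qed

end

section \<open>Coarse separation and growth in a finitely generated group\<close>

text \<open>
  Coarse components are easier to handle as reachability classes: maximality over all subsets disappears.
\<close>
definition chain_step :: "('p \<Rightarrow> 'p \<Rightarrow> real) \<Rightarrow> real \<Rightarrow> 'p set \<Rightarrow> 'p rel" where
  "chain_step d k S = {(a, b). a \<in> S \<and> b \<in> S \<and> d a b \<le> k}"

lemma chain_step_mono: "S \<subseteq> T \<Longrightarrow> chain_step d k S \<subseteq> chain_step d k T"
  by (auto simp: chain_step_def)

lemma coarsely_connected_alt:
  "coarsely_connected d k S \<longleftrightarrow> S \<times> S \<subseteq> (chain_step d k S)\<^sup>*"
  by (auto simp: coarsely_connected_def chain_step_def)

lemma sym_chain_step_rtrancl:
  assumes "\<And>a b. a \<in> S \<Longrightarrow> b \<in> S \<Longrightarrow> d a b = d b a"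
  shows "sym ((chain_step d k S)\<^sup>*)"
  by (rule sym_rtrancl) (auto simp: sym_def chain_step_def assms)

text \<open>
  A chain in \<open>S\<close> that starts at \<open>x\<close> never leaves the class of \<open>x\<close>, so it is also a chain in that class;
  conversely a coarsely connected set containing \<open>x\<close> only contains reachable points.
\<close>
lemma coarse_component_reachable:
  assumes sym: "\<And>a b. a \<in> S \<Longrightarrow> b \<in> S \<Longrightarrow> d a b = d b a" and x: "x \<in> S"
  shows "coarse_component d k S {y \<in> S. (x, y) \<in> (chain_step d k S)\<^sup>*}"
proof -
  define C where "C = {y \<in> S. (x, y) \<in> (chain_step d k S)\<^sup>*}"
  have C: "y \<in> C \<longleftrightarrow> y \<in> S \<and> (x, y) \<in> (chain_step d k S)\<^sup>*" for y by (simp add: C_def)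
  have "x \<in> C" using x C by simp
  have CS: "C \<subseteq> S" using C by blast
  have from_x: "(x, y) \<in> (chain_step d k C)\<^sup>*" if "(x, y) \<in> (chain_step d k S)\<^sup>*" for y
    using that
  proof induction
    case base
    show ?case by (rule rtrancl_refl)
  next
    case (step y z)
    have "(x, z) \<in> (chain_step d k S)\<^sup>*" using step.hyps by (rule rtrancl_into_rtrancl)
    moreover have "y \<in> S" "z \<in> S" "d y z \<le> k" using step.hyps(2) by (simp_all add: chain_step_def)
    ultimately have "y \<in> C" "z \<in> C" "d y z \<le> k" using step.hyps(1) C by simp_all
    then have "(y, z) \<in> chain_step d k C" by (simp add: chain_step_def)
    with step.IH show ?case by (rule rtrancl_into_rtrancl)
  qed
  have "sym ((chain_step d k C)\<^sup>*)"
    by (rule sym_chain_step_rtrancl) (use sym CS in blast)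
  then have "(y, z) \<in> (chain_step d k C)\<^sup>*" if "y \<in> C" "z \<in> C" for y z
    using that from_x C by (meson rtrancl_trans symD)
  then have conn: "coarsely_connected d k C"
    unfolding coarsely_connected_alt by auto
  have "C' = C" if C': "C \<subseteq> C'" "C' \<subseteq> S" "coarsely_connected d k C'" for C'
  proof -
    have "y \<in> C" if "y \<in> C'" for y
    proof -
      have "(x, y) \<in> C' \<times> C'" using that C'(1) \<open>x \<in> C\<close> by blast
      then have "(x, y) \<in> (chain_step d k S)\<^sup>*"
        using C'(3) rtrancl_mono[OF chain_step_mono[OF C'(2)]] unfolding coarsely_connected_alt
        by (meson subsetD)
      then show ?thesis using C that C'(2) by blast
    qed
    then show ?thesis using C'(1) by blast
  qed
  then show ?thesis using conn CS unfolding coarse_component_def C_def[symmetric] by blast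
qed

lemma coarse_component_eq_reachable:
  assumes sym: "\<And>a b. a \<in> S \<Longrightarrow> b \<in> S \<Longrightarrow> d a b = d b a"
    and C: "coarse_component d k S C" "x \<in> C"
  shows "C = {y \<in> S. (x, y) \<in> (chain_step d k S)\<^sup>*}" (is "C = ?K")
proof -
  have CS: "C \<subseteq> S" "coarsely_connected d k C" using C by (auto simp: coarse_component_def)
  have "(x, y) \<in> (chain_step d k S)\<^sup>*" if "y \<in> C" for y
  proof -
    have "(x, y) \<in> C \<times> C" using that C(2) by simp
    then show ?thesis
      using CS(2) rtrancl_mono[OF chain_step_mono[OF CS(1)]] unfolding coarsely_connected_alt
      by (meson subsetD)
  qed
  then have "C \<subseteq> ?K" using CS(1) by blast
  moreover have "coarse_component d k S ?K"
    by (rule coarse_component_reachable[OF sym]) (use CS C(2) in auto)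
  ultimately show ?thesis using C(1) by (auto simp: coarse_component_def)
qed

lemma distinct_coarse_components_iff:
  assumes sym: "\<And>a b. a \<in> S \<Longrightarrow> b \<in> S \<Longrightarrow> d a b = d b a"
  shows "(\<exists>C1 C2. C1 \<noteq> C2 \<and> (\<forall>C\<in>{C1, C2}. coarse_component d k S C \<and> (\<exists>x\<in>C. P x))) \<longleftrightarrow>
    (\<exists>x\<in>S. \<exists>y\<in>S. P x \<and> P y \<and> (x, y) \<notin> (chain_step d k S)\<^sup>*)"
proof
  assume "\<exists>C1 C2. C1 \<noteq> C2 \<and> (\<forall>C\<in>{C1, C2}. coarse_component d k S C \<and> (\<exists>x\<in>C. P x))"
  then obtain C1 C2 where "C1 \<noteq> C2" "\<forall>C\<in>{C1, C2}. coarse_component d k S C \<and> (\<exists>x\<in>C. P x)"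
    by (elim exE conjE)
  then obtain x y where C: "C1 \<noteq> C2" "coarse_component d k S C1" "coarse_component d k S C2"
    "x \<in> C1" "y \<in> C2" "P x" "P y" by (metis insertCI)
  have eq: "C1 = {z \<in> S. (x, z) \<in> (chain_step d k S)\<^sup>*}"
      "C2 = {z \<in> S. (y, z) \<in> (chain_step d k S)\<^sup>*}"
    using coarse_component_eq_reachable[OF sym C(2,4)] coarse_component_eq_reachable[OF sym C(3,5)]
    by simp_all
  have xy: "x \<in> S" "y \<in> S" using C by (auto simp: coarse_component_def)
  have "(x, y) \<notin> (chain_step d k S)\<^sup>*"
  proof
    assume "(x, y) \<in> (chain_step d k S)\<^sup>*"
    moreover have "sym ((chain_step d k S)\<^sup>*)" using sym_chain_step_rtrancl[OF sym] .
    ultimately have "(x, z) \<in> (chain_step d k S)\<^sup>* \<longleftrightarrow> (y, z) \<in> (chain_step d k S)\<^sup>*" for z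
      by (meson rtrancl_trans symD)
    then have "C1 = C2" by (subst eq(1), subst eq(2)) simp
    then show False using C by simp
  qed
  then show "\<exists>x\<in>S. \<exists>y\<in>S. P x \<and> P y \<and> (x, y) \<notin> (chain_step d k S)\<^sup>*" using xy C by blast
next
  assume "\<exists>x\<in>S. \<exists>y\<in>S. P x \<and> P y \<and> (x, y) \<notin> (chain_step d k S)\<^sup>*"
  then obtain x y where xy: "x \<in> S" "y \<in> S" "P x" "P y" "(x, y) \<notin> (chain_step d k S)\<^sup>*" by blast
  let ?K = "\<lambda>x. {y \<in> S. (x, y) \<in> (chain_step d k S)\<^sup>*}"
  have self: "x \<in> ?K x" "y \<in> ?K y" using xy(1,2) by simp_all
  have "y \<notin> ?K x" using xy(5) by simp
  then have "?K x \<noteq> ?K y" using self by metis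
  moreover have "coarse_component d k S (?K x)"
    by (rule coarse_component_reachable[OF sym xy(1)])
  moreover have "coarse_component d k S (?K y)"
    by (rule coarse_component_reachable[OF sym xy(2)])
  moreover have "\<exists>z\<in>?K x. P z" "\<exists>z\<in>?K y. P z"
    using self xy(3,4) by (metis (no_types, lifting))+
  ultimately show "\<exists>C1 C2. C1 \<noteq> C2 \<and> (\<forall>C\<in>{C1, C2}. coarse_component d k S C \<and> (\<exists>x\<in>C. P x))"
    by (intro exI[of _ "?K x"] exI[of _ "?K y"]) simp
qed

locale finitely_generated_group = group G for G (structure) +
  fixes S
  assumes finite_S: "finite S" and S_subset: "S \<subseteq> carrier G" and generate_S: "generate G S = carrier G"
begin

abbreviation "ball \<equiv> word_ball S"
abbreviation "word_dist \<equiv> graph_dist (cayley_graph G S)"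

definition nbhd :: "'a set \<Rightarrow> nat \<Rightarrow> 'a set" where
  "nbhd Z n = {z \<otimes> b |z b. z \<in> Z \<and> b \<in> ball n}"

lemmas word_dist_le_iff = graph_dist_cayley[OF S_subset generate_S]

lemma ball_carrier: "b \<in> ball n \<Longrightarrow> b \<in> carrier G"
  using word_ball_subset[OF S_subset] by blast

lemmas ball_mult = word_ball_mult[OF S_subset]
lemmas ball_inv = word_ball_inv[OF S_subset]
lemmas finite_ball = finite_word_ball[OF finite_S]

lemma word_dist_sym:
  assumes "g \<in> carrier G" "h \<in> carrier G"
  shows "word_dist g h = word_dist h g"
proof -
  have "inv h \<otimes> g = inv (inv g \<otimes> h)" using assms by (simp add: inv_mult_group)
  then have "inv g \<otimes> h \<in> ball n \<longleftrightarrow> inv h \<otimes> g \<in> ball n" for n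
    using ball_inv[of _ n] assms inv_inv[of "inv g \<otimes> h"] by (metis inv_closed m_closed)
  then have "word_dist g h \<le> r \<longleftrightarrow> word_dist h g \<le> r" for r
    using assms by (simp add: word_dist_le_iff)
  then show ?thesis by (meson order.antisym order.refl)
qed

lemma mem_nbhd_iff:
  assumes "Z \<subseteq> carrier G" "x \<in> carrier G"
  shows "x \<in> nbhd Z n \<longleftrightarrow> (\<exists>z\<in>Z. inv x \<otimes> z \<in> ball n)"
proof
  assume "x \<in> nbhd Z n"
  then obtain z b where z: "x = z \<otimes> b" "z \<in> Z" "b \<in> ball n" by (auto simp: nbhd_def)
  have zb: "z \<in> carrier G" "b \<in> carrier G" using z assms(1) ball_carrier by auto
  then have "inv x \<otimes> z = inv b" by (simp add: z(1) inv_mult_group m_assoc)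
  then show "\<exists>z\<in>Z. inv x \<otimes> z \<in> ball n" using ball_inv z by metis
next
  assume "\<exists>z\<in>Z. inv x \<otimes> z \<in> ball n"
  then obtain z where z: "z \<in> Z" "inv x \<otimes> z \<in> ball n" by blast
  then have "z \<in> carrier G" using assms(1) by auto
  then have "x = z \<otimes> inv (inv x \<otimes> z)" using assms(2)
    by (simp add: inv_mult_group m_assoc[symmetric])
  then show "x \<in> nbhd Z n" using z ball_inv unfolding nbhd_def by blast
qed

lemma nbhd_carrier: "Z \<subseteq> carrier G \<Longrightarrow> nbhd Z n \<subseteq> carrier G"
  by (auto simp: nbhd_def ball_carrier subsetD)

lemma nbhd_mult:
  assumes "Z \<subseteq> carrier G" "x \<in> nbhd Z m" "b \<in> ball n"
  shows "x \<otimes> b \<in> nbhd Z (m + n)"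
proof -
  obtain z c where z: "x = z \<otimes> c" "z \<in> Z" "c \<in> ball m" using assms by (auto simp: nbhd_def)
  then have "x \<otimes> b = z \<otimes> (c \<otimes> b)" using assms ball_carrier by (metis m_assoc subsetD)
  then show ?thesis using z ball_mult[OF z(3) assms(3)] by (auto simp: nbhd_def)
qed

lemma dist_to_set_ge:
  assumes "Z \<subseteq> carrier G" "x \<in> carrier G" "x \<notin> nbhd Z n"
  shows "ereal (real n) \<le> dist_to_set word_dist x Z"
  unfolding dist_to_set_def
proof (rule INF_greatest)
  fix z assume z: "z \<in> Z"
  then have "\<not> word_dist x z \<le> real n"
    using assms mem_nbhd_iff[OF assms(1,2)] by (auto simp: word_dist_le_iff subsetD)
  then show "ereal (real n) \<le> ereal (word_dist x z)" by simp
qed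

lemma dist_to_set_le:
  assumes "Z \<subseteq> carrier G" "x \<in> nbhd Z n"
  shows "dist_to_set word_dist x Z \<le> ereal (real n)"
proof -
  have x: "x \<in> carrier G" using assms nbhd_carrier by blast
  then obtain z where z: "z \<in> Z" "inv x \<otimes> z \<in> ball n" using mem_nbhd_iff assms by blast
  then have "word_dist x z \<le> real n" using x assms by (auto simp: word_dist_le_iff subsetD)
  then show ?thesis unfolding dist_to_set_def by (intro INF_lower2[OF z(1)]) simp
qed

text \<open>
  Word distances are integers, so a distance to \<open>Z\<close> of at most \<open>L\<close> is attained and may be rounded down. For
  empty \<open>Z\<close> both sides are empty.
\<close>
lemma thickening_eq_nbhd:
  assumes Z: "Z \<subseteq> carrier G" and L: "0 \<le> L"
  shows "thickening (carrier G) word_dist Z L = nbhd Z (nat \<lfloor>L\<rfloor>)"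
proof (rule Set.set_eqI)
  fix x
  show "x \<in> thickening (carrier G) word_dist Z L \<longleftrightarrow> x \<in> nbhd Z (nat \<lfloor>L\<rfloor>)"
  proof
    assume x: "x \<in> thickening (carrier G) word_dist Z L"
    then have xc: "x \<in> carrier G" by (simp add: thickening_def)
    from x have "dist_to_set word_dist x Z \<le> ereal L" by (simp add: thickening_def)
    moreover have "ereal L < ereal (of_int \<lfloor>L\<rfloor> + 1)" by simp
    ultimately have "dist_to_set word_dist x Z < ereal (of_int \<lfloor>L\<rfloor> + 1)"
      by (rule le_less_trans)
    then obtain z where z: "z \<in> Z" "word_dist x z < of_int \<lfloor>L\<rfloor> + 1"
      by (auto simp: dist_to_set_def INF_less_iff)
    define r where "r = word_dist x z"
    have zc: "z \<in> carrier G" using z Z by blast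
    have "0 \<le> r" "inv x \<otimes> z \<in> ball (nat \<lfloor>r\<rfloor>)"
      using word_dist_le_iff[OF xc zc, of r] by (auto simp: r_def)
    moreover have "\<lfloor>r\<rfloor> \<le> \<lfloor>L\<rfloor>" using z(2) unfolding r_def by linarith
    then have "nat \<lfloor>r\<rfloor> \<le> nat \<lfloor>L\<rfloor>" by simp
    ultimately have "inv x \<otimes> z \<in> ball (nat \<lfloor>L\<rfloor>)" using word_ball_mono by blast
    then show "x \<in> nbhd Z (nat \<lfloor>L\<rfloor>)" using mem_nbhd_iff[OF Z xc] z by blast
  next
    assume x: "x \<in> nbhd Z (nat \<lfloor>L\<rfloor>)"
    have "real (nat \<lfloor>L\<rfloor>) \<le> L" using L by simp
    then have "dist_to_set word_dist x Z \<le> ereal L"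
      using dist_to_set_le[OF Z x] by (meson ereal_less_eq(3) order_trans)
    then show "x \<in> thickening (carrier G) word_dist Z L"
      using nbhd_carrier[OF Z] x by (auto simp: thickening_def)
  qed
qed

definition ball_at :: "'a \<Rightarrow> nat \<Rightarrow> 'a set" where
  "ball_at z n = {x \<in> carrier G. inv z \<otimes> x \<in> ball n}"

lemma ball_at_eq: "z \<in> carrier G \<Longrightarrow> ball_at z n = (\<lambda>b. z \<otimes> b) ` ball n"
  by (force simp: ball_at_def ball_carrier m_assoc[symmetric])

lemma card_ball_at_le:
  assumes "z \<in> carrier G"
  shows "finite (ball_at z n)" "card (ball_at z n \<inter> A) \<le> card (ball n)"
proof -
  show f: "finite (ball_at z n)" using finite_word_ball[OF finite_S] by (simp add: ball_at_eq assms)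
  have "card (ball_at z n \<inter> A) \<le> card (ball_at z n)" using f by (intro card_mono) auto
  also have "\<dots> \<le> card (ball n)"
    unfolding ball_at_eq[OF assms] by (rule card_image_le[OF finite_word_ball[OF finite_S]])
  finally show "card (ball_at z n \<inter> A) \<le> card (ball n)" .
qed

text \<open>
  One threshold \<open>n0\<close> serves all sets of the family; the growth function of a family is a
  supremum over its members as well.
\<close>
definition subexponential :: "'a set set \<Rightarrow> bool" where
  "subexponential \<Z> \<longleftrightarrow> (\<forall>e>0. \<exists>n0. \<forall>n\<ge>n0. \<forall>Z\<in>\<Z>. \<forall>z\<in>Z. real (card (ball_at z n \<inter> Z)) \<le> exp (e * real n))"

text \<open>
  Two boundary effects of the definition of the growth function are harmless: all cardinalities in the supremum
  are bounded by the size of a ball, and \<open>ln 0 = 0\<close> when nothing is counted.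
\<close>
lemma not_exponential_growth_iff:
  assumes "\<forall>Z\<in>\<Z>. Z \<subseteq> carrier G"
  shows "\<not> exponential_growth (cayley_graph G S) \<Z> \<longleftrightarrow> subexponential \<Z>"
proof -
  have pverts: "pverts (cayley_graph G S) = carrier G" by (simp add: cayley_graph_def)
  define V where "V = family_growth (cayley_graph G S) \<Z>"
  have V: "V r = (SUP (Z, z) \<in> (SIGMA Z:\<Z>. Z). card (ball_at z (nat \<lfloor>r\<rfloor>) \<inter> Z))" if "0 \<le> r" for r
    unfolding V_def family_growth_def
  proof (rule SUP_cong[OF refl], clarify)
    fix Z z assume "Z \<in> \<Z>" "z \<in> Z"
    then have "{x \<in> pverts (cayley_graph G S). word_dist z x \<le> r} = ball_at z (nat \<lfloor>r\<rfloor>)"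
      using assms that pverts by (auto simp: ball_at_def word_dist_le_iff subsetD)
    then show "card ({x \<in> pverts (cayley_graph G S). word_dist z x \<le> r} \<inter> Z) = card (ball_at z (nat \<lfloor>r\<rfloor>) \<inter> Z)"
      by simp
  qed
  have growth: "\<not> exponential_growth (cayley_graph G S) \<Z> \<longleftrightarrow>
      (\<forall>y>0. eventually (\<lambda>r. ereal (1 / r * ln (real (V r))) < y) at_top)"
    by (simp add: exponential_growth_def V_def not_less Limsup_le_iff)
  show ?thesis
  proof
    assume ne: "\<not> exponential_growth (cayley_graph G S) \<Z>"
    show "subexponential \<Z>" unfolding subexponential_def
    proof (intro allI impI)
      fix e :: real assume "e > 0"
      then have "eventually (\<lambda>r. ereal (1 / r * ln (real (V r))) < ereal e) at_top"
        using growth[THEN iffD1, OF ne, rule_format, of "ereal e"] by simp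
      then obtain r0 where r0: "\<And>r. r \<ge> r0 \<Longrightarrow> 1 / r * ln (real (V r)) < e"
        by (auto simp: eventually_at_top_linorder)
      have "real (card (ball_at z n \<inter> Z)) \<le> exp (e * real n)"
        if n: "n \<ge> nat \<lceil>r0\<rceil> + 1" and Z: "Z \<in> \<Z>" "z \<in> Z" for n Z z
      proof -
        have "bdd_above ((\<lambda>(Z, z). card (ball_at z n \<inter> Z)) ` (SIGMA Z:\<Z>. Z))"
          by (rule bdd_aboveI[of _ "card (ball n)"]) (use assms in \<open>auto intro!: card_ball_at_le\<close>)
        from cSUP_upper[OF _ this, of "(Z, z)"]
        have le: "card (ball_at z n \<inter> Z) \<le> V (real n)" using Z V[of "real n"] by simp
        have "real n \<ge> r0" "real n \<ge> 1" using n by linarith+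
        then have "ln (real (V (real n))) < e * real n" using r0[of "real n"]
          by (simp add: field_simps)
        then have "exp (ln (real (V (real n)))) \<le> exp (e * real n)" by simp
        then have "real (V (real n)) \<le> exp (e * real n)"
          by (cases "V (real n) = 0") simp_all
        then show ?thesis using le by linarith
      qed
      then show "\<exists>n0. \<forall>n\<ge>n0. \<forall>Z\<in>\<Z>. \<forall>z\<in>Z. real (card (ball_at z n \<inter> Z)) \<le> exp (e * real n)"
        by blast
    qed
  next
    assume sub: "subexponential \<Z>"
    show "\<not> exponential_growth (cayley_graph G S) \<Z>" unfolding growth
    proof (intro allI impI)
      fix y :: ereal assume "y > 0"
      then obtain e where e: "e > 0" "ereal e < y"
        using ereal_dense2[of 0 y] by auto
      then obtain n0 where n0: "\<And>n Z z. n \<ge> n0 \<Longrightarrow> Z \<in> \<Z> \<Longrightarrow> z \<in> Z \<Longrightarrow>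
          real (card (ball_at z n \<inter> Z)) \<le> exp (e * real n)"
        using sub unfolding subexponential_def by metis
      have "ereal (1 / r * ln (real (V r))) < y" if r: "r \<ge> real n0 + 1" for r
      proof -
        define n where "n = nat \<lfloor>r\<rfloor>"
        have n: "n \<ge> n0" "real n \<le> r" "r > 0" using r unfolding n_def by linarith+
        have "real (V r) \<le> exp (e * real n)"
        proof (cases "(SIGMA Z:\<Z>. Z) = {}")
          case True
          then show ?thesis using V[of r] n by simp
        next
          case False
          have "V r \<le> nat \<lfloor>exp (e * real n)\<rfloor>"
            unfolding V[OF less_imp_le[OF n(3)]] n_def[symmetric]
            by (rule cSUP_least[OF False]) (use n0[OF n(1)] in \<open>auto simp: le_nat_floor\<close>)
          then have "real (V r) \<le> real (nat \<lfloor>exp (e * real n)\<rfloor>)" by (rule of_nat_mono)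
          also have "\<dots> \<le> exp (e * real n)" by (rule of_nat_floor) simp
          finally show ?thesis .
        qed
        then have "ln (real (V r)) \<le> e * real n"
        proof (cases "V r = 0")
          case False
          then have "ln (real (V r)) \<le> ln (exp (e * real n))"
            using \<open>real (V r) \<le> exp (e * real n)\<close> by (subst ln_le_cancel_iff) auto
          then show ?thesis by simp
        qed (use e in simp)
        also have "\<dots> \<le> e * r" using e n by simp
        finally have "1 / r * ln (real (V r)) \<le> e" using n by (simp add: field_simps)
        then show ?thesis using e by (meson ereal_less_eq(3) le_less_trans)
      qed
      then show "eventually (\<lambda>r. ereal (1 / r * ln (real (V r))) < y) at_top"
        unfolding eventually_at_top_linorder by blast
    qed
  qed
qed

end

context finitely_generated_group
begin

definition edges_in :: "'a set \<Rightarrow> 'a rel" where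
  "edges_in A = {(a, b). a \<in> A \<and> b \<in> A \<and> inv a \<otimes> b \<in> ball 1}"

lemma edges_in_eq_chain_step:
  assumes "A \<subseteq> carrier G"
  shows "edges_in A = chain_step word_dist 1 A"
proof -
  have "inv a \<otimes> b \<in> ball 1 \<longleftrightarrow> word_dist a b \<le> 1" if "a \<in> A" "b \<in> A" for a b
    using word_dist_le_iff[of a b 1] that assms by auto
  then show ?thesis unfolding edges_in_def chain_step_def by blast
qed

lemma inv_cancel_left [simp]: "w \<in> carrier G \<Longrightarrow> s \<in> carrier G \<Longrightarrow> inv w \<otimes> (w \<otimes> s) = s"
  by (simp add: m_assoc[symmetric])

text \<open>
  A point all of whose neighbours up to distance \<open>n\<close> lie in \<open>A\<close> is joined to each of them inside \<open>A\<close>,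
  because prefixes of a word of length \<open>n\<close> stay within distance \<open>n\<close>.
\<close>
lemma edge_path:
  assumes "A \<subseteq> carrier G" "a \<in> carrier G" "\<And>c. c \<in> ball n \<Longrightarrow> a \<otimes> c \<in> A" "b \<in> ball n"
  shows "(a, a \<otimes> b) \<in> (edges_in A)\<^sup>*"
  using assms(3,4)
proof (induction n arbitrary: b)
  case 0
  then show ?case using assms(2) by simp
next
  case (Suc n)
  have "c \<in> ball (Suc n)" if "c \<in> ball n" for c using that by simp
  then have IH: "(a, a \<otimes> c) \<in> (edges_in A)\<^sup>*" if "c \<in> ball n" for c
    using Suc.IH[OF _ that] Suc.prems(1) by blast
  show ?case
  proof (cases "b \<in> ball n")
    case True
    then show ?thesis using IH by simp
  next
    case False
    then obtain g s where g: "b = g \<otimes> s" "g \<in> ball n" "s \<in> S \<union> (\<lambda>s. inv s) ` S"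
      using Suc.prems(2) by auto
    have c: "g \<in> carrier G" "s \<in> carrier G" using g ball_carrier S_subset by auto
    have "a \<otimes> g \<in> A" "a \<otimes> b \<in> A"
      using Suc.prems g(2) by simp_all
    moreover have "inv (a \<otimes> g) \<otimes> (a \<otimes> b) = s"
    proof -
      have "a \<otimes> b = (a \<otimes> g) \<otimes> s" using c assms(2) by (simp add: g m_assoc)
      then show ?thesis using c assms(2) by simp
    qed
    ultimately have "(a \<otimes> g, a \<otimes> b) \<in> edges_in A"
      using word_ball_1[OF S_subset g(3)] by (simp add: edges_in_def)
    then show ?thesis using IH[OF g(2)] by (rule rtrancl_into_rtrancl[rotated])
  qed
qed

lemma edge_connected_carrier:
  assumes "a \<in> carrier G" "b \<in> carrier G"
  shows "(a, b) \<in> (edges_in (carrier G))\<^sup>*"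
proof -
  obtain n where n: "inv a \<otimes> b \<in> ball n"
    using word_ball_exhausts[OF S_subset, of "inv a \<otimes> b"] generate_S assms by auto
  have "(a, a \<otimes> (inv a \<otimes> b)) \<in> (edges_in (carrier G))\<^sup>*"
    by (rule edge_path[OF _ assms(1) _ n]) (use assms ball_carrier in auto)
  then show ?thesis using assms by (simp add: m_assoc[symmetric])
qed

text \<open>
  The two scales in the definition of coarse separation collapse: the connectivity scale can be
  taken to be \<open>1\<close>, since edge paths are chains for any scale \<open>k \<ge> 1\<close>, and smaller scales cannot occur as
  they would not connect distinct group elements. All remaining constants become natural numbers.
\<close>
lemma coarsely_separated_iff_edges:
  assumes \<Z>: "\<forall>Z\<in>\<Z>. Z \<subseteq> carrier G"
  shows "coarsely_separated (carrier G) word_dist {carrier G} \<Z> \<longleftrightarrow>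
    (\<exists>L. \<forall>n. \<exists>Z\<in>\<Z>. \<exists>x\<in>carrier G - nbhd Z n. \<exists>y\<in>carrier G - nbhd Z n.
       (x, y) \<notin> (edges_in (carrier G - nbhd Z L))\<^sup>*)" (is "?sep \<longleftrightarrow> (\<exists>L. \<forall>n. ?edge L n)")
proof -
  define A where "A Z L = carrier G - nbhd Z L" for Z L
  have A: "A Z L \<subseteq> carrier G" for Z L by (auto simp: A_def)
  define Q where "Q k L D Z \<longleftrightarrow> (\<exists>C1 C2. C1 \<noteq> C2 \<and> (\<forall>C\<in>{C1, C2}.
      coarse_component word_dist k (carrier G - thickening (carrier G) word_dist Z L) C \<and>
      (\<exists>x\<in>C. ereal D \<le> dist_to_set word_dist x Z)))" for k L D Z
  have sep: "?sep \<longleftrightarrow> (\<exists>k\<ge>0. \<exists>L\<ge>0. \<forall>D\<ge>0. \<exists>Z\<in>\<Z>. coarsely_connected word_dist k (carrier G) \<and> Q k L D Z)"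
    unfolding coarsely_separated_def Q_def by simp
  have Q: "Q k L D Z \<longleftrightarrow> (\<exists>x\<in>A Z (nat \<lfloor>L\<rfloor>). \<exists>y\<in>A Z (nat \<lfloor>L\<rfloor>). ereal D \<le> dist_to_set word_dist x Z \<and>
      ereal D \<le> dist_to_set word_dist y Z \<and> (x, y) \<notin> (chain_step word_dist k (A Z (nat \<lfloor>L\<rfloor>)))\<^sup>*)"
    if Z: "Z \<in> \<Z>" and L: "0 \<le> L" for k L D Z
  proof -
    have Zc: "Z \<subseteq> carrier G" using Z \<Z> by blast
    show ?thesis
      unfolding Q_def thickening_eq_nbhd[OF Zc L] A_def[symmetric]
      by (rule distinct_coarse_components_iff) (meson A subsetD word_dist_sym)
  qed
  show ?thesis
  proof
    assume ?sep
    then obtain k L where L: "0 \<le> L"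
      and kL: "\<And>D. 0 \<le> D \<Longrightarrow> \<exists>Z\<in>\<Z>. coarsely_connected word_dist k (carrier G) \<and> Q k L D Z"
      unfolding sep by meson
    have "?edge (nat \<lfloor>L\<rfloor>) n" for n
    proof -
      obtain Z where Z: "Z \<in> \<Z>" "coarsely_connected word_dist k (carrier G)" "Q k L (real n + 1) Z"
        using kL[of "real n + 1"] by auto
      define B where "B = A Z (nat \<lfloor>L\<rfloor>)"
      have Zc: "Z \<subseteq> carrier G" using Z \<Z> by blast
      have Bc: "B \<subseteq> carrier G" unfolding B_def by (rule A)
      obtain x y where xy: "x \<in> B" "y \<in> B" "(x, y) \<notin> (chain_step word_dist k B)\<^sup>*"
        and far: "ereal (real n + 1) \<le> dist_to_set word_dist x Z"
                 "ereal (real n + 1) \<le> dist_to_set word_dist y Z"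
        using Z(3)[unfolded Q[OF Z(1) L], folded B_def] by (elim bexE conjE)
      have deep: "w \<notin> nbhd Z n" if "ereal (real n + 1) \<le> dist_to_set word_dist w Z" for w
      proof
        assume "w \<in> nbhd Z n"
        from order_trans[OF that dist_to_set_le[OF Zc this]]
        show False by simp
      qed
      \<comment> \<open>For \<open>k < 1\<close> chains are constant, but \<open>x \<noteq> y\<close> are joined by one in the whole group.\<close>
      have "1 \<le> k"
      proof (rule ccontr)
        assume k: "\<not> 1 \<le> k"
        have trivial: "a = b" if "(a, b) \<in> chain_step word_dist k (carrier G)" for a b
        proof -
          have ab: "a \<in> carrier G" "b \<in> carrier G" "word_dist a b \<le> k"
            using that by (simp_all add: chain_step_def)
          then have "inv a \<otimes> b \<in> ball (nat \<lfloor>k\<rfloor>)" by (simp add: word_dist_le_iff)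
          moreover have "nat \<lfloor>k\<rfloor> = 0" using k by linarith
          ultimately have "inv a \<otimes> b = \<one>" by simp
          then have "a \<otimes> (inv a \<otimes> b) = a" using ab by simp
          then show "a = b" using ab by (simp add: m_assoc[symmetric])
        qed
        have "(x, y) \<in> (chain_step word_dist k (carrier G))\<^sup>*"
          using Z(2) xy(1,2) Bc unfolding coarsely_connected_alt by (meson SigmaI subsetD)
        then have "x = y"
        proof induction
          case (step a b)
          then show ?case using trivial by simp
        qed simp
        then show False using xy by simp
      qed
      then have "edges_in B \<subseteq> chain_step word_dist k B"
        unfolding edges_in_eq_chain_step[OF Bc] by (auto simp: chain_step_def)
      then have "(x, y) \<notin> (edges_in B)\<^sup>*" using xy(3) rtrancl_mono by (meson subsetD)
      moreover have "x \<in> carrier G - nbhd Z n" "y \<in> carrier G - nbhd Z n"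
        using xy(1,2) Bc deep[OF far(1)] deep[OF far(2)] by auto
      ultimately show ?thesis using Z(1) unfolding B_def A_def by meson
    qed
    then show "\<exists>L. \<forall>n. ?edge L n" by (intro exI allI)
  next
    assume "\<exists>L. \<forall>n. ?edge L n"
    then obtain L where "\<forall>n. ?edge L n" by (elim exE)
    then have L: "?edge L n" for n by (rule spec)
    have conn: "coarsely_connected word_dist 1 (carrier G)"
      unfolding coarsely_connected_alt edges_in_eq_chain_step[OF order_refl, symmetric]
      by (intro subsetI) (metis SigmaE edge_connected_carrier)
    have "\<exists>Z\<in>\<Z>. Q 1 (real L) D Z" for D
    proof -
      define n where "n = max L (nat \<lceil>D\<rceil>)"
      obtain Z x y where Z: "Z \<in> \<Z>" "x \<in> carrier G - nbhd Z n" "y \<in> carrier G - nbhd Z n"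
        "(x, y) \<notin> (edges_in (A Z L))\<^sup>*" using L[of n] unfolding A_def by (elim bexE)
      have Zc: "Z \<subseteq> carrier G" using Z \<Z> by blast
      have "nbhd Z L \<subseteq> nbhd Z n" using word_ball_mono[of L n S] by (auto simp: nbhd_def n_def)
      then have "x \<in> A Z L" "y \<in> A Z L" using Z by (auto simp: A_def)
      moreover have "D \<le> real n" unfolding n_def by linarith
      then have "ereal D \<le> ereal (real n)" by simp
      then have "ereal D \<le> dist_to_set word_dist x Z" "ereal D \<le> dist_to_set word_dist y Z"
        using dist_to_set_ge[OF Zc, of _ n] Z(2,3) by (meson DiffE order_trans)+
      moreover have "(x, y) \<notin> (chain_step word_dist 1 (A Z L))\<^sup>*"
        using Z(4) unfolding edges_in_eq_chain_step[OF A] .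
      ultimately have "Q 1 (real L) D Z"
        unfolding Q[OF Z(1) of_nat_0_le_iff] by (simp only: floor_of_nat nat_int) meson
      then show ?thesis using Z(1) by blast
    qed
    then have "\<forall>D\<ge>0. \<exists>Z\<in>\<Z>. coarsely_connected word_dist 1 (carrier G) \<and> Q 1 (real L) D Z"
      using conn by simp
    then show ?sep unfolding sep by (meson of_nat_0_le_iff zero_le_one)
  qed
qed

text \<open>
  Each point of the neighbourhood in the ball is near a point of \<open>Z\<close> in a slightly larger ball. Growth is
  measured around points of \<open>Z\<close> only, so the latter ball is recentred at one of these points, which
  doubles its radius.
\<close>
lemma card_nbhd_ball_at_le:
  assumes Z: "Z \<subseteq> carrier G" and p: "p \<in> carrier G"
    and M: "\<And>z. z \<in> Z \<Longrightarrow> real (card (ball_at z (2 * (n + l)) \<inter> Z)) \<le> M" and "0 \<le> M"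
  shows "real (card (nbhd Z l \<inter> ball_at p n)) \<le> real (card (ball l)) * M"
proof -
  define W where "W = Z \<inter> ball_at p (n + l)"
  have "finite W" using card_ball_at_le(1)[OF p] by (simp add: W_def)
  have "nbhd Z l \<inter> ball_at p n \<subseteq> (\<lambda>(z, b). z \<otimes> b) ` (W \<times> ball l)"
  proof
    fix x assume x: "x \<in> nbhd Z l \<inter> ball_at p n"
    then obtain z b where z: "x = z \<otimes> b" "z \<in> Z" "b \<in> ball l" by (auto simp: nbhd_def)
    have c: "z \<in> carrier G" "b \<in> carrier G" using z Z ball_carrier by auto
    have "inv p \<otimes> x \<otimes> inv b \<in> ball (n + l)"
      using x ball_mult ball_inv[OF z(3)] by (auto simp: ball_at_def)
    moreover have "inv p \<otimes> x \<otimes> inv b = inv p \<otimes> z" using c p by (simp add: z m_assoc)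
    ultimately have "z \<in> W" using z c by (simp add: W_def ball_at_def)
    then show "x \<in> (\<lambda>(z, b). z \<otimes> b) ` (W \<times> ball l)" using z by auto
  qed
  then have "card (nbhd Z l \<inter> ball_at p n) \<le> card W * card (ball l)"
    using surj_card_le[of "W \<times> ball l"] \<open>finite W\<close> finite_ball
    by (simp add: card_cartesian_product)
  moreover have "real (card W) \<le> M"
  proof (cases "W = {}")
    case True
    then show ?thesis using \<open>0 \<le> M\<close> by simp
  next
    case False
    then obtain z0 where z0: "z0 \<in> Z" "z0 \<in> carrier G" "inv p \<otimes> z0 \<in> ball (n + l)"
      by (auto simp: W_def ball_at_def)
    have "W \<subseteq> ball_at z0 (2 * (n + l)) \<inter> Z"
    proof
      fix z assume z: "z \<in> W"
      then have zc: "z \<in> carrier G" "inv p \<otimes> z \<in> ball (n + l)" by (auto simp: W_def ball_at_def)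
      have "inv (inv p \<otimes> z0) \<otimes> (inv p \<otimes> z) \<in> ball ((n + l) + (n + l))"
        using ball_mult[OF ball_inv[OF z0(3)] zc(2)] .
      moreover have "inv (inv p \<otimes> z0) \<otimes> (inv p \<otimes> z) = inv z0 \<otimes> z"
        using z0 zc p by (simp add: inv_mult_group m_assoc) (simp add: m_assoc[symmetric])
      ultimately show "z \<in> ball_at z0 (2 * (n + l)) \<inter> Z"
        using z zc by (simp only: ball_at_def W_def mult_2) simp
    qed
    then have "card W \<le> card (ball_at z0 (2 * (n + l)) \<inter> Z)"
      using card_ball_at_le(1)[OF z0(2)] by (intro card_mono) auto
    then show ?thesis using M[OF z0(1)] by linarith
  qed
  ultimately show ?thesis
    by (smt (verit) mult.commute mult_left_mono of_nat_0_le_iff of_nat_mono of_nat_mult)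
qed

text \<open>
  Fattening the sets, moving the centre off them and rescaling the radius do not affect
  subexponential growth.
\<close>
lemma subexponential_nbhd:
  assumes sub: "subexponential \<Z>" and \<Z>: "\<forall>Z\<in>\<Z>. Z \<subseteq> carrier G" and e: "0 < e"
  shows "\<exists>n0. \<forall>n\<ge>n0. \<forall>Z\<in>\<Z>. \<forall>p\<in>carrier G. real (card (nbhd Z l \<inter> ball_at p (c * n))) \<le> exp (e * real n)"
proof -
  \<comment> \<open>The recentred ball has radius about \<open>2 (c + 1) n\<close>; this rate turns its bound into \<open>exp (e n / 2)\<close> up to
    the constant \<open>K\<close> below, which is absorbed by the other half of \<open>exp (e n)\<close>. Using \<open>c + 1\<close> rather than
    \<open>c\<close> keeps the radius growing when \<open>c = 0\<close>.\<close>
  define e' where "e' = e / (4 * (real c + 1))"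
  have e': "0 < e'" "4 * (real c + 1) * e' = e" using e by (auto simp: e'_def add_pos_nonneg)
  obtain n1 where n1: "\<And>n Z z. n \<ge> n1 \<Longrightarrow> Z \<in> \<Z> \<Longrightarrow> z \<in> Z \<Longrightarrow>
      real (card (ball_at z n \<inter> Z)) \<le> exp (e' * real n)"
    using sub e' unfolding subexponential_def by metis
  define K where "K = real (card (ball l)) * exp (2 * e' * real l)"
  have "real (card (nbhd Z l \<inter> ball_at p (c * n))) \<le> exp (e * real n)"
    if n: "n \<ge> max n1 (nat \<lceil>2 * K / e\<rceil>)" and Z: "Z \<in> \<Z>" and p: "p \<in> carrier G" for n Z p
  proof -
    define m where "m = (c + 1) * n"
    have "ball_at p (c * n) \<subseteq> ball_at p m"
      using word_ball_mono[of "c * n" m S] by (auto simp: ball_at_def m_def)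
    then have "card (nbhd Z l \<inter> ball_at p (c * n)) \<le> card (nbhd Z l \<inter> ball_at p m)"
      using card_ball_at_le(1)[OF p] by (intro card_mono) auto
    moreover have "real (card (nbhd Z l \<inter> ball_at p m)) \<le> real (card (ball l)) * exp (e' * real (2 * (m + l)))"
    proof (rule card_nbhd_ball_at_le)
      have "2 * (m + l) \<ge> n1" using n by (simp add: m_def)
      then show "real (card (ball_at z (2 * (m + l)) \<inter> Z)) \<le> exp (e' * real (2 * (m + l)))" if "z \<in> Z" for z
        using n1 Z that by blast
    qed (use Z \<Z> p in auto)
    moreover have "e' * real (2 * (m + l)) = e * real n / 2 + 2 * e' * real l"
      unfolding m_def e'(2)[symmetric] by (simp add: algebra_simps)
    then have "real (card (ball l)) * exp (e' * real (2 * (m + l))) = K * exp (e * real n / 2)"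
      by (simp add: K_def exp_add)
    moreover have "K \<le> exp (e * real n / 2)"
    proof -
      have "2 * K / e \<le> real n" using n by linarith
      then have "K \<le> e * real n / 2" using e by (simp add: field_simps)
      then show ?thesis using exp_ge_add_one_self[of "e * real n / 2"] by linarith
    qed
    then have "K * exp (e * real n / 2) \<le> exp (e * real n / 2) * exp (e * real n / 2)"
      by (rule mult_right_mono) simp
    moreover have "exp (e * real n / 2) * exp (e * real n / 2) = exp (e * real n)"
      by (simp flip: exp_add)
    ultimately show ?thesis by linarith
  qed
  then show ?thesis by blast
qed

text \<open>
  The sets \<open>X n\<close> grow like \<open>2 ^ n\<close> within radius proportional to \<open>n\<close>, faster than any neighbourhood
  of a member of the family allows at rate \<open>ln 2 / 2\<close>.
\<close>
lemma exponential_set_leaves_nbhd: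
  assumes sub: "subexponential \<Z>" and \<Z>: "\<forall>Z\<in>\<Z>. Z \<subseteq> carrier G"
    and X: "\<And>n. X n \<subseteq> ball (c * n)" "\<And>n. 2 ^ n \<le> card (X n)"
  shows "\<exists>n. \<forall>Z\<in>\<Z>. \<forall>p\<in>carrier G. \<exists>x\<in>X n. p \<otimes> x \<notin> nbhd Z l"
proof -
  obtain n0 where n0: "\<And>n Z p. n \<ge> n0 \<Longrightarrow> Z \<in> \<Z> \<Longrightarrow> p \<in> carrier G \<Longrightarrow>
      real (card (nbhd Z l \<inter> ball_at p (c * n))) \<le> exp (ln 2 / 2 * real n)"
    using subexponential_nbhd[OF sub \<Z>, of "ln 2 / 2" l c] by auto
  have "\<exists>x\<in>X (n0 + 1). p \<otimes> x \<notin> nbhd Z l" if Z: "Z \<in> \<Z>" and p: "p \<in> carrier G" for Z p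
  proof (rule ccontr)
    define n where "n = n0 + 1"
    assume "\<not> (\<exists>x\<in>X (n0 + 1). p \<otimes> x \<notin> nbhd Z l)"
    then have sub: "(\<lambda>x. p \<otimes> x) ` X n \<subseteq> nbhd Z l \<inter> ball_at p (c * n)"
      using X(1)[of n] p unfolding n_def[symmetric] ball_at_eq[OF p] by blast
    have "inj_on (\<lambda>x. p \<otimes> x) (X n)"
      using X(1) ball_carrier p by (intro inj_onI) (metis inv_cancel_left subsetD)
    then have "card (X n) \<le> card (nbhd Z l \<inter> ball_at p (c * n))"
      using card_mono[OF _ sub] card_ball_at_le(1)[OF p] by (simp add: card_image)
    also have "real \<dots> \<le> exp (ln 2 / 2 * real n)"
      by (rule n0) (use Z p in \<open>simp_all add: n_def\<close>)
    also have "\<dots> < exp (ln 2 * real n)" by (simp add: n_def)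
    also have "\<dots> = 2 ^ n" by (metis exp_ln exp_of_nat2_mult mult.commute zero_less_numeral)
    finally have "real (card (X n)) < 2 ^ n" by simp
    then show False using X(2)[of n] by (metis not_less of_nat_le_iff of_nat_numeral of_nat_power)
  qed
  then show ?thesis by blast
qed

end

section \<open>Pulling separating families back along injective Lipschitz maps\<close>

definition word_eval :: "('h, 'm) monoid_scheme \<Rightarrow> ('l \<Rightarrow> 'h) \<Rightarrow> 'l list \<Rightarrow> 'h" where
  "word_eval H \<phi> w = foldr (\<lambda>l g. \<phi> l \<otimes>\<^bsub>H\<^esub> g) w \<one>\<^bsub>H\<^esub>"

lemma word_eval_simps [simp]:
  "word_eval H \<phi> [] = \<one>\<^bsub>H\<^esub>" "word_eval H \<phi> (l # w) = \<phi> l \<otimes>\<^bsub>H\<^esub> word_eval H \<phi> w"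
  by (simp_all add: word_eval_def)

lemma (in monoid) word_eval_closed:
  assumes "\<And>l. l \<in> L \<Longrightarrow> \<phi> l \<in> carrier G" "w \<in> lists L"
  shows "word_eval G \<phi> w \<in> carrier G"
  using assms(2) by induction (simp_all add: assms(1))

lemma (in monoid) word_eval_append:
  assumes "\<And>l. l \<in> L \<Longrightarrow> \<phi> l \<in> carrier G" "v \<in> lists L" "w \<in> lists L"
  shows "word_eval G \<phi> (v @ w) = word_eval G \<phi> v \<otimes> word_eval G \<phi> w"
  using assms(2)
proof induction
  case (Cons l v)
  then show ?case using assms word_eval_closed[where L = L, OF assms(1)] by (simp add: m_assoc)
qed (use assms word_eval_closed[where L = L, OF assms(1)] in simp)

abbreviation two_letter_word :: "('h, 'm) monoid_scheme \<Rightarrow> 'h \<Rightarrow> 'h \<Rightarrow> bool list \<Rightarrow> 'h" where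
  "two_letter_word G x y \<equiv> word_eval G (\<lambda>b. if b then x else y)"

lemma (in monoid) two_letter_word_closed:
  "x \<in> carrier G \<Longrightarrow> y \<in> carrier G \<Longrightarrow> two_letter_word G x y w \<in> carrier G"
  by (rule word_eval_closed[where L = UNIV]) simp_all

lemma (in finitely_generated_group) two_letter_word_ball:
  assumes "x \<in> ball c" "y \<in> ball c"
  shows "two_letter_word G x y w \<in> ball (c * length w)"
proof (induction w)
  case (Cons b w)
  then show ?case using ball_mult[of _ c _ "c * length w"] assms by auto
qed simp

text \<open>
  The hypotheses on \<open>f\<close> make it an injective Lipschitz map that need not be a homomorphism. The overlap
  condition provides exponentially many words \<open>w\<close> such that \<open>u w\<close> lies both in \<open>f(H)\<close> and in its translate by
  the generator \<open>u\<close>. Chains of translates of \<open>f(H)\<close> then join any two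
  points of \<open>G\<close> through overlaps that contain points far from the separating set, so a
  separating set for \<open>G\<close> must separate one of the translates.
\<close>
theorem coarsely_separable_subexp_pullback:
  assumes "group G" "group H"
    and T: "finite T" "T \<subseteq> carrier H" "generate H T = carrier H"
    and f: "f \<in> carrier H \<rightarrow> carrier G" "inj_on f (carrier H)" "\<one>\<^bsub>G\<^esub> \<in> f ` carrier H"
    and K: "finite K" "K \<subseteq> carrier G"
    and f_step: "\<And>h t. h \<in> carrier H \<Longrightarrow> t \<in> T \<union> (\<lambda>t. inv\<^bsub>H\<^esub> t) ` T \<Longrightarrow>
      \<exists>k\<in>K. f (h \<otimes>\<^bsub>H\<^esub> t) = f h \<otimes>\<^bsub>G\<^esub> k"
    and U: "U \<subseteq> carrier G" "generate G U = carrier G"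
    and overlap: "\<And>u. u \<in> U \<Longrightarrow> \<exists>x\<in>carrier G. \<exists>y\<in>carrier G.
      (\<forall>n. inj_on (two_letter_word G x y) {w. length w = n}) \<and>
      (\<forall>w. two_letter_word G x y w \<in> f ` carrier H \<and> u \<otimes>\<^bsub>G\<^esub> two_letter_word G x y w \<in> f ` carrier H)"
    and sep: "coarsely_separable_subexp G"
  shows "coarsely_separable_subexp H"
proof -
  interpret H: finitely_generated_group H T
    using assms by (intro finitely_generated_group.intro finitely_generated_group_axioms.intro)
  from sep obtain S \<Z> where S: "finite S" "S \<subseteq> carrier G" "generate G S = carrier G"
    and \<Z>: "\<forall>Z\<in>\<Z>. Z \<subseteq> carrier G" and ne: "\<not> exponential_growth (cayley_graph G S) \<Z>"
    and sepZ: "coarsely_separated (carrier G) (graph_dist (cayley_graph G S)) {carrier G} \<Z>"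
    unfolding coarsely_separable_subexp_def by blast
  interpret G: finitely_generated_group G S
    using assms S by (intro finitely_generated_group.intro finitely_generated_group_axioms.intro)
  have sub: "G.subexponential \<Z>" using ne G.not_exponential_growth_iff[OF \<Z>] by blast
  obtain L where L: "\<And>n. \<exists>Z\<in>\<Z>. \<exists>x\<in>carrier G - G.nbhd Z n. \<exists>y\<in>carrier G - G.nbhd Z n.
       (x, y) \<notin> (G.edges_in (carrier G - G.nbhd Z L))\<^sup>*"
    using sepZ G.coarsely_separated_iff_edges[OF \<Z>] by blast
  obtain C where C: "K \<subseteq> G.ball C"
    using G.finite_subset_word_ball[OF S(2) K(1)] S(3) K(2) by auto
  have f_ball: "\<exists>c\<in>G.ball (C * n). f (h \<otimes>\<^bsub>H\<^esub> b) = f h \<otimes>\<^bsub>G\<^esub> c"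
    if h: "h \<in> carrier H" and "b \<in> H.ball n" for h b n
    using that(2)
  proof (induction n arbitrary: b)
    case 0
    have "f h \<in> carrier G" using h f by blast
    then show ?case using 0 h by simp
  next
    case (Suc n)
    show ?case
    proof (cases "b \<in> H.ball n")
      case True
      then show ?thesis using Suc.IH G.word_ball_mono[of "C * n" "C * Suc n" S] by fastforce
    next
      case False
      then obtain g t where g: "b = g \<otimes>\<^bsub>H\<^esub> t" "g \<in> H.ball n" "t \<in> T \<union> (\<lambda>t. inv\<^bsub>H\<^esub> t) ` T"
        using Suc.prems by auto
      have gt: "g \<in> carrier H" "t \<in> carrier H" using g H.ball_carrier T by auto
      obtain c where c: "c \<in> G.ball (C * n)" "f (h \<otimes>\<^bsub>H\<^esub> g) = f h \<otimes>\<^bsub>G\<^esub> c" using Suc.IH g by blast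
      obtain k where k: "k \<in> K" "f ((h \<otimes>\<^bsub>H\<^esub> g) \<otimes>\<^bsub>H\<^esub> t) = f (h \<otimes>\<^bsub>H\<^esub> g) \<otimes>\<^bsub>G\<^esub> k"
        using f_step[OF _ g(3)] h gt by blast
      have "f h \<in> carrier G" "c \<in> carrier G" "k \<in> carrier G" using h f c G.ball_carrier k K by auto
      then have "f (h \<otimes>\<^bsub>H\<^esub> b) = f h \<otimes>\<^bsub>G\<^esub> (c \<otimes>\<^bsub>G\<^esub> k)"
        using k c h gt by (simp add: g G.m_assoc H.m_assoc)
      moreover have "c \<otimes>\<^bsub>G\<^esub> k \<in> G.ball (C * Suc n)"
        using G.ball_mult[OF c(1)] k(1) C by (metis add.commute mult_Suc_right subsetD)
      ultimately show ?thesis by blast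
    qed
  qed
  \<comment> \<open>Neighbours in \<open>H\<close> are sent to points at distance at most \<open>C\<close>. Removing \<open>C\<close> more than \<open>L\<close> ensures that
    the short paths between the images of neighbours avoid the \<open>L\<close>-neighbourhood of \<open>Z\<close>.\<close>
  define l where "l = L + C"
  define W where "W g Z = {h \<in> carrier H. g \<otimes>\<^bsub>G\<^esub> f h \<in> G.nbhd Z l}" for g Z
  define \<W> where "\<W> = {W g Z |g Z. g \<in> carrier G \<and> Z \<in> \<Z>}"
  have \<W>: "\<forall>Z\<in>\<W>. Z \<subseteq> carrier H" by (auto simp: \<W>_def W_def)
  have "H.subexponential \<W>" unfolding H.subexponential_def
  proof (intro allI impI)
    fix e :: real assume "e > 0"
    obtain n0 where n0: "\<And>n Z p. n \<ge> n0 \<Longrightarrow> Z \<in> \<Z> \<Longrightarrow> p \<in> carrier G \<Longrightarrow>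
        real (card (G.nbhd Z l \<inter> G.ball_at p (C * n))) \<le> exp (e * real n)"
      using G.subexponential_nbhd[OF sub \<Z> \<open>e > 0\<close>, of l C] by blast
    have "real (card (H.ball_at h n \<inter> W g Z)) \<le> exp (e * real n)"
      if n: "n \<ge> n0" and g: "g \<in> carrier G" "Z \<in> \<Z>" "h \<in> W g Z" for n g Z h
    proof -
      have h: "h \<in> carrier H" using g by (simp add: W_def)
      then have gh: "g \<otimes>\<^bsub>G\<^esub> f h \<in> carrier G" using g f by auto
      have "(\<lambda>x. g \<otimes>\<^bsub>G\<^esub> f x) ` (H.ball_at h n \<inter> W g Z) \<subseteq> G.nbhd Z l \<inter> G.ball_at (g \<otimes>\<^bsub>G\<^esub> f h) (C * n)"
      proof clarify
        fix x assume x: "x \<in> H.ball_at h n" "x \<in> W g Z"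
        then have xc: "x \<in> carrier H" "inv\<^bsub>H\<^esub> h \<otimes>\<^bsub>H\<^esub> x \<in> H.ball n" by (auto simp: H.ball_at_def)
        have "h \<otimes>\<^bsub>H\<^esub> (inv\<^bsub>H\<^esub> h \<otimes>\<^bsub>H\<^esub> x) = x" using h xc by (simp add: H.m_assoc[symmetric])
        then obtain c where "c \<in> G.ball (C * n)" "f x = f h \<otimes>\<^bsub>G\<^esub> c" using f_ball[OF h xc(2)] by auto
        moreover have "f h \<in> carrier G" using h f by auto
        ultimately have "g \<otimes>\<^bsub>G\<^esub> f x \<in> G.ball_at (g \<otimes>\<^bsub>G\<^esub> f h) (C * n)"
          using g G.ball_carrier by (auto simp: G.ball_at_eq[OF gh] G.m_assoc)
        then show "g \<otimes>\<^bsub>G\<^esub> f x \<in> G.nbhd Z l \<inter> G.ball_at (g \<otimes>\<^bsub>G\<^esub> f h) (C * n)"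
          using x(2) by (simp add: W_def)
      qed
      moreover have "inj_on (\<lambda>x. g \<otimes>\<^bsub>G\<^esub> f x) (H.ball_at h n \<inter> W g Z)"
      proof (rule inj_onI)
        fix x y assume a: "x \<in> H.ball_at h n \<inter> W g Z" "y \<in> H.ball_at h n \<inter> W g Z"
          "g \<otimes>\<^bsub>G\<^esub> f x = g \<otimes>\<^bsub>G\<^esub> f y"
        then have xy: "x \<in> carrier H" "y \<in> carrier H" by (auto simp: W_def)
        then have "f x \<in> carrier G" "f y \<in> carrier G" using f by auto
        then have "f x = f y" using a(3) g by simp
        then show "x = y" using f(2) xy by (auto dest: inj_onD)
      qed
      ultimately have "card (H.ball_at h n \<inter> W g Z) \<le> card (G.nbhd Z l \<inter> G.ball_at (g \<otimes>\<^bsub>G\<^esub> f h) (C * n))"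
        using G.card_ball_at_le(1)[OF gh] by (intro card_inj_on_le) auto
      then show ?thesis using n0[OF n g(2) gh] by linarith
    qed
    then show "\<exists>n0. \<forall>n\<ge>n0. \<forall>Z\<in>\<W>. \<forall>z\<in>Z. real (card (H.ball_at z n \<inter> Z)) \<le> exp (e * real n)"
      unfolding \<W>_def by blast
  qed
  then have ne': "\<not> exponential_growth (cayley_graph H T) \<W>"
    using H.not_exponential_growth_iff[OF \<W>] by blast
  have "\<exists>Z\<in>\<W>. \<exists>x\<in>carrier H - H.nbhd Z n. \<exists>y\<in>carrier H - H.nbhd Z n.
       (x, y) \<notin> (H.edges_in (carrier H - H.nbhd Z 0))\<^sup>*" for n
  proof -
    \<comment> \<open>This depth in \<open>G\<close> guarantees depth \<open>n\<close> in \<open>H\<close> after pulling back.\<close>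
    define m where "m = l + C * n"
    obtain Z x y where Z: "Z \<in> \<Z>" and x: "x \<in> carrier G" "x \<notin> G.nbhd Z m"
      and y: "y \<in> carrier G" "y \<notin> G.nbhd Z m"
      and xy: "(x, y) \<notin> (G.edges_in (carrier G - G.nbhd Z L))\<^sup>*" using L[of m] by blast
    have Zc: "Z \<subseteq> carrier G" using Z \<Z> by blast
    \<comment> \<open>\<open>P g\<close>: the deep points of the translate of \<open>f(H)\<close> by \<open>g\<close> all lie in the component of \<open>x\<close>.\<close>
    define P where "P g \<longleftrightarrow> (\<forall>h\<in>carrier H. g \<otimes>\<^bsub>G\<^esub> f h \<notin> G.nbhd Z m \<longrightarrow>
        (x, g \<otimes>\<^bsub>G\<^esub> f h) \<in> (G.edges_in (carrier G - G.nbhd Z L))\<^sup>*)" for g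
    have "\<exists>g\<in>carrier G. \<exists>h\<in>carrier H. \<exists>h'\<in>carrier H. g \<otimes>\<^bsub>G\<^esub> f h \<notin> G.nbhd Z m \<and>
       g \<otimes>\<^bsub>G\<^esub> f h' \<notin> G.nbhd Z m \<and>
       (g \<otimes>\<^bsub>G\<^esub> f h, g \<otimes>\<^bsub>G\<^esub> f h') \<notin> (G.edges_in (carrier G - G.nbhd Z L))\<^sup>*"
    proof (rule ccontr)
      assume "\<not> ?thesis"
      then have coset: "(g \<otimes>\<^bsub>G\<^esub> f h, g \<otimes>\<^bsub>G\<^esub> f h') \<in> (G.edges_in (carrier G - G.nbhd Z L))\<^sup>*"
        if "g \<in> carrier G" "h \<in> carrier H" "h' \<in> carrier H" "g \<otimes>\<^bsub>G\<^esub> f h \<notin> G.nbhd Z m"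
          "g \<otimes>\<^bsub>G\<^esub> f h' \<notin> G.nbhd Z m" for g h h' using that by blast
      obtain h1 where h1: "h1 \<in> carrier H" "f h1 = \<one>\<^bsub>G\<^esub>" using f(3) by force
      have Px: "P x" unfolding P_def using coset[OF x(1) h1(1)] x h1(2) by simp
      \<comment> \<open>A common deep point carries the property from one translate to another.\<close>
      have pass: "P g'" if P: "P g" and c: "g \<in> carrier G" "g' \<in> carrier G"
        and p: "h \<in> carrier H" "h' \<in> carrier H" "g \<otimes>\<^bsub>G\<^esub> f h = g' \<otimes>\<^bsub>G\<^esub> f h'" "g \<otimes>\<^bsub>G\<^esub> f h \<notin> G.nbhd Z m" for g g' h h'
        unfolding P_def
      proof (intro ballI impI)
        fix h'' assume h: "h'' \<in> carrier H" "g' \<otimes>\<^bsub>G\<^esub> f h'' \<notin> G.nbhd Z m"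
        have "(x, g' \<otimes>\<^bsub>G\<^esub> f h') \<in> (G.edges_in (carrier G - G.nbhd Z L))\<^sup>*"
          using P p by (auto simp: P_def)
        moreover have "(g' \<otimes>\<^bsub>G\<^esub> f h', g' \<otimes>\<^bsub>G\<^esub> f h'') \<in> (G.edges_in (carrier G - G.nbhd Z L))\<^sup>*"
          using coset[OF c(2) p(2) h(1)] p h by simp
        ultimately show "(x, g' \<otimes>\<^bsub>G\<^esub> f h'') \<in> (G.edges_in (carrier G - G.nbhd Z L))\<^sup>*"
          by (rule rtrancl_trans)
      qed
      \<comment> \<open>Adjacent translates have a common deep point, by exponential growth of the overlap.\<close>
      have meet: "\<exists>h\<in>carrier H. \<exists>h'\<in>carrier H. g \<otimes>\<^bsub>G\<^esub> f h = (g \<otimes>\<^bsub>G\<^esub> u) \<otimes>\<^bsub>G\<^esub> f h' \<and> g \<otimes>\<^bsub>G\<^esub> f h \<notin> G.nbhd Z m"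
        if g: "g \<in> carrier G" and u: "u \<in> U" for g u
      proof -
        have uc: "u \<in> carrier G" using u U by blast
        obtain a b where ab: "a \<in> carrier G" "b \<in> carrier G"
          and inj: "\<And>n. inj_on (two_letter_word G a b) {w. length w = n}"
          and img: "\<And>w. two_letter_word G a b w \<in> f ` carrier H" "\<And>w. u \<otimes>\<^bsub>G\<^esub> two_letter_word G a b w \<in> f ` carrier H"
          using overlap[OF u] by blast
        obtain c where c: "a \<in> G.ball c" "b \<in> G.ball c"
          using G.finite_subset_word_ball[OF S(2), of "{a, b}"] S(3) ab by auto
        define X where "X n = two_letter_word G a b ` {w. length w = n}" for n
        have X1: "X n \<subseteq> G.ball (c * n)" for n using G.two_letter_word_ball[OF c] by (auto simp: X_def)
        have "card {w :: bool list. length w = n} = 2 ^ n" for n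
          using card_lists_length_eq[of "UNIV :: bool set" n] by simp
        then have X2: "2 ^ n \<le> card (X n)" for n unfolding X_def by (simp add: card_image[OF inj])
        obtain n where "\<forall>Z\<in>\<Z>. \<forall>p\<in>carrier G. \<exists>x\<in>X n. p \<otimes>\<^bsub>G\<^esub> x \<notin> G.nbhd Z m"
          using G.exponential_set_leaves_nbhd[OF sub \<Z> X1 X2] by blast
        then obtain x where xX: "x \<in> X n" "(g \<otimes>\<^bsub>G\<^esub> u) \<otimes>\<^bsub>G\<^esub> x \<notin> G.nbhd Z m" using Z g uc by blast
        then obtain w where w: "x = two_letter_word G a b w" by (auto simp: X_def)
        obtain h' where h': "h' \<in> carrier H" "x = f h'" using img(1) w by blast
        obtain h where h: "h \<in> carrier H" "u \<otimes>\<^bsub>G\<^esub> x = f h" using img(2) w by blast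
        have "x \<in> carrier G" using h' f by auto
        then have "g \<otimes>\<^bsub>G\<^esub> f h = (g \<otimes>\<^bsub>G\<^esub> u) \<otimes>\<^bsub>G\<^esub> f h'" using g uc h h' by (metis G.m_assoc)
        then show ?thesis using h h' xX(2) by metis
      qed
      have "\<forall>g\<in>carrier G. P g \<longrightarrow> P (g \<otimes>\<^bsub>G\<^esub> v)" if "v \<in> generate G U" for v
        using that
      proof induction
        case one
        then show ?case by simp
      next
        case (incl u)
        show ?case
        proof (intro ballI impI)
          fix g assume g: "g \<in> carrier G" "P g"
          obtain h h' where "h \<in> carrier H" "h' \<in> carrier H" "g \<otimes>\<^bsub>G\<^esub> f h = (g \<otimes>\<^bsub>G\<^esub> u) \<otimes>\<^bsub>G\<^esub> f h'"
            "g \<otimes>\<^bsub>G\<^esub> f h \<notin> G.nbhd Z m" using meet[OF g(1) incl] by blast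
          then show "P (g \<otimes>\<^bsub>G\<^esub> u)" using pass[OF g(2,1), of "g \<otimes>\<^bsub>G\<^esub> u" h h'] incl U(1) g by auto
        qed
      next
        case (inv u)
        have uc: "u \<in> carrier G" using inv U by blast
        show ?case
        proof (intro ballI impI)
          fix g assume g: "g \<in> carrier G" "P g"
          let ?g = "g \<otimes>\<^bsub>G\<^esub> inv\<^bsub>G\<^esub> u"
          have gc: "?g \<in> carrier G" and eq: "?g \<otimes>\<^bsub>G\<^esub> u = g" using g uc by (simp_all add: G.m_assoc)
          obtain h h' where "h \<in> carrier H" "h' \<in> carrier H" "?g \<otimes>\<^bsub>G\<^esub> f h = g \<otimes>\<^bsub>G\<^esub> f h'"
            "?g \<otimes>\<^bsub>G\<^esub> f h \<notin> G.nbhd Z m" using meet[OF gc inv] eq by auto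
          then show "P ?g" using pass[OF g(2,1) gc, of h' h] by auto
        qed
      next
        case (eng v v')
        have "v \<in> carrier G" "v' \<in> carrier G" using eng.hyps U by auto
        then show ?case using eng.IH by (metis G.m_assoc G.m_closed)
      qed
      moreover have "inv\<^bsub>G\<^esub> x \<otimes>\<^bsub>G\<^esub> y \<in> generate G U" using U(2) x y by simp
      ultimately have "P (x \<otimes>\<^bsub>G\<^esub> (inv\<^bsub>G\<^esub> x \<otimes>\<^bsub>G\<^esub> y))" using Px x by blast
      then have "P y" using x y by (simp add: G.m_assoc[symmetric])
      then have "(x, y) \<in> (G.edges_in (carrier G - G.nbhd Z L))\<^sup>*" using h1 y unfolding P_def by force
      then show False using xy by simp
    qed
    then obtain g h h' where g: "g \<in> carrier G" and h: "h \<in> carrier H" "h' \<in> carrier H"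
      and deep: "g \<otimes>\<^bsub>G\<^esub> f h \<notin> G.nbhd Z m" "g \<otimes>\<^bsub>G\<^esub> f h' \<notin> G.nbhd Z m"
      and cut: "(g \<otimes>\<^bsub>G\<^esub> f h, g \<otimes>\<^bsub>G\<^esub> f h') \<notin> (G.edges_in (carrier G - G.nbhd Z L))\<^sup>*" by blast
    have WW: "W g Z \<in> \<W>" using g Z by (auto simp: \<W>_def)
    have far: "k \<notin> H.nbhd (W g Z) n" if "g \<otimes>\<^bsub>G\<^esub> f k \<notin> G.nbhd Z m" for k
    proof
      assume "k \<in> H.nbhd (W g Z) n"
      then obtain w b where w: "k = w \<otimes>\<^bsub>H\<^esub> b" "w \<in> W g Z" "b \<in> H.ball n" by (auto simp: H.nbhd_def)
      then have wc: "w \<in> carrier H" "g \<otimes>\<^bsub>G\<^esub> f w \<in> G.nbhd Z l" by (auto simp: W_def)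
      obtain c where c: "c \<in> G.ball (C * n)" "f k = f w \<otimes>\<^bsub>G\<^esub> c" using f_ball[OF wc(1) w(3)] w(1) by auto
      have "g \<otimes>\<^bsub>G\<^esub> f k = (g \<otimes>\<^bsub>G\<^esub> f w) \<otimes>\<^bsub>G\<^esub> c"
        using c(2) g G.ball_carrier[OF c(1)] funcset_mem[OF f(1) wc(1)] by (simp add: G.m_assoc)
      then show False using that G.nbhd_mult[OF Zc wc(2) c(1)] by (simp add: m_def)
    qed
    have W0: "H.nbhd (W g Z) 0 = W g Z" using \<W> WW by (force simp: H.nbhd_def)
    have edge: "(g \<otimes>\<^bsub>G\<^esub> f a, g \<otimes>\<^bsub>G\<^esub> f b) \<in> (G.edges_in (carrier G - G.nbhd Z L))\<^sup>*"
      if "(a, b) \<in> H.edges_in (carrier H - W g Z)" for a b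
    proof -
      have a: "a \<in> carrier H" "b \<in> carrier H" "inv\<^bsub>H\<^esub> a \<otimes>\<^bsub>H\<^esub> b \<in> H.ball 1" "g \<otimes>\<^bsub>G\<^esub> f a \<notin> G.nbhd Z l"
        using that by (auto simp: H.edges_in_def W_def)
      have ga: "g \<otimes>\<^bsub>G\<^esub> f a \<in> carrier G" using g a f by auto
      have "a \<otimes>\<^bsub>H\<^esub> (inv\<^bsub>H\<^esub> a \<otimes>\<^bsub>H\<^esub> b) = b" using a by (simp add: H.m_assoc[symmetric])
      then obtain c where c: "c \<in> G.ball C" "f b = f a \<otimes>\<^bsub>G\<^esub> c" using f_ball[OF a(1,3)] by auto
      have gb: "g \<otimes>\<^bsub>G\<^esub> f b = (g \<otimes>\<^bsub>G\<^esub> f a) \<otimes>\<^bsub>G\<^esub> c"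
        using c(2) g G.ball_carrier[OF c(1)] funcset_mem[OF f(1) a(1)] by (simp add: G.m_assoc)
      have stay: "(g \<otimes>\<^bsub>G\<^esub> f a) \<otimes>\<^bsub>G\<^esub> d \<in> carrier G - G.nbhd Z L" if d: "d \<in> G.ball C" for d
      proof -
        have dc: "d \<in> carrier G" using d G.ball_carrier by blast
        have "(g \<otimes>\<^bsub>G\<^esub> f a) \<otimes>\<^bsub>G\<^esub> d \<otimes>\<^bsub>G\<^esub> inv\<^bsub>G\<^esub> d = g \<otimes>\<^bsub>G\<^esub> f a" using ga dc by (simp add: G.m_assoc)
        then have "(g \<otimes>\<^bsub>G\<^esub> f a) \<otimes>\<^bsub>G\<^esub> d \<notin> G.nbhd Z L"
          using G.nbhd_mult[OF Zc _ G.ball_inv[OF d]] a(4) unfolding l_def by metis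
        then show ?thesis using ga dc by simp
      qed
      show ?thesis unfolding gb by (rule G.edge_path[OF _ ga stay c(1)]) auto
    qed
    have "(h, h') \<notin> (H.edges_in (carrier H - W g Z))\<^sup>*"
    proof
      assume "(h, h') \<in> (H.edges_in (carrier H - W g Z))\<^sup>*"
      then have "(g \<otimes>\<^bsub>G\<^esub> f h, g \<otimes>\<^bsub>G\<^esub> f h') \<in> (G.edges_in (carrier G - G.nbhd Z L))\<^sup>*"
      proof induction
        case base
        show ?case by (rule rtrancl_refl)
      next
        case (step a b)
        show ?case by (rule rtrancl_trans[OF step.IH edge[OF step.hyps(2)]])
      qed
      then show False using cut by simp
    qed
    then show ?thesis using WW far[OF deep(1)] far[OF deep(2)] h W0
      by (intro bexI[of _ "W g Z"] bexI[of _ h] bexI[of _ h']) auto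
  qed
  then have "coarsely_separated (carrier H) H.word_dist {carrier H} \<W>"
    unfolding H.coarsely_separated_iff_edges[OF \<W>] by blast
  then show ?thesis unfolding coarsely_separable_subexp_def using T \<W> ne' by blast
qed

section \<open>Universal properties of Artin groups and graph products\<close>

lemma (in monoid) word_eval_cong_class:
  assumes \<phi>: "\<And>l. l \<in> L \<Longrightarrow> \<phi> l \<in> carrier G"
    and rel: "\<And>u v. (u, v) \<in> R \<Longrightarrow> u \<in> lists L \<Longrightarrow> v \<in> lists L \<Longrightarrow> word_eval G \<phi> u = word_eval G \<phi> v"
    and "(u, v) \<in> word_cong L R"
  shows "word_eval G \<phi> u = word_eval G \<phi> v"
proof -
  have step: "word_eval G \<phi> u = word_eval G \<phi> v" if uv: "(u, v) \<in> word_step L R" for u v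
  proof -
    obtain a x y b where x: "u = a @ x @ b" "v = a @ y @ b" "a \<in> lists L" "b \<in> lists L"
      "x \<in> lists L" "y \<in> lists L" "(x, y) \<in> R" using uv unfolding word_step_def by blast
    have split: "word_eval G \<phi> (a @ z @ b) = word_eval G \<phi> a \<otimes> (word_eval G \<phi> z \<otimes> word_eval G \<phi> b)"
      if "z \<in> lists L" for z
      using that x(3,4) word_eval_append[where \<phi> = \<phi> and L = L, OF \<phi>] by simp
    show ?thesis unfolding x(1,2) split[OF x(5)] split[OF x(6)] rel[OF x(7,5,6)] ..
  qed
  have "(u, v) \<in> (word_step L R \<union> (word_step L R)\<inverse>)\<^sup>*" using assms(3) by (simp add: word_cong_def)
  then show ?thesis
  proof induction
    case (step v w)
    then show ?case using \<open>\<And>u v. (u, v) \<in> word_step L R \<Longrightarrow> _\<close> by (metis UnE converseD)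
  qed simp
qed

lemma word_monoid_carrier: "carrier (word_monoid L R) = (\<lambda>w. word_cong L R `` {w}) ` lists L"
  by (auto simp: word_monoid_def quotient_def)

lemma word_monoid_one: "\<one>\<^bsub>word_monoid L R\<^esub> = word_cong L R `` {[]}"
  by (simp add: word_monoid_def)

lemma word_monoid_lift:
  assumes "group H" and \<phi>: "\<And>l. l \<in> L \<Longrightarrow> \<phi> l \<in> carrier H"
    and rel: "\<And>u v. (u, v) \<in> R \<Longrightarrow> u \<in> lists L \<Longrightarrow> v \<in> lists L \<Longrightarrow> word_eval H \<phi> u = word_eval H \<phi> v"
  obtains h where "h \<in> hom (word_monoid L R) H" "\<And>l. l \<in> L \<Longrightarrow> h (word_cong L R `` {[l]}) = \<phi> l"
proof -
  interpret H: group H by fact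
  let ?c = "\<lambda>w. word_cong L R `` {w}"
  define h where "h A = word_eval H \<phi> (SOME w. w \<in> A)" for A
  have h: "h (?c w) = word_eval H \<phi> w" if "w \<in> lists L" for w
  proof -
    have "w \<in> ?c w" using equiv_class_self[OF equiv_word_cong that] .
    then have "(SOME v. v \<in> ?c w) \<in> ?c w" by (rule someI)
    then have "(w, SOME v. v \<in> ?c w) \<in> word_cong L R" by simp
    from H.word_eval_cong_class[OF \<phi> rel this] show ?thesis unfolding h_def by simp
  qed
  have "h \<in> hom (word_monoid L R) H"
  proof (rule homI)
    fix A assume "A \<in> carrier (word_monoid L R)"
    then obtain v where v: "v \<in> lists L" "A = ?c v" unfolding word_monoid_carrier by blast
    then show "h A \<in> carrier H" using h H.word_eval_closed[where L = L, OF \<phi>] by simp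
    fix B assume "B \<in> carrier (word_monoid L R)"
    then obtain w where w: "w \<in> lists L" "B = ?c w" unfolding word_monoid_carrier by blast
    show "h (A \<otimes>\<^bsub>word_monoid L R\<^esub> B) = h A \<otimes>\<^bsub>H\<^esub> h B"
      using v w h H.word_eval_append[where L = L, OF \<phi>] by (simp add: word_monoid_mult_class)
  qed
  moreover have "h (?c [l]) = \<phi> l" if "l \<in> L" for l using h[of "[l]"] that \<phi> by simp
  ultimately show thesis using that by blast
qed

lemma word_monoid_generate:
  assumes "group (word_monoid L R)"
  shows "generate (word_monoid L R) ((\<lambda>l. word_cong L R `` {[l]}) ` L) = carrier (word_monoid L R)"
proof
  interpret group "word_monoid L R" by fact
  let ?c = "\<lambda>w. word_cong L R `` {w}"
  show "generate (word_monoid L R) ((\<lambda>l. ?c [l]) ` L) \<subseteq> carrier (word_monoid L R)"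
    by (rule generate_incl) (auto simp: word_monoid_carrier)
  have "?c w \<in> generate (word_monoid L R) ((\<lambda>l. ?c [l]) ` L)" if "w \<in> lists L" for w
    using that
  proof induction
    case Nil
    show ?case by (metis generate.one word_monoid_one)
  next
    case (Cons l w)
    then have "?c [l] \<otimes>\<^bsub>word_monoid L R\<^esub> ?c w \<in> generate (word_monoid L R) ((\<lambda>l. ?c [l]) ` L)"
      by (intro generate.eng[OF generate.incl]) blast+
    then show ?case using Cons.hyps by (simp add: word_monoid_mult_class)
  qed
  then show "carrier (word_monoid L R) \<subseteq> generate (word_monoid L R) ((\<lambda>l. ?c [l]) ` L)"
    by (auto simp: word_monoid_carrier)
qed

text \<open>
  The quotient map, which sends an element to its coset modulo the normal closure of the relators.
\<close>
definition relator_class :: "('g, 'm) monoid_scheme \<Rightarrow> 'g set \<Rightarrow> 'g \<Rightarrow> 'g set" where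
  "relator_class G R g = ((\<lambda>N. N \<lhd> G) hull R) #>\<^bsub>G\<^esub> g"

lemma relator_class_hom:
  assumes "group G" "R \<subseteq> carrier G"
  shows "relator_class G R \<in> hom G (quotient_by_relators G R)"
  using normal.r_coset_hom_Mod[OF group.normal_hull[OF assms]]
  unfolding quotient_by_relators_def relator_class_def[abs_def] .

lemma relator_class_group_hom:
  assumes "group G" "R \<subseteq> carrier G"
  shows "group_hom G (quotient_by_relators G R) (relator_class G R)"
  using assms(1) group_quotient_by_relators[OF assms] relator_class_hom[OF assms]
  by (simp add: group_hom_def group_hom_axioms_def)

lemma relator_class_surj: "relator_class G R ` carrier G = carrier (quotient_by_relators G R)"
  by (auto simp: quotient_by_relators_def relator_class_def carrier_FactGroup)

lemma relator_class_relator: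
  assumes "group G" "R \<subseteq> carrier G" "r \<in> R"
  shows "relator_class G R r = \<one>\<^bsub>quotient_by_relators G R\<^esub>"
proof -
  interpret normal "(\<lambda>N. N \<lhd> G) hull R" G using group.normal_hull[OF assms(1,2)] .
  have "r \<in> (\<lambda>N. N \<lhd> G) hull R" using hull_subset[of R] assms(3) by blast
  then show ?thesis
    by (simp add: relator_class_def quotient_by_relators_def FactGroup_def rcos_const is_subgroup)
qed

text \<open>
  The kernel of \<open>h\<close> is a normal subgroup containing the relators, hence contains their normal closure.
\<close>
lemma quotient_by_relators_lift:
  assumes "group G" "R \<subseteq> carrier G" "group H" "h \<in> hom G H" and R: "\<And>r. r \<in> R \<Longrightarrow> h r = \<one>\<^bsub>H\<^esub>"
  obtains k where "k \<in> hom (quotient_by_relators G R) H"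
    "\<And>g. g \<in> carrier G \<Longrightarrow> k (relator_class G R g) = h g"
proof -
  interpret group_hom G H h using assms by (simp add: group_hom_def group_hom_axioms_def)
  let ?N = "(\<lambda>N. N \<lhd> G) hull R"
  have N: "?N \<lhd> G" using G.normal_hull[OF assms(2)] .
  have ker: "?N \<subseteq> kernel G H h"
    by (rule hull_minimal) (use assms(2) R normal_kernel in \<open>auto simp: kernel_def\<close>)
  have eq: "h x = h y" if xy: "x \<in> carrier G" "y \<in> carrier G" "?N #>\<^bsub>G\<^esub> x = ?N #>\<^bsub>G\<^esub> y" for x y
  proof -
    have "x \<in> ?N #>\<^bsub>G\<^esub> x" using G.rcos_self[OF xy(1)] N by (simp add: normal_imp_subgroup)
    then obtain n where "n \<in> ?N" "x = n \<otimes>\<^bsub>G\<^esub> y" using xy(3) by (auto simp: r_coset_def)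
    then show ?thesis using ker xy by (auto simp: kernel_def)
  qed
  obtain k where "k \<in> hom (G Mod ?N) H" "\<And>x. x \<in> carrier G \<Longrightarrow> k (?N #>\<^bsub>G\<^esub> x) = h x"
    using FactGroup_universal[OF assms(4) N eq] by blast
  then show thesis using that by (simp add: quotient_by_relators_def relator_class_def)
qed

lemma quotient_by_relators_generate:
  assumes "group G" "R \<subseteq> carrier G" "S \<subseteq> carrier G" "generate G S = carrier G"
  shows "generate (quotient_by_relators G R) (relator_class G R ` S) = carrier (quotient_by_relators G R)"
proof -
  interpret group_hom G "quotient_by_relators G R" "relator_class G R"
    by (rule relator_class_group_hom[OF assms(1,2)])
  show ?thesis using generate_img[OF assms(3)] assms(4) relator_class_surj by metis
qed

lemma (in group) commutator_eq_one_iff: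
  assumes "g \<in> carrier G" "h \<in> carrier G"
  shows "commutator G g h = \<one> \<longleftrightarrow> g \<otimes> h = h \<otimes> g"
proof -
  have "commutator G g h = (g \<otimes> h) \<otimes> inv (h \<otimes> g)"
    using assms by (simp add: commutator_def inv_mult_group m_assoc)
  then show ?thesis using assms inv_solve_right'[of "g \<otimes> h" "h \<otimes> g" \<one>]
    inv_solve_right'[of \<one> "g \<otimes> h" "h \<otimes> g"] by simp
qed

lemma (in group_hom) hom_commutator:
  "g \<in> carrier G \<Longrightarrow> h' \<in> carrier G \<Longrightarrow> h (commutator G g h') = commutator H (h g) (h h')"
  by (simp add: commutator_def)

lemma quotient_by_relators_commute:
  assumes "group G" "R \<subseteq> carrier G" "a \<in> carrier G" "b \<in> carrier G" "commutator G a b \<in> R"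
  shows "relator_class G R a \<otimes>\<^bsub>quotient_by_relators G R\<^esub> relator_class G R b
       = relator_class G R b \<otimes>\<^bsub>quotient_by_relators G R\<^esub> relator_class G R a"
proof -
  interpret group_hom G "quotient_by_relators G R" "relator_class G R"
    by (rule relator_class_group_hom[OF assms(1,2)])
  show ?thesis
    using relator_class_relator[OF assms(1,2,5)] assms(3,4)
    by (simp add: hom_commutator H.commutator_eq_one_iff)
qed


text \<open>
  Classes of letters generate any word monoid that is a group; here the negative letters are redundant, being
  inverses of the positive ones.
\<close>
lemma free_group_generate: "generate (free_group S) (free_group_gen S ` S) = carrier (free_group S)"
proof -
  interpret group "free_group S" by (rule group_free_group)
  let ?c = "\<lambda>w. word_cong (S \<times> UNIV) (free_group_relations S) `` {w}"
  have sub: "free_group_gen S ` S \<subseteq> carrier (free_group S)" by (auto intro: free_group_gen_in_carrier)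
  have "?c [l] \<in> generate (free_group S) (free_group_gen S ` S)" if l: "l \<in> S \<times> UNIV" for l
  proof -
    obtain s e where s: "l = (s, e)" "s \<in> S" using l by auto
    show ?thesis
    proof (cases e)
      case True
      then have "?c [l] = free_group_gen S s" using s by (simp add: free_group_gen_def)
      then show ?thesis using s by (simp add: generate.incl)
    next
      case False
      have "([(s, e), (s, \<not> e)], []) \<in> free_group_relations S"
        using s unfolding free_group_relations_def by blast
      then have "([(s, e), (s, \<not> e)], []) \<in> word_cong (S \<times> UNIV) (free_group_relations S)"
        by (rule word_cong_relation) (use s in auto)
      from equiv_class_eq[OF equiv_word_cong this]
      have "?c [l] \<otimes>\<^bsub>free_group S\<^esub> free_group_gen S s = \<one>\<^bsub>free_group S\<^esub>"
        using s False word_monoid_mult_class[of "[l]" "S \<times> UNIV" "[(s, True)]" "free_group_relations S"]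
        by (simp add: free_group_gen_def free_group_def word_monoid_one)
      moreover have "?c [l] \<in> carrier (free_group S)"
        unfolding free_group_def word_monoid_carrier using l by auto
      ultimately have "?c [l] = inv\<^bsub>free_group S\<^esub> free_group_gen S s"
        using s by (metis free_group_gen_in_carrier inv_equality)
      then show ?thesis using s by (simp add: generate.inv)
    qed
  qed
  then have "(\<lambda>l. ?c [l]) ` (S \<times> UNIV) \<subseteq> generate (free_group S) (free_group_gen S ` S)" by blast
  then have "generate (free_group S) ((\<lambda>l. ?c [l]) ` (S \<times> UNIV)) \<subseteq> generate (free_group S) (free_group_gen S ` S)"
    by (rule generate_subgroup_incl) (rule generate_is_subgroup[OF sub])
  then show ?thesis
    using word_monoid_generate[of "S \<times> UNIV" "free_group_relations S"] generate_incl[OF sub] is_group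
    unfolding free_group_def by blast
qed

definition raag_relators :: "'v pair_pre_digraph \<Rightarrow> ('v \<times> bool) list set set" where
  "raag_relators \<Gamma> = {commutator (free_group (pverts \<Gamma>)) (free_group_gen (pverts \<Gamma>) u)
     (free_group_gen (pverts \<Gamma>) v) | u v. (u, v) \<in> parcs \<Gamma>}"

definition raag_gen :: "'v pair_pre_digraph \<Rightarrow> 'v \<Rightarrow> ('v \<times> bool) list set set" where
  "raag_gen \<Gamma> u =
     relator_class (free_group (pverts \<Gamma>)) (raag_relators \<Gamma>) (free_group_gen (pverts \<Gamma>) u)"

definition graph_product_relators ::
    "'v pair_pre_digraph \<Rightarrow> ('v \<Rightarrow> ('g, 'm) monoid_scheme) \<Rightarrow> ('v \<times> 'g) list set set" where
  "graph_product_relators \<Gamma> G =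
     {commutator (free_product (pverts \<Gamma>) G) (free_product_inj (pverts \<Gamma>) G u g)
        (free_product_inj (pverts \<Gamma>) G v h) | u v g h.
          (u, v) \<in> parcs \<Gamma> \<and> g \<in> carrier (G u) \<and> h \<in> carrier (G v)}"

definition gprod_inj ::
    "'v pair_pre_digraph \<Rightarrow> ('v \<Rightarrow> ('g, 'm) monoid_scheme) \<Rightarrow> 'v \<Rightarrow> 'g \<Rightarrow> ('v \<times> 'g) list set set" where
  "gprod_inj \<Gamma> G u g =
     relator_class (free_product (pverts \<Gamma>) G) (graph_product_relators \<Gamma> G)
       (free_product_inj (pverts \<Gamma>) G u g)"

context
  fixes \<Gamma> :: "'v pair_pre_digraph"
  assumes wf: "pair_wf_digraph \<Gamma>"
begin

private abbreviation (input) "F \<equiv> free_group (pverts \<Gamma>)"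

lemma raag_relators_subset: "raag_relators \<Gamma> \<subseteq> carrier F"
  unfolding raag_relators_def
  by (auto dest: pair_wf_digraph.wellformed'[OF wf]
      intro!: group.commutator_closed[OF group_free_group] free_group_gen_in_carrier)

lemma raag_eq: "raag \<Gamma> = quotient_by_relators F (raag_relators \<Gamma>)"
  by (simp add: raag_def raag_relators_def Let_def)

lemma raag_gen_eq: "raag_gen \<Gamma> u = relator_class F (raag_relators \<Gamma>) (free_group_gen (pverts \<Gamma>) u)"
  by (simp add: raag_gen_def)

lemma raag_gen_closed: "u \<in> pverts \<Gamma> \<Longrightarrow> raag_gen \<Gamma> u \<in> carrier (raag \<Gamma>)"
  unfolding raag_eq raag_gen_eq
  using relator_class_hom[OF group_free_group raag_relators_subset] free_group_gen_in_carrier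
  by (metis hom_in_carrier)

lemma raag_gen_commute:
  assumes "(u, v) \<in> parcs \<Gamma>"
  shows "raag_gen \<Gamma> u \<otimes>\<^bsub>raag \<Gamma>\<^esub> raag_gen \<Gamma> v = raag_gen \<Gamma> v \<otimes>\<^bsub>raag \<Gamma>\<^esub> raag_gen \<Gamma> u"
  unfolding raag_eq raag_gen_eq
  by (rule quotient_by_relators_commute[OF group_free_group raag_relators_subset])
    (use assms pair_wf_digraph.wellformed'[OF wf assms] in \<open>auto simp: raag_relators_def intro: free_group_gen_in_carrier\<close>)

lemma raag_generate: "generate (raag \<Gamma>) (raag_gen \<Gamma> ` pverts \<Gamma>) = carrier (raag \<Gamma>)"
  using quotient_by_relators_generate[OF group_free_group raag_relators_subset _ free_group_generate]
  unfolding raag_eq raag_gen_eq by (simp add: image_image image_subset_iff free_group_gen_in_carrier)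

text \<open>
  The universal property: first through words, then through the free group, then through the quotient
  by the commutators. All homomorphisms out of the Artin group used below are obtained from it.
\<close>
lemma raag_lift:
  assumes "group H" and \<phi>: "\<And>u. u \<in> pverts \<Gamma> \<Longrightarrow> \<phi> u \<in> carrier H"
    and comm: "\<And>u v. (u, v) \<in> parcs \<Gamma> \<Longrightarrow> \<phi> u \<otimes>\<^bsub>H\<^esub> \<phi> v = \<phi> v \<otimes>\<^bsub>H\<^esub> \<phi> u"
  obtains h where "h \<in> hom (raag \<Gamma>) H" "\<And>u. u \<in> pverts \<Gamma> \<Longrightarrow> h (raag_gen \<Gamma> u) = \<phi> u"
proof -
  interpret H: group H by fact
  define \<psi> where "\<psi> = (\<lambda>(u, e). if e then \<phi> u else inv\<^bsub>H\<^esub> \<phi> u)"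
  have \<psi>: "\<psi> l \<in> carrier H" if "l \<in> pverts \<Gamma> \<times> UNIV" for l using that \<phi> by (auto simp: \<psi>_def)
  have "word_eval H \<psi> u = word_eval H \<psi> v" if "(u, v) \<in> free_group_relations (pverts \<Gamma>)" for u v
    using that \<phi> by (auto simp: free_group_relations_def \<psi>_def)
  then obtain h where h: "h \<in> hom F H"
    "\<And>l. l \<in> pverts \<Gamma> \<times> UNIV \<Longrightarrow> h (word_cong (pverts \<Gamma> \<times> UNIV) (free_group_relations (pverts \<Gamma>)) `` {[l]}) = \<psi> l"
    using word_monoid_lift[where H = H and \<phi> = \<psi> and L = "pverts \<Gamma> \<times> UNIV" and R = "free_group_relations (pverts \<Gamma>)", OF assms(1) \<psi>]
    unfolding free_group_def by blast
  have hx: "h (free_group_gen (pverts \<Gamma>) u) = \<phi> u" if "u \<in> pverts \<Gamma>" for u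
    using h(2)[of "(u, True)"] that by (simp add: free_group_gen_def \<psi>_def)
  interpret h: group_hom F H h using h(1) assms(1) group_free_group
    by (simp add: group_hom_def group_hom_axioms_def)
  have "h r = \<one>\<^bsub>H\<^esub>" if r: "r \<in> raag_relators \<Gamma>" for r
  proof -
    obtain u v where uv: "r = commutator F (free_group_gen (pverts \<Gamma>) u) (free_group_gen (pverts \<Gamma>) v)" "(u, v) \<in> parcs \<Gamma>" using r unfolding raag_relators_def by blast
    then have "u \<in> pverts \<Gamma>" "v \<in> pverts \<Gamma>" using pair_wf_digraph.wellformed'[OF wf uv(2)] by auto
    then show ?thesis using comm[OF uv(2)] \<phi>
      by (simp add: uv(1) h.hom_commutator free_group_gen_in_carrier hx H.commutator_eq_one_iff)
  qed
  then obtain k where "k \<in> hom (raag \<Gamma>) H" "\<And>g. g \<in> carrier F \<Longrightarrow> k (relator_class F (raag_relators \<Gamma>) g) = h g"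
    using quotient_by_relators_lift[OF group_free_group raag_relators_subset assms(1) h(1)]
    unfolding raag_eq by blast
  then show thesis using that hx unfolding raag_gen_eq by (simp add: free_group_gen_in_carrier)
qed

end

context
  fixes \<Gamma> :: "'v pair_pre_digraph" and G :: "'v \<Rightarrow> ('g, 'm) monoid_scheme"
  assumes wf: "pair_wf_digraph \<Gamma>" and G: "\<And>u. u \<in> pverts \<Gamma> \<Longrightarrow> group (G u)"
begin

private abbreviation (input) "P \<equiv> free_product (pverts \<Gamma>) G"
private abbreviation (input) "\<iota> \<equiv> free_product_inj (pverts \<Gamma>) G"
private abbreviation (input) "RP \<equiv> graph_product_relators \<Gamma> G"
private abbreviation (input) "letters \<equiv> SIGMA u:pverts \<Gamma>. carrier (G u)"

lemma group_free_product_vertices: "group P" using G by (rule group_free_product)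

lemma graph_product_relators_subset: "RP \<subseteq> carrier P"
  unfolding graph_product_relators_def
  by (auto dest: pair_wf_digraph.wellformed'[OF wf]
      intro!: group.commutator_closed[OF group_free_product_vertices] free_product_inj_in_carrier)

lemma graph_product_eq: "graph_product \<Gamma> G = quotient_by_relators P RP"
  by (simp add: graph_product_def graph_product_relators_def Let_def)

lemma gprod_inj_eq: "gprod_inj \<Gamma> G u g = relator_class P RP (\<iota> u g)"
  by (simp add: gprod_inj_def)

lemma gprod_inj_closed:
  "u \<in> pverts \<Gamma> \<Longrightarrow> g \<in> carrier (G u) \<Longrightarrow> gprod_inj \<Gamma> G u g \<in> carrier (graph_product \<Gamma> G)"
  unfolding graph_product_eq gprod_inj_eq
  using relator_class_hom[OF group_free_product_vertices graph_product_relators_subset] free_product_inj_in_carrier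
  by (metis hom_in_carrier)

lemma gprod_inj_mult:
  assumes "u \<in> pverts \<Gamma>" "g \<in> carrier (G u)" "h \<in> carrier (G u)"
  shows "gprod_inj \<Gamma> G u g \<otimes>\<^bsub>graph_product \<Gamma> G\<^esub> gprod_inj \<Gamma> G u h = gprod_inj \<Gamma> G u (g \<otimes>\<^bsub>G u\<^esub> h)"
proof -
  interpret Gu: group "G u" using G assms by blast
  have "([(u, g), (u, h)], [(u, g \<otimes>\<^bsub>G u\<^esub> h)]) \<in> free_product_relations (pverts \<Gamma>) G"
    using assms unfolding free_product_relations_def by blast
  then have "([(u, g), (u, h)], [(u, g \<otimes>\<^bsub>G u\<^esub> h)]) \<in> word_cong letters (free_product_relations (pverts \<Gamma>) G)"
    by (rule word_cong_relation) (use assms in auto)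
  from equiv_class_eq[OF equiv_word_cong this]
  have "\<iota> u g \<otimes>\<^bsub>P\<^esub> \<iota> u h = \<iota> u (g \<otimes>\<^bsub>G u\<^esub> h)"
    using assms word_monoid_mult_class[of "[(u, g)]" letters "[(u, h)]" "free_product_relations (pverts \<Gamma>) G"]
    by (simp add: free_product_inj_def free_product_def)
  then show ?thesis
    using hom_mult[OF relator_class_hom[OF group_free_product_vertices graph_product_relators_subset]] assms
    unfolding graph_product_eq gprod_inj_eq by (metis free_product_inj_in_carrier)
qed

lemma gprod_inj_commute:
  assumes "(u, v) \<in> parcs \<Gamma>" "g \<in> carrier (G u)" "h \<in> carrier (G v)"
  shows "gprod_inj \<Gamma> G u g \<otimes>\<^bsub>graph_product \<Gamma> G\<^esub> gprod_inj \<Gamma> G v h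
       = gprod_inj \<Gamma> G v h \<otimes>\<^bsub>graph_product \<Gamma> G\<^esub> gprod_inj \<Gamma> G u g"
  unfolding graph_product_eq gprod_inj_eq
  by (rule quotient_by_relators_commute[OF group_free_product_vertices graph_product_relators_subset])
    (use assms pair_wf_digraph.wellformed'[OF wf assms(1)] in \<open>auto simp: graph_product_relators_def intro: free_product_inj_in_carrier\<close>)

lemma graph_product_generate:
  "generate (graph_product \<Gamma> G) {gprod_inj \<Gamma> G u g |u g. u \<in> pverts \<Gamma> \<and> g \<in> carrier (G u)}
     = carrier (graph_product \<Gamma> G)"
proof -
  have "generate P ((\<lambda>(u, g). \<iota> u g) ` letters) = carrier P"
    using word_monoid_generate[of letters "free_product_relations (pverts \<Gamma>) G"] group_free_product_vertices
    unfolding free_product_def free_product_inj_def by (simp add: case_prod_beta)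
  moreover have "(\<lambda>(u, g). \<iota> u g) ` letters \<subseteq> carrier P" by (auto simp: graph_product_relators_def intro: free_product_inj_in_carrier)
  ultimately have "generate (graph_product \<Gamma> G) (relator_class P RP ` (\<lambda>(u, g). \<iota> u g) ` letters) = carrier (graph_product \<Gamma> G)"
    unfolding graph_product_eq by (intro quotient_by_relators_generate group_free_product_vertices graph_product_relators_subset)
  moreover have "relator_class P RP ` (\<lambda>(u, g). \<iota> u g) ` letters
      = {gprod_inj \<Gamma> G u g |u g. u \<in> pverts \<Gamma> \<and> g \<in> carrier (G u)}"
    unfolding gprod_inj_eq by (auto simp: image_iff)
  ultimately show ?thesis by simp
qed

text \<open>
  The analogue for graph products. It is applied to a group of permutations, to let the graph product act
  on a set.
\<close>
lemma graph_product_lift: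
  assumes "group H" and \<phi>: "\<And>u. u \<in> pverts \<Gamma> \<Longrightarrow> \<phi> u \<in> hom (G u) H"
    and comm: "\<And>u v g h. (u, v) \<in> parcs \<Gamma> \<Longrightarrow> g \<in> carrier (G u) \<Longrightarrow> h \<in> carrier (G v) \<Longrightarrow>
      \<phi> u g \<otimes>\<^bsub>H\<^esub> \<phi> v h = \<phi> v h \<otimes>\<^bsub>H\<^esub> \<phi> u g"
  obtains k where "k \<in> hom (graph_product \<Gamma> G) H"
    "\<And>u g. u \<in> pverts \<Gamma> \<Longrightarrow> g \<in> carrier (G u) \<Longrightarrow> k (gprod_inj \<Gamma> G u g) = \<phi> u g"
proof -
  interpret H: group H by fact
  have \<phi>c: "\<phi> u g \<in> carrier H" if "u \<in> pverts \<Gamma>" "g \<in> carrier (G u)" for u g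
    using hom_in_carrier[OF \<phi>] that .
  define \<psi> where "\<psi> = (\<lambda>(u, g). \<phi> u g)"
  have \<psi>: "\<psi> l \<in> carrier H" if "l \<in> letters" for l using that \<phi>c by (auto simp: \<psi>_def)
  have "word_eval H \<psi> v = word_eval H \<psi> w" if vw: "(v, w) \<in> free_product_relations (pverts \<Gamma>) G" for v w
  proof -
    consider u where "v = [(u, \<one>\<^bsub>G u\<^esub>)]" "w = []" "u \<in> pverts \<Gamma>"
      | u g h where "v = [(u, g), (u, h)]" "w = [(u, g \<otimes>\<^bsub>G u\<^esub> h)]" "u \<in> pverts \<Gamma>" "g \<in> carrier (G u)" "h \<in> carrier (G u)"
      using vw unfolding free_product_relations_def by blast
    then show ?thesis
    proof cases
      case 1
      then show ?thesis using hom_one[OF \<phi> G assms(1)] by (simp add: \<psi>_def)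
    next
      case 2
      then show ?thesis using \<phi>[of u] \<phi>c by (simp add: \<psi>_def hom_mult)
    qed
  qed
  then obtain h where h: "h \<in> hom P H"
    "\<And>l. l \<in> letters \<Longrightarrow> h (word_cong letters (free_product_relations (pverts \<Gamma>) G) `` {[l]}) = \<psi> l"
    using word_monoid_lift[where H = H and \<phi> = \<psi> and L = letters and R = "free_product_relations (pverts \<Gamma>) G", OF assms(1) \<psi>]
    unfolding free_product_def by blast
  have h\<iota>: "h (\<iota> u g) = \<phi> u g" if "u \<in> pverts \<Gamma>" "g \<in> carrier (G u)" for u g
    using h(2)[of "(u, g)"] that by (simp add: free_product_inj_def \<psi>_def)
  interpret h: group_hom P H h using h(1) assms(1) group_free_product_vertices
    by (simp add: group_hom_def group_hom_axioms_def)
  have "h r = \<one>\<^bsub>H\<^esub>" if r: "r \<in> RP" for r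
  proof -
    obtain u v a b where uv: "r = commutator P (\<iota> u a) (\<iota> v b)" "(u, v) \<in> parcs \<Gamma>"
      "a \<in> carrier (G u)" "b \<in> carrier (G v)" using r unfolding graph_product_relators_def by blast
    then have "u \<in> pverts \<Gamma>" "v \<in> pverts \<Gamma>" using pair_wf_digraph.wellformed'[OF wf uv(2)] by auto
    then show ?thesis using comm[OF uv(2-4)] uv \<phi>c
      by (simp add: h.hom_commutator free_product_inj_in_carrier h\<iota> H.commutator_eq_one_iff)
  qed
  then obtain k where "k \<in> hom (graph_product \<Gamma> G) H" "\<And>g. g \<in> carrier P \<Longrightarrow> k (relator_class P RP g) = h g"
    using quotient_by_relators_lift[OF group_free_product_vertices graph_product_relators_subset assms(1) h(1)]
    unfolding graph_product_eq by blast
  then show thesis using that h\<iota> unfolding gprod_inj_eq by (simp add: free_product_inj_in_carrier)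
qed

end

section \<open>A Lipschitz section of the reduction modulo a weight\<close>

text \<open>
  The cyclic group of order \<open>N\<close> acts on the integers by rotating each block of \<open>N\<close> consecutive
  integers that starts at a multiple of \<open>N\<close>. Adding \<open>m\<close> would not be an action of the cyclic group, but modulo
  \<open>N\<close> the two agree.
\<close>
definition rotate_block :: "int \<Rightarrow> int \<Rightarrow> int \<Rightarrow> int" where
  "rotate_block N m e = N * (e div N) + (e + m) mod N"

lemma rotate_block_add:
  assumes "N > 0" shows "rotate_block N m (rotate_block N n e) = rotate_block N (m + n) e"
proof -
  have "rotate_block N n e div N = e div N" using assms by (simp add: rotate_block_def)
  moreover have "(rotate_block N n e + m) mod N = (e + (m + n)) mod N"
  proof -
    have "(rotate_block N n e + m) mod N = ((e + n) mod N + m) mod N"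
      unfolding rotate_block_def by (metis add.assoc mod_mult_self4)
    then show ?thesis by (simp add: mod_simps ac_simps)
  qed
  ultimately show ?thesis unfolding rotate_block_def[of N m] rotate_block_def[of N "m + n"] by simp
qed

lemma rotate_block_0 [simp]: "rotate_block N 0 e = e"
  by (simp add: rotate_block_def)

lemma rotate_block_mod: "rotate_block N (m mod N) e = rotate_block N m e"
  by (simp add: rotate_block_def mod_simps)

lemma rotate_block_diff: "rotate_block N m e - e = (e + m) mod N - e mod N"
proof -
  have "e = N * (e div N) + e mod N" by simp
  then show ?thesis unfolding rotate_block_def by linarith
qed

lemma rotate_block_diff_bound:
  assumes "N > 0" shows "rotate_block N m e - e \<in> {-N..N}"
  unfolding rotate_block_diff atLeastAtMost_iff
  using pos_mod_bound[OF assms, of "e + m"] pos_mod_bound[OF assms, of e]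
    pos_mod_sign[OF assms, of "e + m"] pos_mod_sign[OF assms, of e] by linarith

lemma rotate_block_diff_mod: "(rotate_block N m e - e) mod N = m mod N"
  unfolding rotate_block_diff by (simp add: mod_simps)

lemma rotate_block_small:
  assumes "0 \<le> e" "e < N" "0 \<le> e + m" "e + m < N"
  shows "rotate_block N m e - e = m"
  unfolding rotate_block_diff using assms by simp

lemma BijGroup_mult: "f \<in> Bij S \<Longrightarrow> g \<in> Bij S \<Longrightarrow> x \<in> S \<Longrightarrow> (f \<otimes>\<^bsub>BijGroup S\<^esub> g) x = f (g x)"
  by (simp add: BijGroup_def compose_def)

lemma BijGroup_mult_Bij: "f \<in> Bij S \<Longrightarrow> g \<in> Bij S \<Longrightarrow> f \<otimes>\<^bsub>BijGroup S\<^esub> g \<in> Bij S"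
  by (simp add: BijGroup_def compose_Bij)

lemma BijGroup_one: "x \<in> S \<Longrightarrow> \<one>\<^bsub>BijGroup S\<^esub> x = x"
  by (simp add: BijGroup_def)

lemma carrier_BijGroup: "carrier (BijGroup S) = Bij S"
  by (simp add: BijGroup_def)

lemma Bij_eqI: "f \<in> Bij S \<Longrightarrow> g \<in> Bij S \<Longrightarrow> (\<And>x. x \<in> S \<Longrightarrow> f x = g x) \<Longrightarrow> f = g"
  by (meson Bij_imp_extensional extensionalityI)

lemma (in group) int_pow_commute:
  assumes "x \<otimes> y = y \<otimes> x" "x \<in> carrier G" "y \<in> carrier G"
  shows "x [^] (i::int) \<otimes> y = y \<otimes> x [^] i"
proof -
  have nat: "x [^] (n::nat) \<otimes> y = y \<otimes> x [^] n" for n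
    using group_commutes_pow assms by blast
  show ?thesis
  proof (cases i rule: int_cases2)
    case (nonneg n)
    then show ?thesis using nat by (simp add: int_pow_int)
  next
    case (nonpos n)
    let ?z = "x [^] n"
    have z: "?z \<in> carrier G" using assms by simp
    have "inv ?z \<otimes> y = inv ?z \<otimes> (y \<otimes> ?z) \<otimes> inv ?z"
      using z assms by (simp add: m_assoc)
    also have "\<dots> = inv ?z \<otimes> (?z \<otimes> y) \<otimes> inv ?z" by (simp only: nat)
    also have "\<dots> = y \<otimes> inv ?z" using z assms by (simp add: m_assoc[symmetric])
    finally show ?thesis using nonpos assms by (simp add: int_pow_neg int_pow_int)
  qed
qed

text \<open>
  The bound \<open>3 \<le> N\<close> leaves room for the exponents \<open>0\<close>, \<open>1\<close> and \<open>2\<close> in one block.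
\<close>
locale raag_with_weight =
  fixes \<Gamma> :: "'v pair_pre_digraph" and N :: nat
  assumes graph: "pair_graph \<Gamma>" and N3: "N \<ge> 3"
begin

abbreviation "V \<equiv> pverts \<Gamma>"
abbreviation "A \<equiv> raag \<Gamma>"
abbreviation "a \<equiv> raag_gen \<Gamma>"
abbreviation "P \<equiv> cyclic_graph_product \<Gamma> (\<lambda>_. N)"
abbreviation "t \<equiv> gprod_inj \<Gamma> (\<lambda>_. integer_mod_group N)"

lemma wf: "pair_wf_digraph \<Gamma>"
  using graph unfolding pair_graph_def pair_digraph_def pair_fin_digraph_def by blast

sublocale A: group A
  by (rule group_raag[OF wf])

sublocale P: group P
  by (rule group_cyclic_graph_product[OF wf])

lemma P_eq: "P = graph_product \<Gamma> (\<lambda>_. integer_mod_group N)"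
  by (simp add: cyclic_graph_product_def)

lemma no_loop: "(u, u) \<notin> parcs \<Gamma>"
proof -
  interpret pair_graph \<Gamma> by (rule graph)
  show ?thesis using no_loops' by blast
qed

lemma arc_sym: "(u, v) \<in> parcs \<Gamma> \<Longrightarrow> (v, u) \<in> parcs \<Gamma>"
proof -
  interpret pair_graph \<Gamma> by (rule graph)
  show "(u, v) \<in> parcs \<Gamma> \<Longrightarrow> (v, u) \<in> parcs \<Gamma>" using arcs_symmetric by blast
qed

lemma finite_V: "finite V"
proof -
  interpret pair_graph \<Gamma> by (rule graph)
  show ?thesis by (rule finite_verts[unfolded with_proj_simps])
qed

lemma arc_verts: "(u, v) \<in> parcs \<Gamma> \<Longrightarrow> u \<in> V \<and> v \<in> V"
  using pair_wf_digraph.wellformed'[OF wf] by blast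

lemmas a_closed [simp] = raag_gen_closed[OF wf]
lemmas a_commute = raag_gen_commute[OF wf]

lemma Z_carrier: "carrier (integer_mod_group N) = {0..<int N}"
  using N3 by (simp add: carrier_integer_mod_group)

lemma mod_Z [simp]: "m mod int N \<in> carrier (integer_mod_group N)"
  using N3 by (simp add: Z_carrier)

lemma t_closed [simp]: "u \<in> V \<Longrightarrow> m \<in> carrier (integer_mod_group N) \<Longrightarrow> t u m \<in> carrier P"
  unfolding P_eq by (rule gprod_inj_closed[OF wf]) auto

lemma t_mult:
  assumes "u \<in> V"
  shows "t u (m mod int N) \<otimes>\<^bsub>P\<^esub> t u (n mod int N) = t u ((m + n) mod int N)"
proof -
  have "t u (m mod int N) \<otimes>\<^bsub>P\<^esub> t u (n mod int N)
      = t u (m mod int N \<otimes>\<^bsub>integer_mod_group N\<^esub> (n mod int N))"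
    unfolding P_eq by (rule gprod_inj_mult[OF wf _ assms mod_Z mod_Z]) (rule group_integer_mod_group)
  then show ?thesis by (simp add: mod_simps)
qed

lemma t_zero:
  assumes "u \<in> V" shows "t u 0 = \<one>\<^bsub>P\<^esub>"
proof -
  have "t u 0 \<in> carrier P" using t_closed[OF assms mod_Z, of 0] by simp
  moreover have "t u 0 \<otimes>\<^bsub>P\<^esub> t u 0 = t u 0" using t_mult[OF assms, of 0 0] by simp
  ultimately show ?thesis using P.r_cancel_one by metis
qed

lemma t_inv:
  assumes "u \<in> V" shows "inv\<^bsub>P\<^esub> (t u (m mod int N)) = t u (- m mod int N)"
proof (rule P.inv_equality)
  show "t u (- m mod int N) \<otimes>\<^bsub>P\<^esub> t u (m mod int N) = \<one>\<^bsub>P\<^esub>"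
    unfolding t_mult[OF assms] using t_zero[OF assms] by simp
qed (rule t_closed[OF assms mod_Z])+

lemma t_pow:
  assumes u: "u \<in> V" shows "t u (1 mod int N) [^]\<^bsub>P\<^esub> (k::int) = t u (k mod int N)"
proof -
  have nat: "t u (1 mod int N) [^]\<^bsub>P\<^esub> (n::nat) = t u (int n mod int N)" for n
  proof (induction n)
    case 0
    show ?case using t_zero[OF u] by simp
  next
    case (Suc n)
    have "t u (1 mod int N) [^]\<^bsub>P\<^esub> Suc n = t u (int n mod int N) \<otimes>\<^bsub>P\<^esub> t u (1 mod int N)"
      unfolding P.nat_pow_Suc Suc.IH ..
    also have "\<dots> = t u ((int n + 1) mod int N)" by (rule t_mult[OF u])
    finally show ?case by (simp add: add.commute)
  qed
  show ?thesis
  proof (cases k rule: int_cases2)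
    case (nonneg n)
    then show ?thesis using nat[of n] by (simp add: int_pow_int)
  next
    case (nonpos n)
    then show ?thesis using nat[of n] t_inv[OF u, of "int n"] t_closed[OF u mod_Z, of 1]
      by (simp add: P.int_pow_neg int_pow_int)
  qed
qed

definition syllables where "syllables = {t u m |u m. u \<in> V \<and> m \<in> carrier (integer_mod_group N)}"

lemma syllables_closed: "syllables \<subseteq> carrier P"
  by (auto simp: syllables_def)

lemma finite_syllables: "finite syllables"
proof -
  have "syllables = (\<lambda>(u, m). t u m) ` (V \<times> {0..<int N})" unfolding syllables_def Z_carrier by fast
  then show ?thesis using finite_V by simp
qed

lemma syllables_generate: "generate P syllables = carrier P"
  unfolding P_eq syllables_def by (rule graph_product_generate[OF wf]) auto

lemma syllables_cases:
  assumes "x \<in> syllables" obtains u m where "u \<in> V" "x = t u (m mod int N)"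
proof -
  obtain u m where "u \<in> V" "x = t u m" "m \<in> {0..<int N}" using assms by (auto simp: syllables_def Z_carrier)
  then show thesis using that[of u m] by simp
qed

text \<open>
  The exponent sum of the generator \<open>u\<close>.
\<close>
definition exponent :: "'v \<Rightarrow> ('v \<times> bool) list set set \<Rightarrow> int" where
  "exponent u = (SOME h. h \<in> hom A integer_group \<and> (\<forall>v\<in>V. h (a v) = (if v = u then 1 else 0)))"

lemma exponent: "exponent u \<in> hom A integer_group" "v \<in> V \<Longrightarrow> exponent u (a v) = (if v = u then 1 else 0)"
proof -
  obtain h where "h \<in> hom A integer_group" "\<And>v. v \<in> V \<Longrightarrow> h (a v) = (if v = u then 1 else 0)"
    by (rule raag_lift[OF wf group_integer_group, of "\<lambda>v. if v = u then 1 else 0"]) auto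
  then have "\<exists>h. h \<in> hom A integer_group \<and> (\<forall>v\<in>V. h (a v) = (if v = u then 1 else 0))" by blast
  from someI_ex[OF this, folded exponent_def]
  show "exponent u \<in> hom A integer_group" "v \<in> V \<Longrightarrow> exponent u (a v) = (if v = u then 1 else 0)" by auto
qed

lemma exponent_mult [simp]:
  "g \<in> carrier A \<Longrightarrow> h \<in> carrier A \<Longrightarrow> exponent u (g \<otimes>\<^bsub>A\<^esub> h) = exponent u g + exponent u h"
  using hom_mult[OF exponent(1)] by simp

lemma exponent_group_hom: "group_hom A integer_group (exponent u)"
  using exponent(1) A.is_group by (simp add: group_hom_def group_hom_axioms_def)

lemma exponent_one [simp]: "exponent u \<one>\<^bsub>A\<^esub> = 0"
  using group_hom.hom_one[OF exponent_group_hom] by simp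

lemma exponent_inv [simp]: "g \<in> carrier A \<Longrightarrow> exponent u (inv\<^bsub>A\<^esub> g) = - exponent u g"
  using group_hom.hom_inv[OF exponent_group_hom] by simp

lemma exponent_pow [simp]: "g \<in> carrier A \<Longrightarrow> exponent u (g [^]\<^bsub>A\<^esub> (k::int)) = k * exponent u g"
  using group_hom.hom_int_pow[OF exponent_group_hom] by simp

text \<open>
  Right multiplication by the power of \<open>u\<close> that rotates the exponent sum of \<open>u\<close> by \<open>m\<close> inside its block.
  Since the power depends on \<open>h\<close>, this is a permutation of the set \<open>A\<close> rather than a translation.
\<close>
definition turn :: "'v \<Rightarrow> int \<Rightarrow> ('v \<times> bool) list set set \<Rightarrow> ('v \<times> bool) list set set" where
  "turn u m = (\<lambda>h\<in>carrier A. h \<otimes>\<^bsub>A\<^esub> a u [^]\<^bsub>A\<^esub> (rotate_block (int N) m (exponent u h) - exponent u h))"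

lemma turn_closed: "u \<in> V \<Longrightarrow> h \<in> carrier A \<Longrightarrow> turn u m h \<in> carrier A"
  by (simp add: turn_def)

text \<open>
  Each turn performs a block rotation on the exponent sum of \<open>u\<close>, so turns compose as rotations do; the powers
  of \<open>u\<close> telescope.
\<close>
lemma turn_add:
  assumes "u \<in> V" "h \<in> carrier A"
  shows "turn u m (turn u n h) = turn u (m + n) h"
proof -
  let ?e = "exponent u h" and ?r = "rotate_block (int N)"
  have "exponent u (turn u n h) = ?r n ?e" using assms by (simp add: turn_def exponent(2))
  then have "turn u m (turn u n h) = turn u n h \<otimes>\<^bsub>A\<^esub> a u [^]\<^bsub>A\<^esub> (?r (m + n) ?e - ?r n ?e)"
    using turn_closed[OF assms, of n] N3 by (simp add: turn_def rotate_block_add)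
  also have "\<dots> = h \<otimes>\<^bsub>A\<^esub> (a u [^]\<^bsub>A\<^esub> (?r n ?e - ?e) \<otimes>\<^bsub>A\<^esub> a u [^]\<^bsub>A\<^esub> (?r (m + n) ?e - ?r n ?e))"
    using assms by (simp add: turn_def A.m_assoc)
  also have "\<dots> = turn u (m + n) h"
    using assms by (simp add: turn_def flip: A.int_pow_mult)
  finally show ?thesis .
qed

lemma turn_0: "u \<in> V \<Longrightarrow> h \<in> carrier A \<Longrightarrow> turn u 0 h = h"
  by (simp add: turn_def)

lemma turn_mod: "turn u (m mod int N) = turn u m"
  by (simp add: turn_def rotate_block_mod)

lemma turn_Bij: "u \<in> V \<Longrightarrow> turn u m \<in> Bij (carrier A)"
  unfolding Bij_def
proof (intro IntI CollectI)
  assume u: "u \<in> V"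
  show "turn u m \<in> extensional (carrier A)" by (simp add: turn_def)
  show "bij_betw (turn u m) (carrier A) (carrier A)"
    by (rule bij_betw_byWitness[of _ "turn u (- m)"]) (use u in \<open>auto simp: turn_add turn_0 turn_closed\<close>)
qed

text \<open>
  Turning at \<open>v\<close> does not change the exponent sum of \<open>u\<close>, so both sides multiply \<open>h\<close> by the same powers of \<open>u\<close>
  and \<open>v\<close>, and these commute.
\<close>
lemma turn_commute:
  assumes uv: "(u, v) \<in> parcs \<Gamma>" and h: "h \<in> carrier A"
  shows "turn u m (turn v n h) = turn v n (turn u m h)"
proof -
  have c: "u \<in> V" "v \<in> V" "u \<noteq> v" using arc_verts[OF uv] no_loop uv by auto
  have exp: "exponent u (turn v n h) = exponent u h" "exponent v (turn u m h) = exponent v h"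
    using c h by (simp_all add: turn_def exponent(2))
  have pow: "a u [^]\<^bsub>A\<^esub> (i::int) \<otimes>\<^bsub>A\<^esub> a v [^]\<^bsub>A\<^esub> (j::int) = a v [^]\<^bsub>A\<^esub> j \<otimes>\<^bsub>A\<^esub> a u [^]\<^bsub>A\<^esub> i" for i j
  proof -
    have "a v \<otimes>\<^bsub>A\<^esub> a u [^]\<^bsub>A\<^esub> i = a u [^]\<^bsub>A\<^esub> i \<otimes>\<^bsub>A\<^esub> a v"
      using A.int_pow_commute[OF a_commute[OF uv]] c by simp
    from A.int_pow_commute[OF this] show ?thesis using c by simp
  qed
  have cl: "turn u m h \<in> carrier A" "turn v n h \<in> carrier A" using turn_closed c h by auto
  let ?i = "rotate_block (int N) m (exponent u h) - exponent u h"
  let ?j = "rotate_block (int N) n (exponent v h) - exponent v h"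
  have "turn u m (turn v n h) = turn v n h \<otimes>\<^bsub>A\<^esub> a u [^]\<^bsub>A\<^esub> ?i"
    using cl exp by (simp add: turn_def[of u])
  also have "\<dots> = h \<otimes>\<^bsub>A\<^esub> (a v [^]\<^bsub>A\<^esub> ?j \<otimes>\<^bsub>A\<^esub> a u [^]\<^bsub>A\<^esub> ?i)"
    using c h by (simp add: turn_def[of v] A.m_assoc)
  also have "\<dots> = h \<otimes>\<^bsub>A\<^esub> (a u [^]\<^bsub>A\<^esub> ?i \<otimes>\<^bsub>A\<^esub> a v [^]\<^bsub>A\<^esub> ?j)" by (simp only: pow)
  also have "\<dots> = turn u m h \<otimes>\<^bsub>A\<^esub> a v [^]\<^bsub>A\<^esub> ?j"
    using c h by (simp add: turn_def[of u] A.m_assoc)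
  also have "\<dots> = turn v n (turn u m h)" using cl exp by (simp add: turn_def[of v])
  finally show ?thesis .
qed

text \<open>
  The turns at different vertices assemble into an action of \<open>P\<close> on the set \<open>A\<close>. Turns multiply on the right while
  permutations compose on the left; the sign makes \<open>g\<close> act like right multiplication by its inverse, in accordance
  with \<open>reduce_action\<close>.
\<close>
definition action :: "('v \<times> int) list set set \<Rightarrow> ('v \<times> bool) list set set \<Rightarrow> ('v \<times> bool) list set set" where
  "action = (SOME k. k \<in> hom P (BijGroup (carrier A)) \<and>
     (\<forall>u\<in>V. \<forall>m\<in>carrier (integer_mod_group N). k (t u m) = turn u (- m)))"

lemma turn_hom:
  assumes u: "u \<in> V"
  shows "(\<lambda>m. turn u (- m)) \<in> hom (integer_mod_group N) (BijGroup (carrier A))"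
proof (rule homI)
  fix m n
  show "turn u (- m) \<in> carrier (BijGroup (carrier A))"
    unfolding carrier_BijGroup by (rule turn_Bij[OF u])
  have "turn u (- ((m + n) mod int N)) = turn u (- ((m + n) mod int N) mod int N)"
    by (rule turn_mod[symmetric])
  also have "\<dots> = turn u ((- m + - n) mod int N)" by (simp add: mod_minus_eq)
  also have "\<dots> = turn u (- m + - n)" by (rule turn_mod)
  also have "\<dots> = turn u (- m) \<otimes>\<^bsub>BijGroup (carrier A)\<^esub> turn u (- n)"
    by (rule Bij_eqI[OF turn_Bij[OF u] BijGroup_mult_Bij[OF turn_Bij[OF u] turn_Bij[OF u]]])
      (simp only: BijGroup_mult[OF turn_Bij[OF u] turn_Bij[OF u]] turn_add[OF u])
  finally show "turn u (- (m \<otimes>\<^bsub>integer_mod_group N\<^esub> n)) = turn u (- m) \<otimes>\<^bsub>BijGroup (carrier A)\<^esub> turn u (- n)"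
    by (simp only: mult_integer_mod_group)
qed

lemma turn_commute_BijGroup:
  assumes uv: "(u, v) \<in> parcs \<Gamma>"
  shows "turn u m \<otimes>\<^bsub>BijGroup (carrier A)\<^esub> turn v n = turn v n \<otimes>\<^bsub>BijGroup (carrier A)\<^esub> turn u m"
proof -
  have B: "turn u m \<in> Bij (carrier A)" "turn v n \<in> Bij (carrier A)"
    using turn_Bij arc_verts[OF uv] by blast+
  show ?thesis
    by (rule Bij_eqI[OF BijGroup_mult_Bij[OF B] BijGroup_mult_Bij[OF B(2,1)]])
      (simp only: BijGroup_mult[OF B] BijGroup_mult[OF B(2,1)] turn_commute[OF uv])
qed

lemma action: "action \<in> hom P (BijGroup (carrier A))"
  and action_t_carrier: "u \<in> V \<Longrightarrow> m \<in> carrier (integer_mod_group N) \<Longrightarrow> action (t u m) = turn u (- m)"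
proof -
  obtain k where "k \<in> hom P (BijGroup (carrier A))"
    "\<And>u m. u \<in> V \<Longrightarrow> m \<in> carrier (integer_mod_group N) \<Longrightarrow> k (t u m) = turn u (- m)"
  proof (rule graph_product_lift[OF wf group_integer_mod_group group_BijGroup turn_hom turn_commute_BijGroup])
    fix k assume "k \<in> hom (graph_product \<Gamma> (\<lambda>_. integer_mod_group N)) (BijGroup (carrier A))"
      and k: "\<And>u m. u \<in> V \<Longrightarrow> m \<in> carrier (integer_mod_group N) \<Longrightarrow> k (t u m) = turn u (- m)"
    then show thesis using that[OF _ k] unfolding P_eq by simp
  qed
  then have "\<exists>k. k \<in> hom P (BijGroup (carrier A)) \<and>
     (\<forall>u\<in>V. \<forall>m\<in>carrier (integer_mod_group N). k (t u m) = turn u (- m))" by blast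
  from someI_ex[OF this, folded action_def]
  show "action \<in> hom P (BijGroup (carrier A))"
    "u \<in> V \<Longrightarrow> m \<in> carrier (integer_mod_group N) \<Longrightarrow> action (t u m) = turn u (- m)" by blast+
qed

lemma action_t:
  assumes "u \<in> V" shows "action (t u (m mod int N)) = turn u (- m)"
proof -
  have "action (t u (m mod int N)) = turn u (- (m mod int N))"
    by (rule action_t_carrier[OF assms mod_Z])
  also have "\<dots> = turn u (- (m mod int N) mod int N)" by (rule turn_mod[symmetric])
  also have "\<dots> = turn u (- m mod int N)" by (simp only: mod_minus_eq)
  also have "\<dots> = turn u (- m)" by (rule turn_mod)
  finally show ?thesis .
qed

lemma action_Bij: "g \<in> carrier P \<Longrightarrow> action g \<in> Bij (carrier A)"
  using hom_in_carrier[OF action] unfolding carrier_BijGroup .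

lemma action_closed: "g \<in> carrier P \<Longrightarrow> h \<in> carrier A \<Longrightarrow> action g h \<in> carrier A"
  by (rule funcset_mem[OF Bij_imp_funcset[OF action_Bij]])

lemma action_mult:
  assumes "g \<in> carrier P" "g' \<in> carrier P" "h \<in> carrier A"
  shows "action (g \<otimes>\<^bsub>P\<^esub> g') h = action g (action g' h)"
  unfolding hom_mult[OF action assms(1,2)]
  by (rule BijGroup_mult[OF action_Bij[OF assms(1)] action_Bij[OF assms(2)] assms(3)])

lemma action_one: "h \<in> carrier A \<Longrightarrow> action \<one>\<^bsub>P\<^esub> h = h"
  unfolding hom_one[OF action P.is_group group_BijGroup] by (rule BijGroup_one)

definition reduce :: "('v \<times> bool) list set set \<Rightarrow> ('v \<times> int) list set set" where
  "reduce = (SOME h. h \<in> hom A P \<and> (\<forall>u\<in>V. h (a u) = t u (1 mod int N)))"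

lemma reduce: "reduce \<in> hom A P" "u \<in> V \<Longrightarrow> reduce (a u) = t u (1 mod int N)"
proof -
  obtain h where "h \<in> hom A P" "\<And>u. u \<in> V \<Longrightarrow> h (a u) = t u (1 mod int N)"
  proof (rule raag_lift[OF wf P.is_group, of "\<lambda>u. t u (1 mod int N)"])
    fix u v assume "(u, v) \<in> parcs \<Gamma>"
    then show "t u (1 mod int N) \<otimes>\<^bsub>P\<^esub> t v (1 mod int N) = t v (1 mod int N) \<otimes>\<^bsub>P\<^esub> t u (1 mod int N)"
      unfolding P_eq by (intro gprod_inj_commute[OF wf]) auto
  qed (use t_closed mod_Z in blast)+
  then have "\<exists>h. h \<in> hom A P \<and> (\<forall>u\<in>V. h (a u) = t u (1 mod int N))" by blast
  from someI_ex[OF this, folded reduce_def]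
  show "reduce \<in> hom A P" "u \<in> V \<Longrightarrow> reduce (a u) = t u (1 mod int N)" by auto
qed

lemma reduce_group_hom: "group_hom A P reduce"
  using reduce(1) A.is_group P.is_group by (simp add: group_hom_def group_hom_axioms_def)

lemma reduce_closed: "h \<in> carrier A \<Longrightarrow> reduce h \<in> carrier P"
  using hom_in_carrier[OF reduce(1)] .

lemma reduce_turn:
  assumes "u \<in> V" "h \<in> carrier A"
  shows "reduce (turn u m h) = reduce h \<otimes>\<^bsub>P\<^esub> t u (m mod int N)"
proof -
  let ?k = "rotate_block (int N) m (exponent u h) - exponent u h"
  have "reduce (a u [^]\<^bsub>A\<^esub> ?k) = t u (?k mod int N)"
    using group_hom.hom_int_pow[OF reduce_group_hom a_closed[OF assms(1)], of ?k] reduce(2)[OF assms(1)]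
      t_pow[OF assms(1)] by simp
  then show ?thesis using assms
    by (simp add: turn_def hom_mult[OF reduce(1)] rotate_block_diff_mod)
qed

text \<open>
  For one syllable this holds because a block rotation by \<open>m\<close> changes exponents by \<open>m\<close> modulo \<open>N\<close>; both sides are
  compatible with products and inverses.
\<close>
lemma reduce_action:
  assumes "g \<in> carrier P" "h \<in> carrier A"
  shows "reduce (action g h) = reduce h \<otimes>\<^bsub>P\<^esub> inv\<^bsub>P\<^esub> g"
proof -
  have t: "reduce (action g h) = reduce h \<otimes>\<^bsub>P\<^esub> inv\<^bsub>P\<^esub> g" if g: "g \<in> syllables" and h: "h \<in> carrier A" for g h
  proof -
    obtain u m where "u \<in> V" "g = t u (m mod int N)" using syllables_cases[OF g] .
    then show ?thesis using reduce_turn h t_inv by (simp add: action_t)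
  qed
  have "\<forall>h\<in>carrier A. reduce (action g h) = reduce h \<otimes>\<^bsub>P\<^esub> inv\<^bsub>P\<^esub> g" if "g \<in> generate P syllables" for g
    using that
  proof induction
    case one
    then show ?case by (simp add: action_one reduce_closed)
  next
    case (incl g)
    then show ?case using t by blast
  next
    case (inv g)
    show ?case
    proof
      fix h assume h: "h \<in> carrier A"
      have g: "g \<in> carrier P" using inv syllables_closed by blast
      let ?h = "action (inv\<^bsub>P\<^esub> g) h"
      have hc: "?h \<in> carrier A" using g h by (simp add: action_closed)
      have "action g ?h = h" using g h by (simp add: action_mult[symmetric] action_one)
      then have "reduce h = reduce ?h \<otimes>\<^bsub>P\<^esub> inv\<^bsub>P\<^esub> g" using t[OF inv hc] by simp
      then show "reduce ?h = reduce h \<otimes>\<^bsub>P\<^esub> inv\<^bsub>P\<^esub> (inv\<^bsub>P\<^esub> g)"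
        using g reduce_closed[OF hc] by (simp add: P.m_assoc)
    qed
  next
    case (eng g g')
    then have g: "g \<in> carrier P" "g' \<in> carrier P" using syllables_generate by auto
    show ?case
    proof
      fix h assume h: "h \<in> carrier A"
      then have "action g' h \<in> carrier A" using g by (simp add: action_closed)
      then show "reduce (action (g \<otimes>\<^bsub>P\<^esub> g') h) = reduce h \<otimes>\<^bsub>P\<^esub> inv\<^bsub>P\<^esub> (g \<otimes>\<^bsub>P\<^esub> g')"
        using eng.IH g h reduce_closed[OF h] by (simp add: action_mult P.inv_mult_group P.m_assoc)
    qed
  qed
  then show ?thesis using assms syllables_generate by blast
qed

text \<open>
  The orbit map of the neutral element. It is a section of \<open>reduce\<close> but not a homomorphism.
\<close>
definition lift :: "('v \<times> int) list set set \<Rightarrow> ('v \<times> bool) list set set" where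
  "lift g = action (inv\<^bsub>P\<^esub> g) \<one>\<^bsub>A\<^esub>"

lemma lift_closed: "g \<in> carrier P \<Longrightarrow> lift g \<in> carrier A"
  by (simp add: lift_def action_closed)

lemma reduce_lift: "g \<in> carrier P \<Longrightarrow> reduce (lift g) = g"
  using group_hom.hom_one[OF reduce_group_hom] by (simp add: lift_def reduce_action)

lemma lift_inj: "inj_on lift (carrier P)"
  by (rule inj_on_inverseI[of _ reduce]) (rule reduce_lift)

lemma lift_one: "lift \<one>\<^bsub>P\<^esub> = \<one>\<^bsub>A\<^esub>"
  by (simp add: lift_def action_one)

lemma lift_turn:
  assumes "g \<in> carrier P" "u \<in> V"
  shows "lift (g \<otimes>\<^bsub>P\<^esub> t u (m mod int N)) = turn u m (lift g)"
proof -
  have "lift (g \<otimes>\<^bsub>P\<^esub> t u (m mod int N)) = action (t u (- m mod int N) \<otimes>\<^bsub>P\<^esub> inv\<^bsub>P\<^esub> g) \<one>\<^bsub>A\<^esub>"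
    using assms by (simp add: lift_def P.inv_mult_group t_inv)
  also have "\<dots> = turn u m (lift g)"
    using assms by (simp add: action_mult lift_def action_t)
  finally show ?thesis .
qed

lemma turn_lift_image:
  assumes "h \<in> lift ` carrier P" "u \<in> V"
  shows "turn u m h \<in> lift ` carrier P"
proof -
  obtain g where g: "g \<in> carrier P" "h = lift g" using assms by blast
  then have "g \<otimes>\<^bsub>P\<^esub> t u (m mod int N) \<in> carrier P" using assms by simp
  then show ?thesis using lift_turn[OF g(1) assms(2), of m] g(2) by (metis imageI)
qed

text \<open>
  As long as no block boundary is crossed, a turn is multiplication by the generator or its inverse. Thus
  the image of the section can be explored letter by letter by keeping track of exponent sums.
\<close>
lemma lift_image_up:
  assumes "h \<in> lift ` carrier P" "u \<in> V" "0 \<le> exponent u h" "exponent u h < int N - 1"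
  shows "h \<otimes>\<^bsub>A\<^esub> a u \<in> lift ` carrier P"
proof -
  have "h \<in> carrier A" using assms lift_closed by auto
  then have "turn u 1 h = h \<otimes>\<^bsub>A\<^esub> a u" using assms rotate_block_small[of "exponent u h" "int N" 1]
    by (simp add: turn_def)
  then show ?thesis using turn_lift_image[OF assms(1,2), of 1] by simp
qed

lemma lift_image_down:
  assumes "h \<in> lift ` carrier P" "u \<in> V" "0 < exponent u h" "exponent u h < int N"
  shows "h \<otimes>\<^bsub>A\<^esub> inv\<^bsub>A\<^esub> (a u) \<in> lift ` carrier P"
proof -
  have "h \<in> carrier A" using assms lift_closed by auto
  then have "turn u (-1) h = h \<otimes>\<^bsub>A\<^esub> inv\<^bsub>A\<^esub> (a u)" using assms rotate_block_small[of "exponent u h" "int N" "-1"]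
    by (simp add: turn_def A.int_pow_neg)
  then show ?thesis using turn_lift_image[OF assms(1,2), of "-1"] by simp
qed

definition small_powers where "small_powers = {a u [^]\<^bsub>A\<^esub> k |u k. u \<in> V \<and> k \<in> {- int N..int N}}"

lemma small_powers_closed: "small_powers \<subseteq> carrier A"
  by (auto simp: small_powers_def)

lemma finite_small_powers: "finite small_powers"
proof -
  have "small_powers = (\<lambda>(u, k). a u [^]\<^bsub>A\<^esub> k) ` (V \<times> {- int N..int N})"
    unfolding small_powers_def by fast
  then show ?thesis using finite_V by simp
qed

lemma lift_step:
  assumes g: "g \<in> carrier P" and s: "s \<in> syllables \<union> (\<lambda>s. inv\<^bsub>P\<^esub> s) ` syllables"
  shows "\<exists>k\<in>small_powers. lift (g \<otimes>\<^bsub>P\<^esub> s) = lift g \<otimes>\<^bsub>A\<^esub> k"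
proof -
  have "\<exists>u m. u \<in> V \<and> s = t u (m mod int N)"
  proof (cases "s \<in> syllables")
    case True
    then show ?thesis using syllables_cases by metis
  next
    case False
    then obtain s' where "s' \<in> syllables" "s = inv\<^bsub>P\<^esub> s'" using s by auto
    then show ?thesis using syllables_cases t_inv by metis
  qed
  then obtain u m where u: "u \<in> V" "s = t u (m mod int N)" by blast
  let ?k = "rotate_block (int N) m (exponent u (lift g)) - exponent u (lift g)"
  have "?k \<in> {- int N..int N}" using N3 by (intro rotate_block_diff_bound) simp
  then have "a u [^]\<^bsub>A\<^esub> ?k \<in> small_powers" using u(1) unfolding small_powers_def by blast
  moreover have "lift (g \<otimes>\<^bsub>P\<^esub> s) = lift g \<otimes>\<^bsub>A\<^esub> a u [^]\<^bsub>A\<^esub> ?k"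
    using lift_turn[OF g u(1), of m] lift_closed[OF g] by (simp add: u(2) turn_def)
  ultimately show ?thesis by blast
qed

text \<open>
  The commutators \<open>[u, v]\<close> and \<open>[u, v\<^sup>2]\<close>, for which all exponent sums vanish.
\<close>
definition letter_x where
  "letter_x u v = a u \<otimes>\<^bsub>A\<^esub> a v \<otimes>\<^bsub>A\<^esub> inv\<^bsub>A\<^esub> (a u) \<otimes>\<^bsub>A\<^esub> inv\<^bsub>A\<^esub> (a v)"

definition letter_y where
  "letter_y u v = a u \<otimes>\<^bsub>A\<^esub> a v \<otimes>\<^bsub>A\<^esub> a v \<otimes>\<^bsub>A\<^esub> inv\<^bsub>A\<^esub> (a u) \<otimes>\<^bsub>A\<^esub> inv\<^bsub>A\<^esub> (a v) \<otimes>\<^bsub>A\<^esub> inv\<^bsub>A\<^esub> (a v)"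

lemma letters_closed [simp]:
  "u \<in> V \<Longrightarrow> v \<in> V \<Longrightarrow> letter_x u v \<in> carrier A"
  "u \<in> V \<Longrightarrow> v \<in> V \<Longrightarrow> letter_y u v \<in> carrier A"
  by (simp_all add: letter_x_def letter_y_def)

text \<open>
  Starting from an exponent sum of \<open>u\<close> in \<open>{0, 1}\<close> and from \<open>0\<close> for \<open>v\<close>, all exponent sums met while
  spelling out a letter lie in \<open>{0, 1, 2}\<close>. The starting value \<open>1\<close> occurs for words that are multiplied by \<open>u\<close> on the left.
\<close>
lemma lift_image_letters:
  assumes h: "h \<in> lift ` carrier P" and uv: "u \<in> V" "v \<in> V" "u \<noteq> v"
    and e: "0 \<le> exponent u h" "exponent u h \<le> 1" "exponent v h = 0"
  shows "h \<otimes>\<^bsub>A\<^esub> letter_x u v \<in> lift ` carrier P" "h \<otimes>\<^bsub>A\<^esub> letter_y u v \<in> lift ` carrier P"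
proof -
  have hc: "h \<in> carrier A" using h lift_closed by auto
  note [simp] = exponent(2) hc uv uv(3)[symmetric]
  have 1: "h \<otimes>\<^bsub>A\<^esub> a u \<in> lift ` carrier P" by (rule lift_image_up) (use h e N3 in auto)
  have 2: "h \<otimes>\<^bsub>A\<^esub> a u \<otimes>\<^bsub>A\<^esub> a v \<in> lift ` carrier P" by (rule lift_image_up) (use 1 e N3 in auto)
  have 3: "h \<otimes>\<^bsub>A\<^esub> a u \<otimes>\<^bsub>A\<^esub> a v \<otimes>\<^bsub>A\<^esub> a v \<in> lift ` carrier P"
    by (rule lift_image_up) (use 2 e N3 in auto)
  have "h \<otimes>\<^bsub>A\<^esub> a u \<otimes>\<^bsub>A\<^esub> a v \<otimes>\<^bsub>A\<^esub> inv\<^bsub>A\<^esub> (a u) \<in> lift ` carrier P"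
    by (rule lift_image_down) (use 2 e N3 in auto)
  then have "h \<otimes>\<^bsub>A\<^esub> a u \<otimes>\<^bsub>A\<^esub> a v \<otimes>\<^bsub>A\<^esub> inv\<^bsub>A\<^esub> (a u) \<otimes>\<^bsub>A\<^esub> inv\<^bsub>A\<^esub> (a v) \<in> lift ` carrier P"
    by (rule lift_image_down) (use e N3 in auto)
  then show "h \<otimes>\<^bsub>A\<^esub> letter_x u v \<in> lift ` carrier P" by (simp add: letter_x_def A.m_assoc)
  have "h \<otimes>\<^bsub>A\<^esub> a u \<otimes>\<^bsub>A\<^esub> a v \<otimes>\<^bsub>A\<^esub> a v \<otimes>\<^bsub>A\<^esub> inv\<^bsub>A\<^esub> (a u) \<in> lift ` carrier P"
    by (rule lift_image_down) (use 3 e N3 in auto)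
  then have "h \<otimes>\<^bsub>A\<^esub> a u \<otimes>\<^bsub>A\<^esub> a v \<otimes>\<^bsub>A\<^esub> a v \<otimes>\<^bsub>A\<^esub> inv\<^bsub>A\<^esub> (a u) \<otimes>\<^bsub>A\<^esub> inv\<^bsub>A\<^esub> (a v) \<in> lift ` carrier P"
    by (rule lift_image_down) (use e N3 in auto)
  then have "h \<otimes>\<^bsub>A\<^esub> a u \<otimes>\<^bsub>A\<^esub> a v \<otimes>\<^bsub>A\<^esub> a v \<otimes>\<^bsub>A\<^esub> inv\<^bsub>A\<^esub> (a u) \<otimes>\<^bsub>A\<^esub> inv\<^bsub>A\<^esub> (a v) \<otimes>\<^bsub>A\<^esub> inv\<^bsub>A\<^esub> (a v) \<in> lift ` carrier P"
    by (rule lift_image_down) (use e N3 in auto)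
  then show "h \<otimes>\<^bsub>A\<^esub> letter_y u v \<in> lift ` carrier P" by (simp add: letter_y_def A.m_assoc)
qed

lemma lift_image_words:
  assumes "h \<in> lift ` carrier P" and uv: "u \<in> V" "v \<in> V" "u \<noteq> v"
    and "0 \<le> exponent u h" "exponent u h \<le> 1" "exponent v h = 0"
  shows "h \<otimes>\<^bsub>A\<^esub> two_letter_word A (letter_x u v) (letter_y u v) w \<in> lift ` carrier P"
  using assms(1,5-)
proof (induction w arbitrary: h)
  case Nil
  then show ?case using lift_closed by auto
next
  case (Cons b w)
  define l where "l = (if b then letter_x u v else letter_y u v)"
  have hc: "h \<in> carrier A" using Cons.prems lift_closed by auto
  have lc: "l \<in> carrier A" using uv by (simp add: l_def)
  have ec: "two_letter_word A (letter_x u v) (letter_y u v) w \<in> carrier A" using uv by (simp add: A.two_letter_word_closed)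
  have "exponent z l = 0" for z using uv by (simp add: l_def letter_x_def letter_y_def)
  then have "exponent z (h \<otimes>\<^bsub>A\<^esub> l) = exponent z h" for z using hc lc by simp
  moreover have "h \<otimes>\<^bsub>A\<^esub> l \<in> lift ` carrier P"
    using lift_image_letters[OF Cons.prems(1) uv Cons.prems(2-)] by (simp add: l_def)
  ultimately have "(h \<otimes>\<^bsub>A\<^esub> l) \<otimes>\<^bsub>A\<^esub> two_letter_word A (letter_x u v) (letter_y u v) w \<in> lift ` carrier P"
    using Cons.IH Cons.prems by simp
  then show ?case using hc lc ec by (simp add: A.m_assoc l_def)
qed

text \<open>
  As \<open>u\<close> and \<open>v\<close> are not adjacent, they may be sent to arbitrary matrices, the other
  generators going to the identity. Let \<open>u\<close> and \<open>v\<close> act on integer vectors by the elements of order four and three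
  which generate the modular group \<open>SL\<^sub>2(\<int>)\<close>. Then \<open>[u, v]\<close> acts by the positive matrix with rows \<open>(2, 1)\<close> and \<open>(1, 1)\<close>, and
  \<open>[u, v\<^sup>2]\<close> by the one with rows \<open>(1, 1)\<close> and \<open>(1, 2)\<close>. The first maps positive vectors to vectors with a larger first
  coordinate, the second to vectors with a larger second coordinate, so the image of \<open>(1, 1)\<close> reveals
  the first letter of a word (ping-pong).
\<close>
lemma letters_free:
  assumes uv: "u \<in> V" "v \<in> V" "u \<noteq> v" "(u, v) \<notin> parcs \<Gamma>"
  shows "inj_on (two_letter_word A (letter_x u v) (letter_y u v)) {w. length w = n}"
proof -
  let ?B = "BijGroup (UNIV :: (int \<times> int) set)"
  interpret B: group ?B by (rule group_BijGroup)
  define S where "S = (\<lambda>z::int \<times> int. (- snd z, fst z))"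
  define S' where "S' = (\<lambda>z::int \<times> int. (snd z, - fst z))"
  define Q where "Q = (\<lambda>z::int \<times> int. (snd z, - fst z - snd z))"
  define Q' where "Q' = (\<lambda>z::int \<times> int. (- fst z - snd z, fst z))"
  have bij: "f \<in> carrier ?B" if "\<And>z. f (g z) = z" "\<And>z. g (f z) = z" for f g :: "int \<times> int \<Rightarrow> int \<times> int"
  proof -
    have "bij f" by (rule bij_betw_byWitness[of UNIV g f UNIV]) (simp_all add: that)
    then show ?thesis by (simp add: carrier_BijGroup Bij_def)
  qed
  have mult: "(f \<otimes>\<^bsub>?B\<^esub> g) z = f (g z)" if "f \<in> carrier ?B" "g \<in> carrier ?B" for f g z
    using that unfolding carrier_BijGroup by (intro BijGroup_mult) simp_all
  have one: "\<one>\<^bsub>?B\<^esub> z = z" for z by (rule BijGroup_one) simp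
  have S: "S \<in> carrier ?B" by (rule bij[of S S']) (simp_all add: S_def S'_def)
  have S': "S' \<in> carrier ?B" by (rule bij[of S' S]) (simp_all add: S_def S'_def)
  have Q: "Q \<in> carrier ?B" by (rule bij[of Q Q']) (simp_all add: Q_def Q'_def)
  have Q': "Q' \<in> carrier ?B" by (rule bij[of Q' Q]) (simp_all add: Q_def Q'_def)
  have invS: "inv\<^bsub>?B\<^esub> S = S'"
  proof (rule B.inv_equality[OF _ S S'])
    show "S' \<otimes>\<^bsub>?B\<^esub> S = \<one>\<^bsub>?B\<^esub>" by (rule ext) (simp add: mult[OF S' S] one, simp add: S_def S'_def)
  qed
  have invQ: "inv\<^bsub>?B\<^esub> Q = Q'"
  proof (rule B.inv_equality[OF _ Q Q'])
    show "Q' \<otimes>\<^bsub>?B\<^esub> Q = \<one>\<^bsub>?B\<^esub>" by (rule ext) (simp add: mult[OF Q' Q] one, simp add: Q_def Q'_def)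
  qed
  define \<phi> where "\<phi> w = (if w = u then S else if w = v then Q else \<one>\<^bsub>?B\<^esub>)" for w
  have \<phi>: "\<phi> w \<in> carrier ?B" for w using S Q by (simp add: \<phi>_def)
  have \<phi>_comm: "\<phi> w \<otimes>\<^bsub>?B\<^esub> \<phi> w' = \<phi> w' \<otimes>\<^bsub>?B\<^esub> \<phi> w" if w: "(w, w') \<in> parcs \<Gamma>" for w w'
  proof -
    have "\<not> (w = u \<and> w' = v)" "\<not> (w = v \<and> w' = u)" using w uv(4) arc_sym by blast+
    then consider "w = w'" | "w \<noteq> u" "w \<noteq> v" | "w' \<noteq> u" "w' \<noteq> v" by blast
    then show ?thesis
    proof cases
      case 1
      then show ?thesis by simp
    next
      case 2
      then have "\<phi> w = \<one>\<^bsub>?B\<^esub>" by (simp only: \<phi>_def if_False)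
      then show ?thesis using \<phi>[of w'] by (simp only: B.l_one B.r_one)
    next
      case 3
      then have "\<phi> w' = \<one>\<^bsub>?B\<^esub>" by (simp only: \<phi>_def if_False)
      then show ?thesis using \<phi>[of w] by (simp only: B.l_one B.r_one)
    qed
  qed
  obtain \<theta> where \<theta>: "\<theta> \<in> hom A ?B" "\<And>w. w \<in> V \<Longrightarrow> \<theta> (a w) = \<phi> w"
  proof (rule raag_lift[OF wf B.is_group, of \<phi>])
    fix h assume h: "h \<in> hom A ?B" "\<And>w. w \<in> V \<Longrightarrow> h (a w) = \<phi> w"
    show thesis by (rule that[OF h])
  next
    show "\<phi> w \<in> carrier ?B" for w by (rule \<phi>)
    show "\<phi> w \<otimes>\<^bsub>?B\<^esub> \<phi> w' = \<phi> w' \<otimes>\<^bsub>?B\<^esub> \<phi> w" if "(w, w') \<in> parcs \<Gamma>" for w w'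
      using that by (rule \<phi>_comm)
  qed
  interpret \<theta>: group_hom A ?B \<theta> using \<theta>(1) A.is_group B.is_group
    by (simp add: group_hom_def group_hom_axioms_def)
  have \<theta>u: "\<theta> (a u) = S" "\<theta> (a v) = Q" using \<theta>(2) uv by (simp_all add: \<phi>_def)
  have x: "\<theta> (letter_x u v) z = (2 * fst z + snd z, fst z + snd z)" for z
  proof -
    have "\<theta> (letter_x u v) = S \<otimes>\<^bsub>?B\<^esub> Q \<otimes>\<^bsub>?B\<^esub> S' \<otimes>\<^bsub>?B\<^esub> Q'"
      using uv by (simp only: letter_x_def \<theta>.hom_mult \<theta>.hom_inv \<theta>u invS invQ a_closed
          A.m_closed A.inv_closed)
    then have "\<theta> (letter_x u v) z = S (Q (S' (Q' z)))"
      by (simp only: mult B.m_closed S Q S' Q')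
    then show ?thesis by (simp add: S_def S'_def Q_def Q'_def)
  qed
  have y: "\<theta> (letter_y u v) z = (fst z + snd z, fst z + 2 * snd z)" for z
  proof -
    have "\<theta> (letter_y u v) = S \<otimes>\<^bsub>?B\<^esub> Q \<otimes>\<^bsub>?B\<^esub> Q \<otimes>\<^bsub>?B\<^esub> S' \<otimes>\<^bsub>?B\<^esub> Q' \<otimes>\<^bsub>?B\<^esub> Q'"
      using uv by (simp only: letter_y_def \<theta>.hom_mult \<theta>.hom_inv \<theta>u invS invQ a_closed
          A.m_closed A.inv_closed)
    then have "\<theta> (letter_y u v) z = S (Q (Q (S' (Q' (Q' z)))))"
      by (simp only: mult B.m_closed S Q S' Q')
    then show ?thesis by (simp add: S_def S'_def Q_def Q'_def)
  qed
  let ?E = "two_letter_word A (letter_x u v) (letter_y u v)"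
  let ?z = "\<lambda>w. \<theta> (?E w) (1, 1)"
  have Ec: "?E w \<in> carrier A" for w using uv by (simp add: A.two_letter_word_closed)
  have cons: "?z (b # w) = (if b then (2 * fst (?z w) + snd (?z w), fst (?z w) + snd (?z w))
      else (fst (?z w) + snd (?z w), fst (?z w) + 2 * snd (?z w)))" for b w
    using uv Ec[of w] \<theta>.hom_closed by (simp add: mult x y)
  have pos: "0 < fst (?z w) \<and> 0 < snd (?z w)" for w
  proof (induction w)
    case Nil
    show ?case by (simp add: one)
  next
    case (Cons b w)
    then show ?case unfolding cons by (cases b) simp_all
  qed
  have first: "snd (?z (b # w)) < fst (?z (b # w)) \<longleftrightarrow> b" for b w
    unfolding cons using pos[of w] by (cases b) simp_all
  have "w = w'" if "length w = length w'" "?E w = ?E w'" for w w'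
    using that
  proof (induction w w' rule: list_induct2)
    case (Cons b w b' w')
    have "b = b'" using first[of b w] first[of b' w'] Cons.prems by metis
    moreover have "?E w = ?E w'"
      using Cons.prems \<open>b = b'\<close> uv Ec[of w] Ec[of w'] by (cases b) simp_all
    ultimately show ?case using Cons.IH by simp
  qed simp
  then show ?thesis by (intro inj_onI) simp
qed

lemma coarsely_separable_graph_product:
  assumes nonadj: "\<And>u. u \<in> V \<Longrightarrow> \<exists>v\<in>V. v \<noteq> u \<and> (u, v) \<notin> parcs \<Gamma>"
    and sep: "coarsely_separable_subexp A"
  shows "coarsely_separable_subexp P"
proof (rule coarsely_separable_subexp_pullback[where f = lift and U = "a ` V" and K = small_powers and T = syllables, OF _ _ _ _ _ _ _ _ _ _ _ _ _ _ sep])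
  show "group A" "group P" by (rule A.is_group P.is_group)+
  show "finite syllables" "syllables \<subseteq> carrier P" "generate P syllables = carrier P" by (rule finite_syllables syllables_closed syllables_generate)+
  show "lift \<in> carrier P \<rightarrow> carrier A" using lift_closed by blast
  show "inj_on lift (carrier P)" by (rule lift_inj)
  have one: "\<one>\<^bsub>A\<^esub> \<in> lift ` carrier P" using lift_one P.one_closed by (metis imageI)
  then show "\<one>\<^bsub>A\<^esub> \<in> lift ` carrier P" .
  show "finite small_powers" "small_powers \<subseteq> carrier A" by (rule finite_small_powers small_powers_closed)+
  show "\<exists>k\<in>small_powers. lift (h \<otimes>\<^bsub>P\<^esub> s) = lift h \<otimes>\<^bsub>A\<^esub> k" if "h \<in> carrier P" "s \<in> syllables \<union> (\<lambda>s. inv\<^bsub>P\<^esub> s) ` syllables" for h s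
    using lift_step that .
  show "a ` V \<subseteq> carrier A" by auto
  show "generate A (a ` V) = carrier A" by (rule raag_generate[OF wf])
  fix c assume "c \<in> a ` V"
  then obtain u where u: "u \<in> V" "c = a u" by blast
  then obtain v where v: "v \<in> V" "v \<noteq> u" "(u, v) \<notin> parcs \<Gamma>" using nonadj by blast
  let ?E = "two_letter_word A (letter_x u v) (letter_y u v)"
  have "?E w \<in> lift ` carrier P" for w
    using lift_image_words[OF one u(1) v(1) v(2)[symmetric], of w] u v by (simp add: A.two_letter_word_closed)
  moreover have "a u \<in> lift ` carrier P" using lift_image_up[OF one u(1)] u N3 by simp
  then have "a u \<otimes>\<^bsub>A\<^esub> ?E w \<in> lift ` carrier P" for w
    using lift_image_words[of "a u" u v w] u v by (simp add: exponent(2))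
  ultimately show "\<exists>x\<in>carrier A. \<exists>y\<in>carrier A. (\<forall>n. inj_on (two_letter_word A x y) {w. length w = n}) \<and>
      (\<forall>w. two_letter_word A x y w \<in> lift ` carrier P \<and> c \<otimes>\<^bsub>A\<^esub> two_letter_word A x y w \<in> lift ` carrier P)"
    using letters_free[OF u(1) v(1) v(2)[symmetric] v(3)] u v
    by (intro bexI[of _ "letter_x u v"] bexI[of _ "letter_y u v"]) auto
qed

end

theorem theorem1p3:
  fixes \<Gamma> :: "'v pair_pre_digraph"
  assumes "pair_graph \<Gamma>"
    and "\<not> is_join \<Gamma>"
    and "card (pverts \<Gamma>) \<ge> 2"
    and "coarsely_separable_subexp (raag \<Gamma>)"
  shows "\<forall>k::nat. \<exists>\<nu> :: 'v \<Rightarrow> nat.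
           (\<forall>u\<in>pverts \<Gamma>. \<nu> u \<ge> 2) \<and> (\<forall>u\<in>pverts \<Gamma>. \<nu> u \<ge> k) \<and>
           coarsely_separable_subexp (cyclic_graph_product \<Gamma> \<nu>)"
proof
  fix k :: nat
  interpret raag_with_weight \<Gamma> "max k 3" by (rule raag_with_weight.intro) (use assms(1) in simp_all)
  \<comment> \<open>Otherwise \<open>{u}\<close> and \<open>V - {u}\<close> exhibit the graph as a join.\<close>
  have "\<exists>v\<in>V. v \<noteq> u \<and> (u, v) \<notin> parcs \<Gamma>" if u: "u \<in> V" for u
  proof (rule ccontr)
    assume "\<not> ?thesis"
    moreover have "V - {u} \<noteq> {}"
    proof
      assume "V - {u} = {}"
      then have "V \<subseteq> {u}" by blast
      then have "card V \<le> 1" using card_mono[of "{u}" V] by simp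
      then show False using assms(3) by simp
    qed
    ultimately have "is_join \<Gamma>" unfolding is_join_def
      using u by (intro exI[of _ "{u}"] exI[of _ "V - {u}"]) auto
    then show False using assms(2) by simp
  qed
  then have "coarsely_separable_subexp (cyclic_graph_product \<Gamma> (\<lambda>_. max k 3))"
    using assms(4) by (rule coarsely_separable_graph_product)
  then show "\<exists>\<nu> :: 'v \<Rightarrow> nat. (\<forall>u\<in>pverts \<Gamma>. \<nu> u \<ge> 2) \<and> (\<forall>u\<in>pverts \<Gamma>. \<nu> u \<ge> k) \<and>
           coarsely_separable_subexp (cyclic_graph_product \<Gamma> \<nu>)"
    by (intro exI[of _ "\<lambda>_. max k 3"]) auto
qed

end
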